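(* Let $A$ be a strict monoidal category. The 2-functor $(-)\times A\colon \mathbf{Cat}\to A\text{-}\mathbf{Mod}\text{-}A$ has a right adjoint (in the 2-categorical sense) sending an $A$-bimodule $X$ to $H^0(A,X)$.
   Context: $\mathbf{Cat}$ is the 2-category of categories, functors and natural transformations. $A$ is a strict monoidal category, with tensor product written $a\otimes b$ or $ab$, and unit $i$. **Bimodules.** An $A$-bimodule is a category $X$ with a strict left action $A\times X\to X$, $(a,x)\mapsto ax$, and a strict right action $X\times A\to X$, $(x,a)\mapsto xa$ (functors satisfying the associativity and unit laws strictly), together with maps $\lambda_{a,x,b}\colon a(xb)\to (ax)b$, natural in $a,b\in A$ and $x\in X$ and not required to be invertible, such that - $\lambda_{aa',x,b}=\lambda_{a,a'x,b}\circ a\lambda_{a',x,b}$ and $\lambda_{i,x,b}=1_{xb}$; - $\lambda_{a,x,bb'}=(\lambda_{a,x,b})b'\circ\lambda_{a,xb,b'}$ and $\lambda_{a,x,i}=1_{ax}$. **Morphisms of bimodules.** A morphism $X\to Y$ is a functor $p\colon X\to Y$ with $p(xb)=p(x)b$ (strictly, on objects and morphisms), together with maps $\rho_{a,x}\colon a\,p(x)\to p(ax)$ natural in $a$ and $x$, such that $\rho_{i,x}=1$, $\rho_{ab,x}=\rho_{a,bx}\circ a\rho_{b,x}$, and $$p(\lambda_{a,x,b})\circ\rho_{a,xb}=(\rho_{a,x})b\circ\lambda_{a,p(x),b}\colon a\,p(xb)=a(p(x)b)\to p(ax)b=p((ax)b).$$ **2-cells.** A 2-cell $(p,\rho)\to(p',\rho')$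 is a natural transformation $\tau\colon p\to p'$ with $\rho'_{a,x}\circ a\tau_x=\tau_{ax}\circ\rho_{a,x}$ and $\tau_{xb}=(\tau_x)b$. These form the 2-category $A\text{-}\mathbf{Mod}\text{-}A$. **The 2-functor $(-)\times A$.** It sends a category $P$ to $P\times A$ with actions $a(y,b)=(y,ab)$ and $(y,b)a=(y,ba)$ and with all $\lambda$ identities. It sends a functor $F\colon P\to Q$ to $F\times A$ with $\rho$ the identity, and acts similarly on natural transformations. **Lax zeroth Hochschild cohomology.** For an $A$-bimodule $X$, the category $H^0(A,X)$ is the lax descent object of the Hochschild data of $X$. Explicitly, an object is an object $x\in X$ equipped with maps $\xi_a\colon ax\to xa$ natural in $a\in A$ such that $\xi_i=1_x$ and, for all $a,b\in A$, $$(\xi_a)b\circ\lambda_{a,x,b}\circ a\xi_b=\xi_{ab}\colon (ab)x=a(bx)\to (xa)b=x(ab).$$ A morphism $(x,\xi)\to(x',\xi')$ is a morphism $f\colon x\to x'$ in $X$ with $\xi'_a\circ af=fa\circ\xi_a$ for all $a\in A$. *)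

theory Defs
  imports Main "HOL-Library.FuncSet"
begin

section \<open>Categories, functors, natural transformations\<close>

record ('o, 'm) cat =
  Ob :: "'o set"
  Ar :: "'m set"
  Dom :: "'m \<Rightarrow> 'o"
  Cod :: "'m \<Rightarrow> 'o"
  Id :: "'o \<Rightarrow> 'm"
  Comp :: "'m \<Rightarrow> 'm \<Rightarrow> 'm"  (infixl "\<cdot>\<index>" 70)

text \<open>\<open>g \<cdot>\<^bsub>C\<^esub> f\<close> is ``\<open>g\<close> after \<open>f\<close>''.\<close>

definition hom :: "('o, 'm, 'z) cat_scheme \<Rightarrow> 'o \<Rightarrow> 'o \<Rightarrow> 'm set" where
  "hom C x y = {f \<in> Ar C. Dom C f = x \<and> Cod C f = y}"

locale category =
  fixes C :: "('o, 'm, 'z) cat_scheme"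
  assumes dom_ob: "f \<in> Ar C \<Longrightarrow> Dom C f \<in> Ob C"
    and cod_ob: "f \<in> Ar C \<Longrightarrow> Cod C f \<in> Ob C"
    and id_hom: "x \<in> Ob C \<Longrightarrow> Id C x \<in> hom C x x"
    and comp_hom: "f \<in> hom C x y \<Longrightarrow> g \<in> hom C y z \<Longrightarrow> g \<cdot>\<^bsub>C\<^esub> f \<in> hom C x z"
    and id_left: "f \<in> hom C x y \<Longrightarrow> Id C y \<cdot>\<^bsub>C\<^esub> f = f"
    and id_right: "f \<in> hom C x y \<Longrightarrow> f \<cdot>\<^bsub>C\<^esub> Id C x = f"
    and comp_assoc: "f \<in> hom C w x \<Longrightarrow> g \<in> hom C x y \<Longrightarrow> h \<in> hom C y z \<Longrightarrow>
      h \<cdot>\<^bsub>C\<^esub> (g \<cdot>\<^bsub>C\<^esub> f) = (h \<cdot>\<^bsub>C\<^esub> g) \<cdot>\<^bsub>C\<^esub> f"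

definition prod_cat ::
  "('o, 'm, 'z) cat_scheme \<Rightarrow> ('p, 'n, 'w) cat_scheme \<Rightarrow> ('o \<times> 'p, 'm \<times> 'n) cat" where
  "prod_cat C D =
    \<lparr>Ob = Ob C \<times> Ob D, Ar = Ar C \<times> Ar D,
     Dom = (\<lambda>(f, g). (Dom C f, Dom D g)), Cod = (\<lambda>(f, g). (Cod C f, Cod D g)),
     Id = (\<lambda>(x, y). (Id C x, Id D y)),
     Comp = (\<lambda>(f', g') (f, g). (f' \<cdot>\<^bsub>C\<^esub> f, g' \<cdot>\<^bsub>D\<^esub> g))\<rparr>"

text \<open>The maps of a functor, and all component families of morphisms of categories and bimodules,
  are required to be \<^const>\<open>extensional\<close> (equal to \<^const>\<open>undefined\<close> off their domain), so that
  HOL equality of functors, transformations etc.\ is equality of the mathematical objects.\<close>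

record ('o, 'm, 'p, 'n) ftr =
  FO :: "'o \<Rightarrow> 'p"
  FA :: "'m \<Rightarrow> 'n"

locale is_functor = dom: category C + cod: category D
  for C :: "('o, 'm, 'z) cat_scheme" and D :: "('p, 'n, 'w) cat_scheme" +
  fixes F :: "('o, 'm, 'p, 'n) ftr"
  assumes FO_map: "FO F \<in> Ob C \<rightarrow>\<^sub>E Ob D"
    and FA_map: "FA F \<in> Ar C \<rightarrow>\<^sub>E Ar D"
    and FA_dom: "f \<in> Ar C \<Longrightarrow> Dom D (FA F f) = FO F (Dom C f)"
    and FA_cod: "f \<in> Ar C \<Longrightarrow> Cod D (FA F f) = FO F (Cod C f)"
    and FA_id: "x \<in> Ob C \<Longrightarrow> FA F (Id C x) = Id D (FO F x)"
    and FA_comp: "f \<in> hom C x y \<Longrightarrow> g \<in> hom C y z \<Longrightarrow>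
      FA F (g \<cdot>\<^bsub>C\<^esub> f) = FA F g \<cdot>\<^bsub>D\<^esub> FA F f"

definition ftr_on ::
  "('o, 'm, 'z) cat_scheme \<Rightarrow> ('o \<Rightarrow> 'p) \<Rightarrow> ('m \<Rightarrow> 'n) \<Rightarrow> ('o, 'm, 'p, 'n) ftr" where
  "ftr_on C fo fa = \<lparr>FO = restrict fo (Ob C), FA = restrict fa (Ar C)\<rparr>"

definition id_ftr :: "('o, 'm, 'z) cat_scheme \<Rightarrow> ('o, 'm, 'o, 'm) ftr" where
  "id_ftr C = ftr_on C (\<lambda>x. x) (\<lambda>f. f)"

text \<open>\<open>comp_ftr C G F\<close> is \<open>G\<close> after \<open>F\<close>, where \<open>C\<close> is the source category of \<open>F\<close>.\<close>

definition comp_ftr ::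
  "('o, 'm, 'z) cat_scheme \<Rightarrow> ('p, 'n, 'q, 'k) ftr \<Rightarrow> ('o, 'm, 'p, 'n) ftr \<Rightarrow> ('o, 'm, 'q, 'k) ftr" where
  "comp_ftr C G F = ftr_on C (\<lambda>x. FO G (FO F x)) (\<lambda>f. FA G (FA F f))"

locale is_nat = src: is_functor C D F + tgt: is_functor C D G
  for C :: "('o, 'm, 'z) cat_scheme" and D :: "('p, 'n, 'w) cat_scheme"
    and F G :: "('o, 'm, 'p, 'n) ftr" +
  fixes \<tau> :: "'o \<Rightarrow> 'n"
  assumes nat_ext: "\<tau> \<in> extensional (Ob C)"
    and nat_hom: "x \<in> Ob C \<Longrightarrow> \<tau> x \<in> hom D (FO F x) (FO G x)"
    and natural: "f \<in> Ar C \<Longrightarrow> \<tau> (Cod C f) \<cdot>\<^bsub>D\<^esub> FA F f = FA G f \<cdot>\<^bsub>D\<^esub> \<tau> (Dom C f)"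

text \<open>A 2-cell records its source and target together with its components.\<close>

record ('f, 'o, 'm) cell =
  Src :: 'f
  Tgt :: 'f
  Cmp :: "'o \<Rightarrow> 'm"

definition fun_cat ::
  "('o, 'm) cat \<Rightarrow> ('p, 'n) cat \<Rightarrow>
    (('o, 'm, 'p, 'n) ftr, (('o, 'm, 'p, 'n) ftr, 'o, 'n) cell) cat" where
  "fun_cat C D =
    \<lparr>Ob = {F. is_functor C D F},
     Ar = {t. is_nat C D (Src t) (Tgt t) (Cmp t)},
     Dom = Src, Cod = Tgt,
     Id = (\<lambda>F. \<lparr>Src = F, Tgt = F, Cmp = (\<lambda>x\<in>Ob C. Id D (FO F x))\<rparr>),
     Comp = (\<lambda>s t. \<lparr>Src = Src t, Tgt = Tgt s, Cmp = (\<lambda>x\<in>Ob C. Cmp s x \<cdot>\<^bsub>D\<^esub> Cmp t x)\<rparr>)\<rparr>"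


section \<open>Strict 2-categories, 2-functors, 2-adjunctions\<close>

text \<open>2-categories as \<open>Cat\<close>-enriched categories: \<open>HomC K x y\<close> is the category of 1-cells \<open>x \<rightarrow> y\<close> and
  2-cells between them, and \<open>HC K x y z\<close> the composition functor
  \<open>HomC K y z \<times> HomC K x y \<rightarrow> HomC K x z\<close>.\<close>

record ('c, 'f, 't) two_cat =
  Obj :: "'c set"
  HomC :: "'c \<Rightarrow> 'c \<Rightarrow> ('f, 't) cat"
  One :: "'c \<Rightarrow> 'f"
  HC :: "'c \<Rightarrow> 'c \<Rightarrow> 'c \<Rightarrow> ('f \<times> 'f, 't \<times> 't, 'f, 't) ftr"

abbreviation One2 :: "('c, 'f, 't) two_cat \<Rightarrow> 'c \<Rightarrow> 't" where
  "One2 K x \<equiv> Id (HomC K x x) (One K x)"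

locale two_category =
  fixes K :: "('c, 'f, 't) two_cat"
  assumes hom_category: "x \<in> Obj K \<Longrightarrow> y \<in> Obj K \<Longrightarrow> category (HomC K x y)"
    and one_ob: "x \<in> Obj K \<Longrightarrow> One K x \<in> Ob (HomC K x x)"
    and hc_functor: "x \<in> Obj K \<Longrightarrow> y \<in> Obj K \<Longrightarrow> z \<in> Obj K \<Longrightarrow>
      is_functor (prod_cat (HomC K y z) (HomC K x y)) (HomC K x z) (HC K x y z)"
    and hc_one_left: "x \<in> Obj K \<Longrightarrow> y \<in> Obj K \<Longrightarrow> f \<in> Ob (HomC K x y) \<Longrightarrow>
      FO (HC K x y y) (One K y, f) = f"
    and hc_one_left2: "x \<in> Obj K \<Longrightarrow> y \<in> Obj K \<Longrightarrow> t \<in> Ar (HomC K x y) \<Longrightarrow>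
      FA (HC K x y y) (One2 K y, t) = t"
    and hc_one_right: "x \<in> Obj K \<Longrightarrow> y \<in> Obj K \<Longrightarrow> f \<in> Ob (HomC K x y) \<Longrightarrow>
      FO (HC K x x y) (f, One K x) = f"
    and hc_one_right2: "x \<in> Obj K \<Longrightarrow> y \<in> Obj K \<Longrightarrow> t \<in> Ar (HomC K x y) \<Longrightarrow>
      FA (HC K x x y) (t, One2 K x) = t"
    and hc_assoc: "w \<in> Obj K \<Longrightarrow> x \<in> Obj K \<Longrightarrow> y \<in> Obj K \<Longrightarrow> z \<in> Obj K \<Longrightarrow>
      f \<in> Ob (HomC K w x) \<Longrightarrow> g \<in> Ob (HomC K x y) \<Longrightarrow> h \<in> Ob (HomC K y z) \<Longrightarrow>
      FO (HC K w y z) (h, FO (HC K w x y) (g, f)) = FO (HC K w x z) (FO (HC K x y z) (h, g), f)"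
    and hc_assoc2: "w \<in> Obj K \<Longrightarrow> x \<in> Obj K \<Longrightarrow> y \<in> Obj K \<Longrightarrow> z \<in> Obj K \<Longrightarrow>
      r \<in> Ar (HomC K w x) \<Longrightarrow> s \<in> Ar (HomC K x y) \<Longrightarrow> t \<in> Ar (HomC K y z) \<Longrightarrow>
      FA (HC K w y z) (t, FA (HC K w x y) (s, r)) = FA (HC K w x z) (FA (HC K x y z) (t, s), r)"

record ('c, 'f, 't, 'd, 'g, 's) two_ftr =
  T0 :: "'c \<Rightarrow> 'd"
  T1 :: "'c \<Rightarrow> 'c \<Rightarrow> ('f, 't, 'g, 's) ftr"

locale two_functor = dom: two_category K + cod: two_category L
  for K :: "('c, 'f, 't) two_cat" and L :: "('d, 'g, 's) two_cat" +
  fixes T :: "('c, 'f, 't, 'd, 'g, 's) two_ftr"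
  assumes T0_obj: "x \<in> Obj K \<Longrightarrow> T0 T x \<in> Obj L"
    and T1_functor: "x \<in> Obj K \<Longrightarrow> y \<in> Obj K \<Longrightarrow>
      is_functor (HomC K x y) (HomC L (T0 T x) (T0 T y)) (T1 T x y)"
    and T1_one: "x \<in> Obj K \<Longrightarrow> FO (T1 T x x) (One K x) = One L (T0 T x)"
    and T1_hc: "x \<in> Obj K \<Longrightarrow> y \<in> Obj K \<Longrightarrow> z \<in> Obj K \<Longrightarrow>
      f \<in> Ob (HomC K x y) \<Longrightarrow> g \<in> Ob (HomC K y z) \<Longrightarrow>
      FO (T1 T x z) (FO (HC K x y z) (g, f)) =
      FO (HC L (T0 T x) (T0 T y) (T0 T z)) (FO (T1 T y z) g, FO (T1 T x y) f)"
    and T1_hc2: "x \<in> Obj K \<Longrightarrow> y \<in> Obj K \<Longrightarrow> z \<in> Obj K \<Longrightarrow>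
      s \<in> Ar (HomC K x y) \<Longrightarrow> t \<in> Ar (HomC K y z) \<Longrightarrow>
      FA (T1 T x z) (FA (HC K x y z) (t, s)) =
      FA (HC L (T0 T x) (T0 T y) (T0 T z)) (FA (T1 T y z) t, FA (T1 T x y) s)"

definition id_two_ftr :: "('c, 'f, 't) two_cat \<Rightarrow> ('c, 'f, 't, 'c, 'f, 't) two_ftr" where
  "id_two_ftr K = \<lparr>T0 = (\<lambda>x. x), T1 = (\<lambda>x y. id_ftr (HomC K x y))\<rparr>"

definition comp_two_ftr ::
  "('c, 'f, 't) two_cat \<Rightarrow> ('d, 'g, 's, 'e, 'h, 'r) two_ftr \<Rightarrow> ('c, 'f, 't, 'd, 'g, 's) two_ftr \<Rightarrow>
    ('c, 'f, 't, 'e, 'h, 'r) two_ftr" where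
  "comp_two_ftr K S T =
    \<lparr>T0 = (\<lambda>x. T0 S (T0 T x)),
     T1 = (\<lambda>x y. comp_ftr (HomC K x y) (T1 S (T0 T x) (T0 T y)) (T1 T x y))\<rparr>"

locale two_natural = src: two_functor K L S + tgt: two_functor K L T
  for K :: "('c, 'f, 't) two_cat" and L :: "('d, 'g, 's) two_cat"
    and S T :: "('c, 'f, 't, 'd, 'g, 's) two_ftr" +
  fixes \<alpha> :: "'c \<Rightarrow> 'g"
  assumes component: "x \<in> Obj K \<Longrightarrow> \<alpha> x \<in> Ob (HomC L (T0 S x) (T0 T x))"
    and natural1: "x \<in> Obj K \<Longrightarrow> y \<in> Obj K \<Longrightarrow> f \<in> Ob (HomC K x y) \<Longrightarrow>
      FO (HC L (T0 S x) (T0 S y) (T0 T y)) (\<alpha> y, FO (T1 S x y) f) =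
      FO (HC L (T0 S x) (T0 T x) (T0 T y)) (FO (T1 T x y) f, \<alpha> x)"
    and natural2: "x \<in> Obj K \<Longrightarrow> y \<in> Obj K \<Longrightarrow> t \<in> Ar (HomC K x y) \<Longrightarrow>
      FA (HC L (T0 S x) (T0 S y) (T0 T y)) (Id (HomC L (T0 S y) (T0 T y)) (\<alpha> y), FA (T1 S x y) t) =
      FA (HC L (T0 S x) (T0 T x) (T0 T y)) (FA (T1 T x y) t, Id (HomC L (T0 S x) (T0 T x)) (\<alpha> x))"

text \<open>\<open>T \<stileturn> R\<close> in the 2-categorical (that is, \<open>Cat\<close>-enriched) sense.\<close>

locale two_adjunction =
  left: two_functor K L T + right: two_functor L K R +
  unit: two_natural K K "id_two_ftr K" "comp_two_ftr K R T" \<eta> +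
  counit: two_natural L L "comp_two_ftr L T R" "id_two_ftr L" \<epsilon>
  for K :: "('c, 'f, 't) two_cat" and L :: "('d, 'g, 's) two_cat"
    and T :: "('c, 'f, 't, 'd, 'g, 's) two_ftr" and R :: "('d, 'g, 's, 'c, 'f, 't) two_ftr"
    and \<eta> :: "'c \<Rightarrow> 'f" and \<epsilon> :: "'d \<Rightarrow> 'g" +
  assumes triangle_left: "x \<in> Obj K \<Longrightarrow>
      FO (HC L (T0 T x) (T0 T (T0 R (T0 T x))) (T0 T x))
        (\<epsilon> (T0 T x), FO (T1 T x (T0 R (T0 T x))) (\<eta> x)) = One L (T0 T x)"
    and triangle_right: "y \<in> Obj L \<Longrightarrow>
      FO (HC K (T0 R y) (T0 R (T0 T (T0 R y))) (T0 R y))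
        (FO (T1 R (T0 T (T0 R y)) y) (\<epsilon> y), \<eta> (T0 R y)) = One K (T0 R y)"


section \<open>The 2-category of categories\<close>

definition Cat2 ::
  "(('o, 'm) cat, ('o, 'm, 'o, 'm) ftr, (('o, 'm, 'o, 'm) ftr, 'o, 'm) cell) two_cat" where
  "Cat2 =
    \<lparr>Obj = {C. category C},
     HomC = fun_cat,
     One = id_ftr,
     HC = (\<lambda>C D E. ftr_on (prod_cat (fun_cat D E) (fun_cat C D))
       (\<lambda>(G, F). comp_ftr C G F)
       (\<lambda>(s, t). \<lparr>Src = comp_ftr C (Src s) (Src t), Tgt = comp_ftr C (Tgt s) (Tgt t),
          Cmp = (\<lambda>x\<in>Ob C. Cmp s (FO (Tgt t) x) \<cdot>\<^bsub>E\<^esub> FA (Src s) (Cmp t x))\<rparr>))\<rparr>"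


section \<open>Strict monoidal categories and their bimodules\<close>

record ('a, 'b) smc = "('a, 'b) cat" +
  Ten :: "('a \<times> 'a, 'b \<times> 'b, 'a, 'b) ftr"
  Unt :: 'a

abbreviation tenO :: "('a, 'b) smc \<Rightarrow> 'a \<Rightarrow> 'a \<Rightarrow> 'a" where
  "tenO A a b \<equiv> FO (Ten A) (a, b)"

abbreviation tenA :: "('a, 'b) smc \<Rightarrow> 'b \<Rightarrow> 'b \<Rightarrow> 'b" where
  "tenA A f g \<equiv> FA (Ten A) (f, g)"

locale strict_monoidal_category = category A for A :: "('a, 'b) smc" +
  assumes ten_functor: "is_functor (prod_cat A A) A (Ten A)"
    and unt_ob: "Unt A \<in> Ob A"
    and ten_assoc: "a \<in> Ob A \<Longrightarrow> b \<in> Ob A \<Longrightarrow> c \<in> Ob A \<Longrightarrow>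
      tenO A (tenO A a b) c = tenO A a (tenO A b c)"
    and ten_assoc_ar: "f \<in> Ar A \<Longrightarrow> g \<in> Ar A \<Longrightarrow> h \<in> Ar A \<Longrightarrow>
      tenA A (tenA A f g) h = tenA A f (tenA A g h)"
    and ten_unit_left: "a \<in> Ob A \<Longrightarrow> tenO A (Unt A) a = a"
    and ten_unit_left_ar: "f \<in> Ar A \<Longrightarrow> tenA A (Id A (Unt A)) f = f"
    and ten_unit_right: "a \<in> Ob A \<Longrightarrow> tenO A a (Unt A) = a"
    and ten_unit_right_ar: "f \<in> Ar A \<Longrightarrow> tenA A f (Id A (Unt A)) = f"

text \<open>\<open>Lam X a x b\<close> is \<open>\<lambda>\<^bsub>a,x,b\<^esub> : a(xb) \<rightarrow> (ax)b\<close>.\<close>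

record ('x, 'y, 'a, 'b) bimod =
  Und :: "('x, 'y) cat"
  LAct :: "('a \<times> 'x, 'b \<times> 'y, 'x, 'y) ftr"
  RAct :: "('x \<times> 'a, 'y \<times> 'b, 'x, 'y) ftr"
  Lam :: "'a \<Rightarrow> 'x \<Rightarrow> 'a \<Rightarrow> 'y"

abbreviation lO :: "('x, 'y, 'a, 'b) bimod \<Rightarrow> 'a \<Rightarrow> 'x \<Rightarrow> 'x" where
  "lO X a x \<equiv> FO (LAct X) (a, x)"

abbreviation lA :: "('x, 'y, 'a, 'b) bimod \<Rightarrow> 'b \<Rightarrow> 'y \<Rightarrow> 'y" where
  "lA X f h \<equiv> FA (LAct X) (f, h)"

abbreviation rO :: "('x, 'y, 'a, 'b) bimod \<Rightarrow> 'x \<Rightarrow> 'a \<Rightarrow> 'x" where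
  "rO X x a \<equiv> FO (RAct X) (x, a)"

abbreviation rA :: "('x, 'y, 'a, 'b) bimod \<Rightarrow> 'y \<Rightarrow> 'b \<Rightarrow> 'y" where
  "rA X h f \<equiv> FA (RAct X) (h, f)"

text \<open>The whiskerings written \<open>a h\<close> and \<open>h a\<close> for an object \<open>a\<close> of \<open>A\<close> and an arrow \<open>h\<close> of \<open>X\<close>.\<close>

abbreviation lW :: "('a, 'b) smc \<Rightarrow> ('x, 'y, 'a, 'b) bimod \<Rightarrow> 'a \<Rightarrow> 'y \<Rightarrow> 'y" where
  "lW A X a h \<equiv> lA X (Id A a) h"

abbreviation rW :: "('a, 'b) smc \<Rightarrow> ('x, 'y, 'a, 'b) bimod \<Rightarrow> 'y \<Rightarrow> 'a \<Rightarrow> 'y" where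
  "rW A X h a \<equiv> rA X h (Id A a)"

locale bimodule = A: strict_monoidal_category A + Und: category "Und X"
  for A :: "('a, 'b) smc" and X :: "('x, 'y, 'a, 'b) bimod" +
  assumes lact_functor: "is_functor (prod_cat A (Und X)) (Und X) (LAct X)"
    and ract_functor: "is_functor (prod_cat (Und X) A) (Und X) (RAct X)"
    and lact_assoc: "a \<in> Ob A \<Longrightarrow> a' \<in> Ob A \<Longrightarrow> x \<in> Ob (Und X) \<Longrightarrow>
      lO X (tenO A a a') x = lO X a (lO X a' x)"
    and lact_assoc_ar: "f \<in> Ar A \<Longrightarrow> f' \<in> Ar A \<Longrightarrow> h \<in> Ar (Und X) \<Longrightarrow>
      lA X (tenA A f f') h = lA X f (lA X f' h)"
    and lact_unit: "x \<in> Ob (Und X) \<Longrightarrow> lO X (Unt A) x = x"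
    and lact_unit_ar: "h \<in> Ar (Und X) \<Longrightarrow> lA X (Id A (Unt A)) h = h"
    and ract_assoc: "x \<in> Ob (Und X) \<Longrightarrow> b \<in> Ob A \<Longrightarrow> b' \<in> Ob A \<Longrightarrow>
      rO X x (tenO A b b') = rO X (rO X x b) b'"
    and ract_assoc_ar: "h \<in> Ar (Und X) \<Longrightarrow> g \<in> Ar A \<Longrightarrow> g' \<in> Ar A \<Longrightarrow>
      rA X h (tenA A g g') = rA X (rA X h g) g'"
    and ract_unit: "x \<in> Ob (Und X) \<Longrightarrow> rO X x (Unt A) = x"
    and ract_unit_ar: "h \<in> Ar (Und X) \<Longrightarrow> rA X h (Id A (Unt A)) = h"
    and lam_hom: "a \<in> Ob A \<Longrightarrow> x \<in> Ob (Und X) \<Longrightarrow> b \<in> Ob A \<Longrightarrow>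
      Lam X a x b \<in> hom (Und X) (lO X a (rO X x b)) (rO X (lO X a x) b)"
    and lam_natural: "f \<in> Ar A \<Longrightarrow> h \<in> Ar (Und X) \<Longrightarrow> g \<in> Ar A \<Longrightarrow>
      Lam X (Cod A f) (Cod (Und X) h) (Cod A g) \<cdot>\<^bsub>Und X\<^esub> lA X f (rA X h g) =
      rA X (lA X f h) g \<cdot>\<^bsub>Und X\<^esub> Lam X (Dom A f) (Dom (Und X) h) (Dom A g)"
    and lam_ten_left: "a \<in> Ob A \<Longrightarrow> a' \<in> Ob A \<Longrightarrow> x \<in> Ob (Und X) \<Longrightarrow> b \<in> Ob A \<Longrightarrow>
      Lam X (tenO A a a') x b = Lam X a (lO X a' x) b \<cdot>\<^bsub>Und X\<^esub> lW A X a (Lam X a' x b)"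
    and lam_unit_left: "x \<in> Ob (Und X) \<Longrightarrow> b \<in> Ob A \<Longrightarrow>
      Lam X (Unt A) x b = Id (Und X) (rO X x b)"
    and lam_ten_right: "a \<in> Ob A \<Longrightarrow> x \<in> Ob (Und X) \<Longrightarrow> b \<in> Ob A \<Longrightarrow> b' \<in> Ob A \<Longrightarrow>
      Lam X a x (tenO A b b') = rW A X (Lam X a x b) b' \<cdot>\<^bsub>Und X\<^esub> Lam X a (rO X x b) b'"
    and lam_unit_right: "a \<in> Ob A \<Longrightarrow> x \<in> Ob (Und X) \<Longrightarrow>
      Lam X a x (Unt A) = Id (Und X) (lO X a x)"

text \<open>\<open>Rho p (a, x)\<close> is \<open>\<rho>\<^bsub>a,x\<^esub> : a p(x) \<rightarrow> p(ax)\<close>.\<close>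

record ('a, 'x, 'y, 'v, 'w) bmor =
  Fun :: "('x, 'y, 'v, 'w) ftr"
  Rho :: "'a \<times> 'x \<Rightarrow> 'w"

abbreviation pO :: "('a, 'x, 'y, 'v, 'w) bmor \<Rightarrow> 'x \<Rightarrow> 'v" where
  "pO p x \<equiv> FO (Fun p) x"

abbreviation pA :: "('a, 'x, 'y, 'v, 'w) bmor \<Rightarrow> 'y \<Rightarrow> 'w" where
  "pA p h \<equiv> FA (Fun p) h"

locale bimodule_morphism =
  X: bimodule A X + Y: bimodule A Y + Fun: is_functor "Und X" "Und Y" "Fun p"
  for A :: "('a, 'b) smc" and X :: "('x, 'y, 'a, 'b) bimod" and Y :: "('v, 'w, 'a, 'b) bimod"
    and p :: "('a, 'x, 'y, 'v, 'w) bmor" +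
  assumes right_strict: "x \<in> Ob (Und X) \<Longrightarrow> b \<in> Ob A \<Longrightarrow> pO p (rO X x b) = rO Y (pO p x) b"
    and right_strict_ar: "h \<in> Ar (Und X) \<Longrightarrow> g \<in> Ar A \<Longrightarrow> pA p (rA X h g) = rA Y (pA p h) g"
    and rho_ext: "Rho p \<in> extensional (Ob A \<times> Ob (Und X))"
    and rho_hom: "a \<in> Ob A \<Longrightarrow> x \<in> Ob (Und X) \<Longrightarrow>
      Rho p (a, x) \<in> hom (Und Y) (lO Y a (pO p x)) (pO p (lO X a x))"
    and rho_natural: "f \<in> Ar A \<Longrightarrow> h \<in> Ar (Und X) \<Longrightarrow>
      Rho p (Cod A f, Cod (Und X) h) \<cdot>\<^bsub>Und Y\<^esub> lA Y f (pA p h) =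
      pA p (lA X f h) \<cdot>\<^bsub>Und Y\<^esub> Rho p (Dom A f, Dom (Und X) h)"
    and rho_unit: "x \<in> Ob (Und X) \<Longrightarrow> Rho p (Unt A, x) = Id (Und Y) (pO p x)"
    and rho_ten: "a \<in> Ob A \<Longrightarrow> b \<in> Ob A \<Longrightarrow> x \<in> Ob (Und X) \<Longrightarrow>
      Rho p (tenO A a b, x) = Rho p (a, lO X b x) \<cdot>\<^bsub>Und Y\<^esub> lW A Y a (Rho p (b, x))"
    and rho_lam: "a \<in> Ob A \<Longrightarrow> x \<in> Ob (Und X) \<Longrightarrow> b \<in> Ob A \<Longrightarrow>
      pA p (Lam X a x b) \<cdot>\<^bsub>Und Y\<^esub> Rho p (a, rO X x b) =
      rW A Y (Rho p (a, x)) b \<cdot>\<^bsub>Und Y\<^esub> Lam Y a (pO p x) b"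

locale bimodule_cell =
  src: bimodule_morphism A X Y p + tgt: bimodule_morphism A X Y q +
  is_nat "Und X" "Und Y" "Fun p" "Fun q" \<tau>
  for A :: "('a, 'b) smc" and X :: "('x, 'y, 'a, 'b) bimod" and Y :: "('v, 'w, 'a, 'b) bimod"
    and p q :: "('a, 'x, 'y, 'v, 'w) bmor" and \<tau> :: "'x \<Rightarrow> 'w" +
  assumes cell_left: "a \<in> Ob A \<Longrightarrow> x \<in> Ob (Und X) \<Longrightarrow>
      Rho q (a, x) \<cdot>\<^bsub>Und Y\<^esub> lW A Y a (\<tau> x) = \<tau> (lO X a x) \<cdot>\<^bsub>Und Y\<^esub> Rho p (a, x)"
    and cell_right: "x \<in> Ob (Und X) \<Longrightarrow> b \<in> Ob A \<Longrightarrow> \<tau> (rO X x b) = rW A Y (\<tau> x) b"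

definition bimod_hom ::
  "('a, 'b) smc \<Rightarrow> ('x, 'y, 'a, 'b) bimod \<Rightarrow> ('v, 'w, 'a, 'b) bimod \<Rightarrow>
    (('a, 'x, 'y, 'v, 'w) bmor, (('a, 'x, 'y, 'v, 'w) bmor, 'x, 'w) cell) cat" where
  "bimod_hom A X Y =
    \<lparr>Ob = {p. bimodule_morphism A X Y p},
     Ar = {t. bimodule_cell A X Y (Src t) (Tgt t) (Cmp t)},
     Dom = Src, Cod = Tgt,
     Id = (\<lambda>p. \<lparr>Src = p, Tgt = p, Cmp = (\<lambda>x\<in>Ob (Und X). Id (Und Y) (pO p x))\<rparr>),
     Comp = (\<lambda>s t. \<lparr>Src = Src t, Tgt = Tgt s,
       Cmp = (\<lambda>x\<in>Ob (Und X). Cmp s x \<cdot>\<^bsub>Und Y\<^esub> Cmp t x)\<rparr>)\<rparr>"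

definition id_bmor :: "('a, 'b) smc \<Rightarrow> ('x, 'y, 'a, 'b) bimod \<Rightarrow> ('a, 'x, 'y, 'x, 'y) bmor" where
  "id_bmor A X =
    \<lparr>Fun = id_ftr (Und X),
     Rho = (\<lambda>(a, x)\<in>Ob A \<times> Ob (Und X). Id (Und X) (lO X a x))\<rparr>"

text \<open>The structure map of \<open>q \<circ> p\<close> is the composite \<open>a q(p(x)) \<rightarrow> q(a p(x)) \<rightarrow> q(p(ax))\<close>.\<close>

definition comp_bmor ::
  "('a, 'b) smc \<Rightarrow> ('x, 'y, 'a, 'b) bimod \<Rightarrow> ('r, 's, 'a, 'b) bimod \<Rightarrow>
    ('a, 'v, 'w, 'r, 's) bmor \<Rightarrow> ('a, 'x, 'y, 'v, 'w) bmor \<Rightarrow> ('a, 'x, 'y, 'r, 's) bmor" where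
  "comp_bmor A X Z q p =
    \<lparr>Fun = comp_ftr (Und X) (Fun q) (Fun p),
     Rho = (\<lambda>(a, x)\<in>Ob A \<times> Ob (Und X). pA q (Rho p (a, x)) \<cdot>\<^bsub>Und Z\<^esub> Rho q (a, pO p x))\<rparr>"

definition Bimod2 ::
  "('a, 'b) smc \<Rightarrow>
    (('x, 'y, 'a, 'b) bimod, ('a, 'x, 'y, 'x, 'y) bmor, (('a, 'x, 'y, 'x, 'y) bmor, 'x, 'y) cell)
    two_cat" where
  "Bimod2 A =
    \<lparr>Obj = {X. bimodule A X},
     HomC = bimod_hom A,
     One = id_bmor A,
     HC = (\<lambda>X Y Z. ftr_on (prod_cat (bimod_hom A Y Z) (bimod_hom A X Y))
       (\<lambda>(q, p). comp_bmor A X Z q p)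
       (\<lambda>(s, t). \<lparr>Src = comp_bmor A X Z (Src s) (Src t), Tgt = comp_bmor A X Z (Tgt s) (Tgt t),
          Cmp = (\<lambda>x\<in>Ob (Und X). Cmp s (pO (Tgt t) x) \<cdot>\<^bsub>Und Z\<^esub> pA (Src s) (Cmp t x))\<rparr>))\<rparr>"


section \<open>A universe\<close>

text \<open>\<open>P \<times> A\<close> and \<open>H\<^sup>0(A,X)\<close> have to be categories of the same HOL type as \<open>P\<close> and as the category
  underlying \<open>X\<close>. We therefore take small categories to be those with objects and arrows in the
  following type: it contains an arbitrary type of atoms and the objects and arrows of \<open>A\<close>, and it is
  closed under pairs and under families indexed by the objects of \<open>A\<close>. As the type of atoms is
  arbitrary, every category whatsoever occurs among these up to isomorphism.\<close>

datatype ('a, 'b, 'u) univ =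
    Atom 'u
  | AOb (un_AOb: 'a)
  | AAr (un_AAr: 'b)
  | Pr (pfst: "('a, 'b, 'u) univ") (psnd: "('a, 'b, 'u) univ")
  | Fam (un_Fam: "'a \<Rightarrow> ('a, 'b, 'u) univ")

type_synonym ('a, 'b, 'u) ucat = "(('a, 'b, 'u) univ, ('a, 'b, 'u) univ) cat"
type_synonym ('a, 'b, 'u) uftr =
  "(('a, 'b, 'u) univ, ('a, 'b, 'u) univ, ('a, 'b, 'u) univ, ('a, 'b, 'u) univ) ftr"
type_synonym ('a, 'b, 'u) ucell =
  "(('a, 'b, 'u) uftr, ('a, 'b, 'u) univ, ('a, 'b, 'u) univ) cell"
type_synonym ('a, 'b, 'u) ubimod = "(('a, 'b, 'u) univ, ('a, 'b, 'u) univ, 'a, 'b) bimod"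
type_synonym ('a, 'b, 'u) ubmor =
  "('a, ('a, 'b, 'u) univ, ('a, 'b, 'u) univ, ('a, 'b, 'u) univ, ('a, 'b, 'u) univ) bmor"
type_synonym ('a, 'b, 'u) ubcell =
  "(('a, 'b, 'u) ubmor, ('a, 'b, 'u) univ, ('a, 'b, 'u) univ) cell"


section \<open>The 2-functor \<open>(-) \<times> A\<close>\<close>

text \<open>The object \<open>(y, b)\<close> of \<open>P \<times> A\<close> is \<open>Pr y (AOb b)\<close>, the arrow \<open>(h, g)\<close> is \<open>Pr h (AAr g)\<close>.\<close>

definition times_cat :: "('a, 'b) smc \<Rightarrow> ('a, 'b, 'u) ucat \<Rightarrow> ('a, 'b, 'u) ucat" where
  "times_cat A P =
    \<lparr>Ob = {Pr y (AOb b) | y b. y \<in> Ob P \<and> b \<in> Ob A},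
     Ar = {Pr h (AAr g) | h g. h \<in> Ar P \<and> g \<in> Ar A},
     Dom = (\<lambda>k. Pr (Dom P (pfst k)) (AOb (Dom A (un_AAr (psnd k))))),
     Cod = (\<lambda>k. Pr (Cod P (pfst k)) (AOb (Cod A (un_AAr (psnd k))))),
     Id = (\<lambda>u. Pr (Id P (pfst u)) (AAr (Id A (un_AOb (psnd u))))),
     Comp = (\<lambda>k' k. Pr (pfst k' \<cdot>\<^bsub>P\<^esub> pfst k) (AAr (un_AAr (psnd k') \<cdot>\<^bsub>A\<^esub> un_AAr (psnd k))))\<rparr>"

definition times_lact ::
  "('a, 'b) smc \<Rightarrow> ('a, 'b, 'u) ucat \<Rightarrow>
    ('a \<times> ('a, 'b, 'u) univ, 'b \<times> ('a, 'b, 'u) univ, ('a, 'b, 'u) univ, ('a, 'b, 'u) univ) ftr" where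
  "times_lact A P = ftr_on (prod_cat A (times_cat A P))
    (\<lambda>(a, u). Pr (pfst u) (AOb (tenO A a (un_AOb (psnd u)))))
    (\<lambda>(f, k). Pr (pfst k) (AAr (tenA A f (un_AAr (psnd k)))))"

definition times_ract ::
  "('a, 'b) smc \<Rightarrow> ('a, 'b, 'u) ucat \<Rightarrow>
    (('a, 'b, 'u) univ \<times> 'a, ('a, 'b, 'u) univ \<times> 'b, ('a, 'b, 'u) univ, ('a, 'b, 'u) univ) ftr" where
  "times_ract A P = ftr_on (prod_cat (times_cat A P) A)
    (\<lambda>(u, a). Pr (pfst u) (AOb (tenO A (un_AOb (psnd u)) a)))
    (\<lambda>(k, f). Pr (pfst k) (AAr (tenA A (un_AAr (psnd k)) f)))"

definition times_bimod :: "('a, 'b) smc \<Rightarrow> ('a, 'b, 'u) ucat \<Rightarrow> ('a, 'b, 'u) ubimod" where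
  "times_bimod A P =
    \<lparr>Und = times_cat A P, LAct = times_lact A P, RAct = times_ract A P,
     Lam = (\<lambda>a u b. Id (times_cat A P) (FO (times_lact A P) (a, FO (times_ract A P) (u, b))))\<rparr>"

definition times_mor ::
  "('a, 'b) smc \<Rightarrow> ('a, 'b, 'u) ucat \<Rightarrow> ('a, 'b, 'u) ucat \<Rightarrow> ('a, 'b, 'u) uftr \<Rightarrow> ('a, 'b, 'u) ubmor" where
  "times_mor A P Q F =
    (let FxA = ftr_on (times_cat A P)
      (\<lambda>u. Pr (FO F (pfst u)) (psnd u)) (\<lambda>k. Pr (FA F (pfst k)) (psnd k))
     in \<lparr>Fun = FxA,
         Rho = (\<lambda>(a, u)\<in>Ob A \<times> Ob (times_cat A P).
           Id (times_cat A Q) (FO (times_lact A Q) (a, FO FxA u)))\<rparr>)"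

definition times_cell ::
  "('a, 'b) smc \<Rightarrow> ('a, 'b, 'u) ucat \<Rightarrow> ('a, 'b, 'u) ucat \<Rightarrow> ('a, 'b, 'u) ucell \<Rightarrow> ('a, 'b, 'u) ubcell" where
  "times_cell A P Q t =
    \<lparr>Src = times_mor A P Q (Src t), Tgt = times_mor A P Q (Tgt t),
     Cmp = (\<lambda>u\<in>Ob (times_cat A P). Pr (Cmp t (pfst u)) (AAr (Id A (un_AOb (psnd u)))))\<rparr>"

definition Times2 ::
  "('a, 'b) smc \<Rightarrow>
    (('a, 'b, 'u) ucat, ('a, 'b, 'u) uftr, ('a, 'b, 'u) ucell,
     ('a, 'b, 'u) ubimod, ('a, 'b, 'u) ubmor, ('a, 'b, 'u) ubcell) two_ftr" where
  "Times2 A =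
    \<lparr>T0 = times_bimod A,
     T1 = (\<lambda>P Q. ftr_on (fun_cat P Q) (times_mor A P Q) (times_cell A P Q))\<rparr>"


section \<open>Lax zeroth Hochschild cohomology\<close>

locale hochschild_object = bimodule A X
  for A :: "('a, 'b) smc" and X :: "('x, 'y, 'a, 'b) bimod" +
  fixes x :: 'x and \<xi> :: "'a \<Rightarrow> 'y"
  assumes x_ob: "x \<in> Ob (Und X)"
    and xi_ext: "\<xi> \<in> extensional (Ob A)"
    and xi_hom: "a \<in> Ob A \<Longrightarrow> \<xi> a \<in> hom (Und X) (lO X a x) (rO X x a)"
    and xi_natural: "f \<in> Ar A \<Longrightarrow>
      \<xi> (Cod A f) \<cdot>\<^bsub>Und X\<^esub> lA X f (Id (Und X) x) = rA X (Id (Und X) x) f \<cdot>\<^bsub>Und X\<^esub> \<xi> (Dom A f)"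
    and xi_unit: "\<xi> (Unt A) = Id (Und X) x"
    and xi_ten: "a \<in> Ob A \<Longrightarrow> b \<in> Ob A \<Longrightarrow>
      rW A X (\<xi> a) b \<cdot>\<^bsub>Und X\<^esub> Lam X a x b \<cdot>\<^bsub>Und X\<^esub> lW A X a (\<xi> b) = \<xi> (tenO A a b)"

definition hochschild_morphism ::
  "('a, 'b) smc \<Rightarrow> ('x, 'y, 'a, 'b) bimod \<Rightarrow> 'x \<Rightarrow> ('a \<Rightarrow> 'y) \<Rightarrow> 'x \<Rightarrow> ('a \<Rightarrow> 'y) \<Rightarrow> 'y \<Rightarrow> bool" where
  "hochschild_morphism A X x \<xi> x' \<xi>' f \<longleftrightarrow>
    f \<in> hom (Und X) x x' \<and>
    (\<forall>a\<in>Ob A. \<xi>' a \<cdot>\<^bsub>Und X\<^esub> lW A X a f = rW A X f a \<cdot>\<^bsub>Und X\<^esub> \<xi> a)"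

text \<open>The object \<open>(x, \<xi>)\<close> of \<open>H\<^sup>0(A,X)\<close> is \<open>Pr x (Fam \<xi>)\<close>; an arrow \<open>f : u \<rightarrow> u'\<close> is \<open>Pr f (Pr u u')\<close>,
  as the same \<open>f\<close> may be a morphism between several pairs of objects.\<close>

definition H0 :: "('a, 'b) smc \<Rightarrow> ('a, 'b, 'u) ubimod \<Rightarrow> ('a, 'b, 'u) ucat" where
  "H0 A X =
    \<lparr>Ob = {Pr x (Fam \<xi>) | x \<xi>. hochschild_object A X x \<xi>},
     Ar = {Pr f (Pr (Pr x (Fam \<xi>)) (Pr x' (Fam \<xi>'))) | f x \<xi> x' \<xi>'.
       hochschild_object A X x \<xi> \<and> hochschild_object A X x' \<xi>' \<and>
       hochschild_morphism A X x \<xi> x' \<xi>' f},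
     Dom = (\<lambda>k. pfst (psnd k)),
     Cod = (\<lambda>k. psnd (psnd k)),
     Id = (\<lambda>u. Pr (Id (Und X) (pfst u)) (Pr u u)),
     Comp = (\<lambda>k' k. Pr (pfst k' \<cdot>\<^bsub>Und X\<^esub> pfst k) (Pr (pfst (psnd k)) (psnd (psnd k'))))\<rparr>"

end

theory Submission
  imports Defs
begin

text \<open>
  A morphism \<open>p : P \<times> A \<rightarrow> X\<close> is strict on the right, and \<open>(y,b) = (y,i)b\<close>. Hence its underlying functor
  is determined by the functor \<open>F y = p(y,i)\<close>, as \<open>p(y,b) = (F y)b\<close>. What is left is the lax structure
  \<open>\<rho> : a p(y,b) \<rightarrow> p(y,ab)\<close>. Because every \<open>\<lambda>\<close> of \<open>P \<times> A\<close> is an identity, the compatibility of \<open>\<rho>\<close>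
  with \<open>\<lambda>\<close> determines \<open>\<rho>\<close> by its values \<open>\<xi>\<^sub>a : a(F y) \<rightarrow> (F y)a\<close> at \<open>b = i\<close>: with \<open>x = F y\<close>, the
  component of \<open>\<rho>\<close> at \<open>a\<close> and \<open>(y,b)\<close> is \<open>(\<xi>\<^sub>a)b \<circ> \<lambda>\<^bsub>a,x,b\<^esub>\<close>. Naturality and the unit and tensor
  axioms of \<open>\<rho>\<close> then say that \<open>(F y, \<xi>)\<close> is an object of \<open>H\<^sup>0(A,X)\<close> depending functorially on \<open>y\<close>. So \<open>p\<close>
  is the same as a functor \<open>P \<rightarrow> H\<^sup>0(A,X)\<close>.

  The proof presents this correspondence by its unit and counit. The unit sends \<open>y\<close> to \<open>(y,i)\<close> with the
  identity maps \<open>a(y,i) = (y,a) = (y,i)a\<close>. The counit \<open>H\<^sup>0(A,X) \<times> A \<rightarrow> X\<close> sends \<open>((x,\<xi>),b)\<close> to \<open>xb\<close>, with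
  \<open>\<rho>\<close> given by the formula above. The right adjoint sends a morphism \<open>(p,\<rho>)\<close> to
  \<open>(x,\<xi>) \<mapsto> (p(x), p(\<xi>\<^sub>a) \<circ> \<rho>\<^bsub>a,x\<^esub>)\<close> and a 2-cell \<open>\<tau>\<close> to its own components.

  The mathematical content lies in \<open>hochschild_object_image\<close> (the right adjoint is defined on objects of
  \<open>H\<^sup>0\<close>), \<open>bimodule_morphism_counit\<close> (the counit is a morphism), \<open>counit_natural\<close>, and the triangle
  identities \<open>triangle_times\<close> and \<open>triangle_H0\<close>. The rest consists in checking that all the structures
  are strict 2-categories, 2-functors and 2-natural transformations.
\<close>

section \<open>Functor categories and the 2-category of categories\<close>

text \<open>Throughout, hom sets are replaced by conditions on sources and targets: in that form the
  typing of composites is decided by conditional rewriting.\<close>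
lemma in_hom_iff: "f \<in> hom C x y \<longleftrightarrow> f \<in> Ar C \<and> Dom C f = x \<and> Cod C f = y"
  by (simp add: hom_def)

context category
begin

lemmas ob_simps [simp] = dom_ob cod_ob

lemma id_ar [simp]:
  assumes "x \<in> Ob C"
  shows "Id C x \<in> Ar C" "Dom C (Id C x) = x" "Cod C (Id C x) = x"
  using id_hom[OF assms] by (simp_all add: hom_def)

lemma comp_ar [simp]:
  assumes "f \<in> Ar C" "g \<in> Ar C" "Cod C f = Dom C g"
  shows "g \<cdot>\<^bsub>C\<^esub> f \<in> Ar C" "Dom C (g \<cdot>\<^bsub>C\<^esub> f) = Dom C f" "Cod C (g \<cdot>\<^bsub>C\<^esub> f) = Cod C g"
  using comp_hom[of f "Dom C f" "Dom C g" g "Cod C g"] assms by (simp_all add: hom_def)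

lemma comp_id [simp]:
  assumes "f \<in> Ar C"
  shows "Cod C f = y \<Longrightarrow> Id C y \<cdot>\<^bsub>C\<^esub> f = f" "Dom C f = x \<Longrightarrow> f \<cdot>\<^bsub>C\<^esub> Id C x = f"
  using id_left[of f "Dom C f" "Cod C f"] id_right[of f "Dom C f" "Cod C f"] assms
  by (auto simp: hom_def)

lemma assoc:
  assumes "f \<in> Ar C" "g \<in> Ar C" "h \<in> Ar C" "Cod C f = Dom C g" "Cod C g = Dom C h"
  shows "(h \<cdot>\<^bsub>C\<^esub> g) \<cdot>\<^bsub>C\<^esub> f = h \<cdot>\<^bsub>C\<^esub> (g \<cdot>\<^bsub>C\<^esub> f)"
  using comp_assoc[of f "Dom C f" "Dom C g" g "Dom C h" h "Cod C h"] assms by (simp add: hom_def)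

end

lemma categoryI:
  assumes "\<And>f. f \<in> Ar C \<Longrightarrow> Dom C f \<in> Ob C \<and> Cod C f \<in> Ob C"
    and "\<And>x. x \<in> Ob C \<Longrightarrow> Id C x \<in> Ar C \<and> Dom C (Id C x) = x \<and> Cod C (Id C x) = x"
    and "\<And>f g. f \<in> Ar C \<Longrightarrow> g \<in> Ar C \<Longrightarrow> Cod C f = Dom C g \<Longrightarrow>
      g \<cdot>\<^bsub>C\<^esub> f \<in> Ar C \<and> Dom C (g \<cdot>\<^bsub>C\<^esub> f) = Dom C f \<and> Cod C (g \<cdot>\<^bsub>C\<^esub> f) = Cod C g"
    and "\<And>f. f \<in> Ar C \<Longrightarrow> Id C (Cod C f) \<cdot>\<^bsub>C\<^esub> f = f \<and> f \<cdot>\<^bsub>C\<^esub> Id C (Dom C f) = f"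
    and "\<And>f g h. f \<in> Ar C \<Longrightarrow> g \<in> Ar C \<Longrightarrow> h \<in> Ar C \<Longrightarrow> Cod C f = Dom C g \<Longrightarrow> Cod C g = Dom C h \<Longrightarrow>
      h \<cdot>\<^bsub>C\<^esub> (g \<cdot>\<^bsub>C\<^esub> f) = (h \<cdot>\<^bsub>C\<^esub> g) \<cdot>\<^bsub>C\<^esub> f"
  shows "category C"
  by unfold_locales (use assms in \<open>auto simp: hom_def\<close>)

lemma prod_cat_simps [simp]:
  "Ob (prod_cat C D) = Ob C \<times> Ob D"
  "Ar (prod_cat C D) = Ar C \<times> Ar D"
  "Dom (prod_cat C D) (f, g) = (Dom C f, Dom D g)"
  "Cod (prod_cat C D) (f, g) = (Cod C f, Cod D g)"
  "Id (prod_cat C D) (x, y) = (Id C x, Id D y)"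
  "(f', g') \<cdot>\<^bsub>prod_cat C D\<^esub> (f, g) = (f' \<cdot>\<^bsub>C\<^esub> f, g' \<cdot>\<^bsub>D\<^esub> g)"
  by (simp_all add: prod_cat_def)

lemma category_prod_cat [simp]:
  assumes "category C" "category D"
  shows "category (prod_cat C D)"
proof -
  interpret C: category C by fact
  interpret D: category D by fact
  show ?thesis
    by (rule categoryI) (auto simp: C.assoc D.assoc)
qed

context is_functor
begin

lemma FO_ob [simp]: "x \<in> Ob C \<Longrightarrow> FO F x \<in> Ob D"
  using FO_map by auto

lemma FA_ar [simp]: "f \<in> Ar C \<Longrightarrow> FA F f \<in> Ar D"
  using FA_map by auto

lemmas FA_simps [simp] = FA_dom FA_cod FA_id

lemma FA_compose [simp]:
  "f \<in> Ar C \<Longrightarrow> g \<in> Ar C \<Longrightarrow> Cod C f = Dom C g \<Longrightarrow> FA F (g \<cdot>\<^bsub>C\<^esub> f) = FA F g \<cdot>\<^bsub>D\<^esub> FA F f"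
  using FA_comp[of f "Dom C f" "Dom C g" g "Cod C g"] by (simp add: hom_def)

end

lemma ftr_on_simps [simp]:
  "x \<in> Ob C \<Longrightarrow> FO (ftr_on C fo fa) x = fo x"
  "f \<in> Ar C \<Longrightarrow> FA (ftr_on C fo fa) f = fa f"
  by (simp_all add: ftr_on_def)

lemma is_functor_ftr_on:
  assumes "category C" "category D"
    and "\<And>x. x \<in> Ob C \<Longrightarrow> fo x \<in> Ob D"
    and "\<And>f. f \<in> Ar C \<Longrightarrow> fa f \<in> Ar D \<and> Dom D (fa f) = fo (Dom C f) \<and> Cod D (fa f) = fo (Cod C f)"
    and "\<And>x. x \<in> Ob C \<Longrightarrow> fa (Id C x) = Id D (fo x)"
    and "\<And>f g. f \<in> Ar C \<Longrightarrow> g \<in> Ar C \<Longrightarrow> Cod C f = Dom C g \<Longrightarrow>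
      fa (g \<cdot>\<^bsub>C\<^esub> f) = fa g \<cdot>\<^bsub>D\<^esub> fa f"
  shows "is_functor C D (ftr_on C fo fa)"
proof -
  interpret C: category C by fact
  interpret D: category D by fact
  show ?thesis
    by unfold_locales (use assms in \<open>auto simp: hom_def ftr_on_def\<close>)
qed

lemma functor_eqI:
  assumes "is_functor C D F" "is_functor C D G"
    and "\<And>x. x \<in> Ob C \<Longrightarrow> FO F x = FO G x" "\<And>f. f \<in> Ar C \<Longrightarrow> FA F f = FA G f"
  shows "F = G"
proof -
  interpret F: is_functor C D F by fact
  interpret G: is_functor C D G by fact
  have "FO F = FO G" using F.FO_map G.FO_map assms(3) by (intro PiE_ext) auto
  moreover have "FA F = FA G" using F.FA_map G.FA_map assms(4) by (intro PiE_ext) auto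
  ultimately show ?thesis by (cases F; cases G) simp
qed

lemma is_functor_id [simp]: "category C \<Longrightarrow> is_functor C C (id_ftr C)"
  unfolding id_ftr_def by (rule is_functor_ftr_on) auto

lemma id_ftr_simps [simp]:
  "x \<in> Ob C \<Longrightarrow> FO (id_ftr C) x = x" "f \<in> Ar C \<Longrightarrow> FA (id_ftr C) f = f"
  by (simp_all add: id_ftr_def)

lemma comp_ftr_simps [simp]:
  "x \<in> Ob C \<Longrightarrow> FO (comp_ftr C G F) x = FO G (FO F x)"
  "f \<in> Ar C \<Longrightarrow> FA (comp_ftr C G F) f = FA G (FA F f)"
  by (simp_all add: comp_ftr_def)

lemma is_functor_comp:
  assumes "is_functor C D F" "is_functor D E G"
  shows "is_functor C E (comp_ftr C G F)"
proof -
  interpret F: is_functor C D F by fact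
  interpret G: is_functor D E G by fact
  show ?thesis unfolding comp_ftr_def
    by (rule is_functor_ftr_on) (auto intro: F.dom.category_axioms G.cod.category_axioms)
qed

lemma comp_ftr_id_left:
  assumes "is_functor C D F" shows "comp_ftr C (id_ftr D) F = F"
proof -
  interpret F: is_functor C D F by fact
  show ?thesis
    by (rule functor_eqI[OF is_functor_comp[OF assms is_functor_id] assms])
      (auto simp: F.cod.category_axioms)
qed

lemma comp_ftr_id_right:
  assumes "is_functor C D F" shows "comp_ftr C F (id_ftr C) = F"
proof -
  interpret F: is_functor C D F by fact
  show ?thesis
    by (rule functor_eqI[OF is_functor_comp[OF is_functor_id assms] assms])
      (auto simp: F.dom.category_axioms)
qed

lemma comp_ftr_assoc:
  assumes "is_functor B C F" "is_functor C D G"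
  shows "comp_ftr B H (comp_ftr B G F) = comp_ftr B (comp_ftr C H G) F"
proof -
  interpret F: is_functor B C F by fact
  interpret G: is_functor C D G by fact
  show ?thesis by (auto simp: comp_ftr_def ftr_on_def restrict_def fun_eq_iff)
qed

context is_nat
begin

lemma cmp_ar [simp]:
  assumes "x \<in> Ob C"
  shows "\<tau> x \<in> Ar D" "Dom D (\<tau> x) = FO F x" "Cod D (\<tau> x) = FO G x"
  using nat_hom[OF assms] by (simp_all add: hom_def)

end

lemma is_natI:
  assumes "is_functor C D F" "is_functor C D G" "\<tau> \<in> extensional (Ob C)"
    and "\<And>x. x \<in> Ob C \<Longrightarrow> \<tau> x \<in> Ar D \<and> Dom D (\<tau> x) = FO F x \<and> Cod D (\<tau> x) = FO G x"
    and "\<And>f. f \<in> Ar C \<Longrightarrow> \<tau> (Cod C f) \<cdot>\<^bsub>D\<^esub> FA F f = FA G f \<cdot>\<^bsub>D\<^esub> \<tau> (Dom C f)"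
  shows "is_nat C D F G \<tau>"
proof -
  interpret F: is_functor C D F by fact
  interpret G: is_functor C D G by fact
  show ?thesis by unfold_locales (use assms in \<open>auto simp: hom_def\<close>)
qed

lemma is_nat_id:
  assumes "is_functor C D F"
  shows "is_nat C D F F (\<lambda>x\<in>Ob C. Id D (FO F x))"
proof -
  interpret F: is_functor C D F by fact
  show ?thesis by (rule is_natI[OF assms assms]) auto
qed

lemma is_nat_vcomp:
  assumes "is_nat C D F G \<tau>" "is_nat C D G H \<sigma>"
  shows "is_nat C D F H (\<lambda>x\<in>Ob C. \<sigma> x \<cdot>\<^bsub>D\<^esub> \<tau> x)"
proof -
  interpret T: is_nat C D F G \<tau> by fact
  interpret S: is_nat C D G H \<sigma> by fact
  show ?thesis
  proof (rule is_natI)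
    show "is_functor C D F" "is_functor C D H" by unfold_locales
    fix f assume f: "f \<in> Ar C"
    have "(\<sigma> (Cod C f) \<cdot>\<^bsub>D\<^esub> \<tau> (Cod C f)) \<cdot>\<^bsub>D\<^esub> FA F f = \<sigma> (Cod C f) \<cdot>\<^bsub>D\<^esub> (FA G f \<cdot>\<^bsub>D\<^esub> \<tau> (Dom C f))"
      using f by (simp add: T.src.cod.assoc T.natural)
    also have "\<dots> = FA H f \<cdot>\<^bsub>D\<^esub> (\<sigma> (Dom C f) \<cdot>\<^bsub>D\<^esub> \<tau> (Dom C f))"
      using f by (simp add: T.src.cod.assoc[symmetric] S.natural)
    finally show "(\<lambda>x\<in>Ob C. \<sigma> x \<cdot>\<^bsub>D\<^esub> \<tau> x) (Cod C f) \<cdot>\<^bsub>D\<^esub> FA F f =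
      FA H f \<cdot>\<^bsub>D\<^esub> (\<lambda>x\<in>Ob C. \<sigma> x \<cdot>\<^bsub>D\<^esub> \<tau> x) (Dom C f)" using f by simp
  qed auto
qed

lemma is_nat_hcomp:
  assumes "is_nat C D F F' \<tau>" "is_nat D E G G' \<sigma>"
  shows "is_nat C E (comp_ftr C G F) (comp_ftr C G' F')
    (\<lambda>x\<in>Ob C. \<sigma> (FO F' x) \<cdot>\<^bsub>E\<^esub> FA G (\<tau> x))"
proof -
  interpret T: is_nat C D F F' \<tau> by fact
  interpret S: is_nat D E G G' \<sigma> by fact
  show ?thesis
  proof (rule is_natI)
    show "is_functor C E (comp_ftr C G F)" "is_functor C E (comp_ftr C G' F')"
      by (rule is_functor_comp; unfold_locales)+
    fix f assume f: "f \<in> Ar C"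
    have *: "FA G (\<tau> (Cod C f)) \<cdot>\<^bsub>E\<^esub> FA G (FA F f) = FA G (FA F' f) \<cdot>\<^bsub>E\<^esub> FA G (\<tau> (Dom C f))"
      using f T.natural[OF f] by (simp flip: S.src.FA_compose)
    have "(\<sigma> (FO F' (Cod C f)) \<cdot>\<^bsub>E\<^esub> FA G (\<tau> (Cod C f))) \<cdot>\<^bsub>E\<^esub> FA G (FA F f) =
        (\<sigma> (FO F' (Cod C f)) \<cdot>\<^bsub>E\<^esub> FA G (FA F' f)) \<cdot>\<^bsub>E\<^esub> FA G (\<tau> (Dom C f))"
      using f by (simp add: S.src.cod.assoc *)
    also have "\<dots> = FA G' (FA F' f) \<cdot>\<^bsub>E\<^esub> (\<sigma> (FO F' (Dom C f)) \<cdot>\<^bsub>E\<^esub> FA G (\<tau> (Dom C f)))"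
      using f S.natural[of "FA F' f"] by (simp add: S.src.cod.assoc)
    finally show "(\<lambda>x\<in>Ob C. \<sigma> (FO F' x) \<cdot>\<^bsub>E\<^esub> FA G (\<tau> x)) (Cod C f) \<cdot>\<^bsub>E\<^esub> FA (comp_ftr C G F) f =
      FA (comp_ftr C G' F') f \<cdot>\<^bsub>E\<^esub> (\<lambda>x\<in>Ob C. \<sigma> (FO F' x) \<cdot>\<^bsub>E\<^esub> FA G (\<tau> x)) (Dom C f)"
      using f by simp
  qed auto
qed

text \<open>The middle four interchange law, which comes down to naturality of \<open>\<sigma>\<close> at the arrow \<open>\<tau>' x\<close>.\<close>
lemma interchange:
  assumes "is_nat C D F F' \<tau>" "is_nat C D F' F'' \<tau>'" "is_nat D E G G' \<sigma>" "is_nat D E G' G'' \<sigma>'"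
    and x: "x \<in> Ob C"
  shows "(\<sigma>' (FO F'' x) \<cdot>\<^bsub>E\<^esub> \<sigma> (FO F'' x)) \<cdot>\<^bsub>E\<^esub> FA G (\<tau>' x \<cdot>\<^bsub>D\<^esub> \<tau> x) =
    (\<sigma>' (FO F'' x) \<cdot>\<^bsub>E\<^esub> FA G' (\<tau>' x)) \<cdot>\<^bsub>E\<^esub> (\<sigma> (FO F' x) \<cdot>\<^bsub>E\<^esub> FA G (\<tau> x))"
proof -
  interpret T: is_nat C D F F' \<tau> by fact
  interpret T': is_nat C D F' F'' \<tau>' by fact
  interpret S: is_nat D E G G' \<sigma> by fact
  interpret S': is_nat D E G' G'' \<sigma>' by fact
  have *: "\<sigma> (FO F'' x) \<cdot>\<^bsub>E\<^esub> FA G (\<tau>' x) = FA G' (\<tau>' x) \<cdot>\<^bsub>E\<^esub> \<sigma> (FO F' x)"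
    using S.natural[of "\<tau>' x"] x by simp
  have "(\<sigma>' (FO F'' x) \<cdot>\<^bsub>E\<^esub> \<sigma> (FO F'' x)) \<cdot>\<^bsub>E\<^esub> FA G (\<tau>' x \<cdot>\<^bsub>D\<^esub> \<tau> x) =
      \<sigma>' (FO F'' x) \<cdot>\<^bsub>E\<^esub> ((\<sigma> (FO F'' x) \<cdot>\<^bsub>E\<^esub> FA G (\<tau>' x)) \<cdot>\<^bsub>E\<^esub> FA G (\<tau> x))"
    using x by (simp add: S.src.cod.assoc)
  then show ?thesis using x by (simp add: * S.src.cod.assoc)
qed

lemma fun_cat_simps [simp]:
  "Ob (fun_cat C D) = {F. is_functor C D F}"
  "Ar (fun_cat C D) = {t. is_nat C D (Src t) (Tgt t) (Cmp t)}"
  "Dom (fun_cat C D) t = Src t"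
  "Cod (fun_cat C D) t = Tgt t"
  "Id (fun_cat C D) F = \<lparr>Src = F, Tgt = F, Cmp = (\<lambda>x\<in>Ob C. Id D (FO F x))\<rparr>"
  "s \<cdot>\<^bsub>fun_cat C D\<^esub> t = \<lparr>Src = Src t, Tgt = Tgt s, Cmp = (\<lambda>x\<in>Ob C. Cmp s x \<cdot>\<^bsub>D\<^esub> Cmp t x)\<rparr>"
  by (simp_all add: fun_cat_def)

lemma cell_eqI:
  fixes s t :: "('f, 'o, 'm) cell"
  assumes "Src s = Src t" "Tgt s = Tgt t" "Cmp s \<in> extensional S" "Cmp t \<in> extensional S"
    and "\<And>x. x \<in> S \<Longrightarrow> Cmp s x = Cmp t x"
  shows "s = t"
  using assms extensionalityI[OF assms(3,4)] by (simp add: cell.equality)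

lemma category_fun_cat:
  assumes "category C" "category D"
  shows "category (fun_cat C D)"
proof (rule categoryI)
  fix f assume f: "f \<in> Ar (fun_cat C D)"
  then interpret f: is_nat C D "Src f" "Tgt f" "Cmp f" by simp
  show "Dom (fun_cat C D) f \<in> Ob (fun_cat C D) \<and> Cod (fun_cat C D) f \<in> Ob (fun_cat C D)"
    by (simp add: f.src.is_functor_axioms f.tgt.is_functor_axioms)
  show "Id (fun_cat C D) (Cod (fun_cat C D) f) \<cdot>\<^bsub>fun_cat C D\<^esub> f = f \<and>
    f \<cdot>\<^bsub>fun_cat C D\<^esub> Id (fun_cat C D) (Dom (fun_cat C D) f) = f"
    by (auto intro!: cell_eqI[of _ _ "Ob C"] simp: f.nat_ext)
next
  fix f g assume "f \<in> Ar (fun_cat C D)" "g \<in> Ar (fun_cat C D)" "Cod (fun_cat C D) f = Dom (fun_cat C D) g"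
  then show "g \<cdot>\<^bsub>fun_cat C D\<^esub> f \<in> Ar (fun_cat C D) \<and>
      Dom (fun_cat C D) (g \<cdot>\<^bsub>fun_cat C D\<^esub> f) = Dom (fun_cat C D) f \<and>
      Cod (fun_cat C D) (g \<cdot>\<^bsub>fun_cat C D\<^esub> f) = Cod (fun_cat C D) g"
    by (auto intro: is_nat_vcomp)
next
  fix f g h assume a: "f \<in> Ar (fun_cat C D)" "g \<in> Ar (fun_cat C D)" "h \<in> Ar (fun_cat C D)"
    and b: "Cod (fun_cat C D) f = Dom (fun_cat C D) g" "Cod (fun_cat C D) g = Dom (fun_cat C D) h"
  from a interpret f: is_nat C D "Src f" "Tgt f" "Cmp f" by simp
  from a b interpret g: is_nat C D "Tgt f" "Tgt g" "Cmp g" by simp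
  from a b interpret h: is_nat C D "Tgt g" "Tgt h" "Cmp h" by simp
  show "h \<cdot>\<^bsub>fun_cat C D\<^esub> (g \<cdot>\<^bsub>fun_cat C D\<^esub> f) = h \<cdot>\<^bsub>fun_cat C D\<^esub> g \<cdot>\<^bsub>fun_cat C D\<^esub> f"
    by (auto intro!: cell_eqI[of _ _ "Ob C"] simp: f.src.cod.assoc)
qed (auto simp: is_nat_id)

lemma Cat2_simps [simp]:
  "Obj Cat2 = {C. category C}" "HomC Cat2 = fun_cat" "One Cat2 = id_ftr"
  by (simp_all add: Cat2_def)

lemma HC_Cat2_FO [simp]:
  "is_functor D E G \<Longrightarrow> is_functor C D F \<Longrightarrow> FO (HC Cat2 C D E) (G, F) = comp_ftr C G F"
  by (simp add: Cat2_def)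

lemma HC_Cat2_FA [simp]:
  "is_nat D E (Src s) (Tgt s) (Cmp s) \<Longrightarrow> is_nat C D (Src t) (Tgt t) (Cmp t) \<Longrightarrow>
    FA (HC Cat2 C D E) (s, t) = \<lparr>Src = comp_ftr C (Src s) (Src t), Tgt = comp_ftr C (Tgt s) (Tgt t),
          Cmp = (\<lambda>x\<in>Ob C. Cmp s (FO (Tgt t) x) \<cdot>\<^bsub>E\<^esub> FA (Src s) (Cmp t x))\<rparr>"
  by (simp add: Cat2_def)

lemma two_category_Cat2:
  "two_category (Cat2 :: (('o, 'm) cat, ('o, 'm, 'o, 'm) ftr, (('o, 'm, 'o, 'm) ftr, 'o, 'm) cell) two_cat)"
proof (rule two_category.intro)
  fix C D :: "('o, 'm) cat"
  assume "C \<in> Obj Cat2" "D \<in> Obj Cat2"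
  then show "category (HomC Cat2 C D)" by (simp add: category_fun_cat)
next
  fix C :: "('o, 'm) cat" assume "C \<in> Obj Cat2"
  then show "One Cat2 C \<in> Ob (HomC Cat2 C C)" by simp
next
  fix C D E :: "('o, 'm) cat"
  assume obj: "C \<in> Obj Cat2" "D \<in> Obj Cat2" "E \<in> Obj Cat2"
  have HC: "HC Cat2 C D E = ftr_on (prod_cat (fun_cat D E) (fun_cat C D)) (\<lambda>(G, F). comp_ftr C G F)
     (\<lambda>(s, t). \<lparr>Src = comp_ftr C (Src s) (Src t), Tgt = comp_ftr C (Tgt s) (Tgt t),
          Cmp = (\<lambda>x\<in>Ob C. Cmp s (FO (Tgt t) x) \<cdot>\<^bsub>E\<^esub> FA (Src s) (Cmp t x))\<rparr>)"
    by (simp add: Cat2_def)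
  show "is_functor (prod_cat (HomC Cat2 D E) (HomC Cat2 C D)) (HomC Cat2 C E) (HC Cat2 C D E)"
    unfolding HC Cat2_simps
  proof (rule is_functor_ftr_on, goal_cases)
    case (5 x)
    obtain G F where x: "x = (G, F)" "is_functor D E G" "is_functor C D F" using 5 by auto
    interpret G: is_functor D E G by fact
    interpret F: is_functor C D F by fact
    show ?case by (auto simp: x restrict_def fun_eq_iff)
  next
    case (6 f g)
    obtain s t s' t' where fg: "f = (s, t)" "g = (s', t')" by (cases f, cases g)
    with 6 have cells: "is_nat C D (Src t) (Tgt t) (Cmp t)" "is_nat C D (Tgt t) (Tgt t') (Cmp t')"
      "is_nat D E (Src s) (Tgt s) (Cmp s)" "is_nat D E (Tgt s) (Tgt s') (Cmp s')"
      and eqs: "Src t' = Tgt t" "Src s' = Tgt s"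
      by auto
    interpret t': is_nat C D "Tgt t" "Tgt t'" "Cmp t'" by fact
    show ?case using interchange[OF cells] by (auto simp: fg eqs restrict_def fun_eq_iff)
  qed (use obj in \<open>auto simp: category_fun_cat intro: is_functor_comp is_nat_hcomp\<close>)
next
  fix C D :: "('o, 'm) cat" and F
  assume obj: "C \<in> Obj Cat2" "D \<in> Obj Cat2" and "F \<in> Ob (HomC Cat2 C D)"
  then show "FO (HC Cat2 C D D) (One Cat2 D, F) = F" "FO (HC Cat2 C C D) (F, One Cat2 C) = F"
    by (simp_all add: comp_ftr_id_left comp_ftr_id_right)
next
  fix C D :: "('o, 'm) cat" and t
  assume obj: "C \<in> Obj Cat2" "D \<in> Obj Cat2" and t: "t \<in> Ar (HomC Cat2 C D)"
  then interpret t: is_nat C D "Src t" "Tgt t" "Cmp t" by simp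
  show "FA (HC Cat2 C D D) (One2 Cat2 D, t) = t" "FA (HC Cat2 C C D) (t, One2 Cat2 C) = t"
    using obj t
    by (auto intro!: cell_eqI[of _ _ "Ob C"] 
        simp: comp_ftr_id_left[OF t.src.is_functor_axioms] comp_ftr_id_left[OF t.tgt.is_functor_axioms]
          comp_ftr_id_right[OF t.src.is_functor_axioms] comp_ftr_id_right[OF t.tgt.is_functor_axioms]
          t.nat_ext is_nat_id)
next
  fix B C D E :: "('o, 'm) cat" and F G H
  assume "F \<in> Ob (HomC Cat2 B C)" "G \<in> Ob (HomC Cat2 C D)" "H \<in> Ob (HomC Cat2 D E)"
  then show "FO (HC Cat2 B D E) (H, FO (HC Cat2 B C D) (G, F)) = FO (HC Cat2 B C E) (FO (HC Cat2 C D E) (H, G), F)"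
    by (simp add: is_functor_comp comp_ftr_assoc)
next
  fix B C D E :: "('o, 'm) cat" and r s t
  assume a: "r \<in> Ar (HomC Cat2 B C)" "s \<in> Ar (HomC Cat2 C D)" "t \<in> Ar (HomC Cat2 D E)"
  from a interpret r: is_nat B C "Src r" "Tgt r" "Cmp r" by simp
  from a interpret s: is_nat C D "Src s" "Tgt s" "Cmp s" by simp
  from a interpret t: is_nat D E "Src t" "Tgt t" "Cmp t" by simp
  show "FA (HC Cat2 B D E) (t, FA (HC Cat2 B C D) (s, r)) = FA (HC Cat2 B C E) (FA (HC Cat2 C D E) (t, s), r)"
    using a
    by (simp add: is_nat_hcomp[of B C _ _ "Cmp r" D] is_nat_hcomp[of C D _ _ "Cmp s" E]
        comp_ftr_assoc[OF r.src.is_functor_axioms s.src.is_functor_axioms]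
        comp_ftr_assoc[OF r.tgt.is_functor_axioms s.tgt.is_functor_axioms])
      (auto simp: restrict_def fun_eq_iff t.src.cod.assoc)
qed

section \<open>The 2-category of bimodules\<close>

text \<open>Turns a commuting square into a rewrite rule that also applies in the middle of a composite bracketed
  to the right; diagrams are pasted by combining it with associativity.\<close>
lemma (in category) comp_rewrite:
  assumes eq: "g \<cdot>\<^bsub>C\<^esub> f = g' \<cdot>\<^bsub>C\<^esub> f'"
    and ar: "f \<in> Ar C" "g \<in> Ar C" "Cod C f = Dom C g" "f' \<in> Ar C" "g' \<in> Ar C" "Cod C f' = Dom C g'"
    and k: "k \<in> Ar C" "Cod C k = Dom C f"
  shows "g \<cdot>\<^bsub>C\<^esub> (f \<cdot>\<^bsub>C\<^esub> k) = g' \<cdot>\<^bsub>C\<^esub> (f' \<cdot>\<^bsub>C\<^esub> k)"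
proof -
  have "Dom C f = Dom C f'"
    using comp_ar(2)[OF ar(1-3)] comp_ar(2)[OF ar(4-6)] eq by simp
  then show ?thesis
    using assoc[OF k(1) ar(1,2) k(2) ar(3)] assoc[OF k(1) ar(4,5) _ ar(6)] k eq by simp
qed

context strict_monoidal_category
begin

interpretation ten: is_functor "prod_cat A A" A "Ten A"
  by (rule ten_functor)

lemma ten_simps [simp]:
  "a \<in> Ob A \<Longrightarrow> b \<in> Ob A \<Longrightarrow> tenO A a b \<in> Ob A"
  "f \<in> Ar A \<Longrightarrow> g \<in> Ar A \<Longrightarrow> tenA A f g \<in> Ar A"
  "f \<in> Ar A \<Longrightarrow> g \<in> Ar A \<Longrightarrow> Dom A (tenA A f g) = tenO A (Dom A f) (Dom A g)"
  "f \<in> Ar A \<Longrightarrow> g \<in> Ar A \<Longrightarrow> Cod A (tenA A f g) = tenO A (Cod A f) (Cod A g)"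
  using ten.FO_ob[of "(a, b)"] ten.FA_ar[of "(f, g)"] ten.FA_dom[of "(f, g)"] ten.FA_cod[of "(f, g)"]
  by simp_all

lemma ten_id: "a \<in> Ob A \<Longrightarrow> b \<in> Ob A \<Longrightarrow> tenA A (Id A a) (Id A b) = Id A (tenO A a b)"
  using ten.FA_id[of "(a, b)"] by simp

lemma ten_comp:
  assumes "f \<in> Ar A" "f' \<in> Ar A" "Cod A f = Dom A f'" "g \<in> Ar A" "g' \<in> Ar A" "Cod A g = Dom A g'"
  shows "tenA A (f' \<cdot>\<^bsub>A\<^esub> f) (g' \<cdot>\<^bsub>A\<^esub> g) = tenA A f' g' \<cdot>\<^bsub>A\<^esub> tenA A f g"
  using ten.FA_compose[of "(f, g)" "(f', g')"] assms by simp

lemmas strict_simps [simp] = unt_ob ten_unit_left ten_unit_left_ar ten_unit_right ten_unit_right_ar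

end

context bimodule
begin

interpretation L: is_functor "prod_cat A (Und X)" "Und X" "LAct X"
  by (rule lact_functor)
interpretation R: is_functor "prod_cat (Und X) A" "Und X" "RAct X"
  by (rule ract_functor)

lemma lact_simps [simp]:
  "a \<in> Ob A \<Longrightarrow> x \<in> Ob (Und X) \<Longrightarrow> lO X a x \<in> Ob (Und X)"
  "f \<in> Ar A \<Longrightarrow> h \<in> Ar (Und X) \<Longrightarrow> lA X f h \<in> Ar (Und X)"
  "f \<in> Ar A \<Longrightarrow> h \<in> Ar (Und X) \<Longrightarrow> Dom (Und X) (lA X f h) = lO X (Dom A f) (Dom (Und X) h)"
  "f \<in> Ar A \<Longrightarrow> h \<in> Ar (Und X) \<Longrightarrow> Cod (Und X) (lA X f h) = lO X (Cod A f) (Cod (Und X) h)"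
  "a \<in> Ob A \<Longrightarrow> x \<in> Ob (Und X) \<Longrightarrow> lA X (Id A a) (Id (Und X) x) = Id (Und X) (lO X a x)"
  using L.FO_ob[of "(a, x)"] L.FA_ar[of "(f, h)"] L.FA_dom[of "(f, h)"] L.FA_cod[of "(f, h)"]
    L.FA_id[of "(a, x)"]
  by simp_all

lemma ract_simps [simp]:
  "a \<in> Ob A \<Longrightarrow> x \<in> Ob (Und X) \<Longrightarrow> rO X x a \<in> Ob (Und X)"
  "f \<in> Ar A \<Longrightarrow> h \<in> Ar (Und X) \<Longrightarrow> rA X h f \<in> Ar (Und X)"
  "f \<in> Ar A \<Longrightarrow> h \<in> Ar (Und X) \<Longrightarrow> Dom (Und X) (rA X h f) = rO X (Dom (Und X) h) (Dom A f)"
  "f \<in> Ar A \<Longrightarrow> h \<in> Ar (Und X) \<Longrightarrow> Cod (Und X) (rA X h f) = rO X (Cod (Und X) h) (Cod A f)"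
  "a \<in> Ob A \<Longrightarrow> x \<in> Ob (Und X) \<Longrightarrow> rA X (Id (Und X) x) (Id A a) = Id (Und X) (rO X x a)"
  using R.FO_ob[of "(x, a)"] R.FA_ar[of "(h, f)"] R.FA_dom[of "(h, f)"] R.FA_cod[of "(h, f)"]
    R.FA_id[of "(x, a)"]
  by simp_all

lemma lact_comp:
  assumes "f \<in> Ar A" "f' \<in> Ar A" "Cod A f = Dom A f'"
    and "h \<in> Ar (Und X)" "h' \<in> Ar (Und X)" "Cod (Und X) h = Dom (Und X) h'"
  shows "lA X (f' \<cdot>\<^bsub>A\<^esub> f) (h' \<cdot>\<^bsub>Und X\<^esub> h) = lA X f' h' \<cdot>\<^bsub>Und X\<^esub> lA X f h"
  using L.FA_compose[of "(f, h)" "(f', h')"] assms by simp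

lemma ract_comp:
  assumes "f \<in> Ar A" "f' \<in> Ar A" "Cod A f = Dom A f'"
    and "h \<in> Ar (Und X)" "h' \<in> Ar (Und X)" "Cod (Und X) h = Dom (Und X) h'"
  shows "rA X (h' \<cdot>\<^bsub>Und X\<^esub> h) (f' \<cdot>\<^bsub>A\<^esub> f) = rA X h' f' \<cdot>\<^bsub>Und X\<^esub> rA X h f"
  using R.FA_compose[of "(h, f)" "(h', f')"] assms by simp

lemma whisker_comp [simp]:
  assumes "a \<in> Ob A" "h \<in> Ar (Und X)" "h' \<in> Ar (Und X)" "Cod (Und X) h = Dom (Und X) h'"
  shows "lW A X a (h' \<cdot>\<^bsub>Und X\<^esub> h) = lW A X a h' \<cdot>\<^bsub>Und X\<^esub> lW A X a h"
    and "rW A X (h' \<cdot>\<^bsub>Und X\<^esub> h) a = rW A X h' a \<cdot>\<^bsub>Und X\<^esub> rW A X h a"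
  using lact_comp[of "Id A a" "Id A a" h h'] ract_comp[of "Id A a" "Id A a" h h'] assms by simp_all

lemma lam_ar [simp]:
  assumes "a \<in> Ob A" "x \<in> Ob (Und X)" "b \<in> Ob A"
  shows "Lam X a x b \<in> Ar (Und X)" "Dom (Und X) (Lam X a x b) = lO X a (rO X x b)"
    "Cod (Und X) (Lam X a x b) = rO X (lO X a x) b"
  using lam_hom[OF assms] by (simp_all add: hom_def)

lemmas unit_simps [simp] = lact_unit lact_unit_ar ract_unit ract_unit_ar lam_unit_left lam_unit_right

end

context bimodule_morphism
begin

lemma rho_ar [simp]:
  assumes "a \<in> Ob A" "x \<in> Ob (Und X)"
  shows "Rho p (a, x) \<in> Ar (Und Y)" "Dom (Und Y) (Rho p (a, x)) = lO Y a (pO p x)"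
    "Cod (Und Y) (Rho p (a, x)) = pO p (lO X a x)"
  using rho_hom[OF assms] by (simp_all add: hom_def)

lemmas strictness [simp] = right_strict right_strict_ar rho_unit

end

lemma bimodule_morphismI:
  assumes "bimodule A X" "bimodule A Y" "is_functor (Und X) (Und Y) (Fun p)"
    and "\<And>x b. x \<in> Ob (Und X) \<Longrightarrow> b \<in> Ob A \<Longrightarrow> pO p (rO X x b) = rO Y (pO p x) b"
    and "\<And>h g. h \<in> Ar (Und X) \<Longrightarrow> g \<in> Ar A \<Longrightarrow> pA p (rA X h g) = rA Y (pA p h) g"
    and "Rho p \<in> extensional (Ob A \<times> Ob (Und X))"
    and "\<And>a x. a \<in> Ob A \<Longrightarrow> x \<in> Ob (Und X) \<Longrightarrow> Rho p (a, x) \<in> Ar (Und Y) \<and>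
      Dom (Und Y) (Rho p (a, x)) = lO Y a (pO p x) \<and> Cod (Und Y) (Rho p (a, x)) = pO p (lO X a x)"
    and "\<And>f h. f \<in> Ar A \<Longrightarrow> h \<in> Ar (Und X) \<Longrightarrow>
      Rho p (Cod A f, Cod (Und X) h) \<cdot>\<^bsub>Und Y\<^esub> lA Y f (pA p h) =
      pA p (lA X f h) \<cdot>\<^bsub>Und Y\<^esub> Rho p (Dom A f, Dom (Und X) h)"
    and "\<And>x. x \<in> Ob (Und X) \<Longrightarrow> Rho p (Unt A, x) = Id (Und Y) (pO p x)"
    and "\<And>a b x. a \<in> Ob A \<Longrightarrow> b \<in> Ob A \<Longrightarrow> x \<in> Ob (Und X) \<Longrightarrow>
      Rho p (tenO A a b, x) = Rho p (a, lO X b x) \<cdot>\<^bsub>Und Y\<^esub> lW A Y a (Rho p (b, x))"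
    and "\<And>a x b. a \<in> Ob A \<Longrightarrow> x \<in> Ob (Und X) \<Longrightarrow> b \<in> Ob A \<Longrightarrow>
      pA p (Lam X a x b) \<cdot>\<^bsub>Und Y\<^esub> Rho p (a, rO X x b) =
      rW A Y (Rho p (a, x)) b \<cdot>\<^bsub>Und Y\<^esub> Lam Y a (pO p x) b"
  shows "bimodule_morphism A X Y p"
  by (intro bimodule_morphism.intro bimodule_morphism_axioms.intro assms(1-3))
    (use assms(4-) in \<open>auto simp: hom_def\<close>)

lemma id_bmor_simps [simp]:
  "Fun (id_bmor A X) = id_ftr (Und X)"
  "a \<in> Ob A \<Longrightarrow> x \<in> Ob (Und X) \<Longrightarrow> Rho (id_bmor A X) (a, x) = Id (Und X) (lO X a x)"
  by (simp_all add: id_bmor_def)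

lemma bimodule_morphism_id:
  assumes "bimodule A X"
  shows "bimodule_morphism A X X (id_bmor A X)"
proof -
  interpret bimodule A X by fact
  show ?thesis
    by (rule bimodule_morphismI)
     (auto simp: assms Und.category_axioms lact_assoc id_bmor_def)
qed

lemma comp_bmor_simps [simp]:
  "Fun (comp_bmor A X Z q p) = comp_ftr (Und X) (Fun q) (Fun p)"
  "a \<in> Ob A \<Longrightarrow> x \<in> Ob (Und X) \<Longrightarrow>
    Rho (comp_bmor A X Z q p) (a, x) = pA q (Rho p (a, x)) \<cdot>\<^bsub>Und Z\<^esub> Rho q (a, pO p x)"
  by (simp_all add: comp_bmor_def)

lemma Rho_comp_bmor_extensional [simp]:
  "Rho (comp_bmor A X Z q p) \<in> extensional (Ob A \<times> Ob (Und X))"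
  by (simp add: comp_bmor_def)

lemma Rho_id_bmor_extensional [simp]:
  "Rho (id_bmor A X) \<in> extensional (Ob A \<times> Ob (Und X))"
  by (simp add: id_bmor_def)

text \<open>The three coherence diagrams for \<open>q \<circ> p\<close> paste from those for \<open>p\<close> (under \<open>q\<close>) and for \<open>q\<close>. In the
  tensor law the two halves are exchanged by naturality of the structure map of \<open>q\<close> at that of \<open>p\<close>.\<close>
lemma bimodule_morphism_comp:
  assumes "bimodule_morphism A X Y p" "bimodule_morphism A Y Z q"
  shows "bimodule_morphism A X Z (comp_bmor A X Z q p)"
proof -
  interpret p: bimodule_morphism A X Y p by fact
  interpret q: bimodule_morphism A Y Z q by fact
  note assoc = q.Y.Und.assoc and rewrite = q.Y.Und.comp_rewrite
  show ?thesis
  proof (rule bimodule_morphismI)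
    fix f h assume fh: "f \<in> Ar A" "h \<in> Ar (Und X)"
    let ?r = "Rho p (Cod A f, Cod (Und X) h)" and ?r' = "Rho p (Dom A f, Dom (Und X) h)"
    have q: "Rho q (Cod A f, pO p (Cod (Und X) h)) \<cdot>\<^bsub>Und Z\<^esub> lA Z f (pA q (pA p h)) =
      pA q (lA Y f (pA p h)) \<cdot>\<^bsub>Und Z\<^esub> Rho q (Dom A f, pO p (Dom (Und X) h))"
      using q.rho_natural[of f "pA p h"] fh by simp
    have "pA q (?r \<cdot>\<^bsub>Und Y\<^esub> lA Y f (pA p h)) = pA q (pA p (lA X f h) \<cdot>\<^bsub>Und Y\<^esub> ?r')"
      using p.rho_natural[OF fh] by simp
    then have p: "pA q ?r \<cdot>\<^bsub>Und Z\<^esub> pA q (lA Y f (pA p h)) = pA q (pA p (lA X f h)) \<cdot>\<^bsub>Und Z\<^esub> pA q ?r'"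
      using fh by simp
    show "Rho (comp_bmor A X Z q p) (Cod A f, Cod (Und X) h) \<cdot>\<^bsub>Und Z\<^esub> lA Z f (pA (comp_bmor A X Z q p) h) =
      pA (comp_bmor A X Z q p) (lA X f h) \<cdot>\<^bsub>Und Z\<^esub> Rho (comp_bmor A X Z q p) (Dom A f, Dom (Und X) h)"
      using fh by (simp add: assoc q rewrite[OF p])
  next
    fix a b x assume abx: "a \<in> Ob A" "b \<in> Ob A" "x \<in> Ob (Und X)"
    have q: "Rho q (a, pO p (lO X b x)) \<cdot>\<^bsub>Und Z\<^esub> lW A Z a (pA q (Rho p (b, x))) =
      pA q (lW A Y a (Rho p (b, x))) \<cdot>\<^bsub>Und Z\<^esub> Rho q (a, lO Y b (pO p x))"
      using q.rho_natural[of "Id A a" "Rho p (b, x)"] abx by simp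
    show "Rho (comp_bmor A X Z q p) (tenO A a b, x) =
      Rho (comp_bmor A X Z q p) (a, lO X b x) \<cdot>\<^bsub>Und Z\<^esub> lW A Z a (Rho (comp_bmor A X Z q p) (b, x))"
      using abx by (simp add: p.rho_ten q.rho_ten p.X.lact_assoc p.Y.lact_assoc q.Y.lact_assoc
        assoc rewrite[OF q])
  next
    fix a x b assume axb: "a \<in> Ob A" "x \<in> Ob (Und X)" "b \<in> Ob A"
    have "pA q (pA p (Lam X a x b) \<cdot>\<^bsub>Und Y\<^esub> Rho p (a, rO X x b)) =
        pA q (rW A Y (Rho p (a, x)) b \<cdot>\<^bsub>Und Y\<^esub> Lam Y a (pO p x) b)"
      using p.rho_lam[OF axb] by simp
    then have p: "pA q (pA p (Lam X a x b)) \<cdot>\<^bsub>Und Z\<^esub> pA q (Rho p (a, rO X x b)) =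
        rW A Z (pA q (Rho p (a, x))) b \<cdot>\<^bsub>Und Z\<^esub> pA q (Lam Y a (pO p x) b)"
      using axb by simp
    have q: "pA q (Lam Y a (pO p x) b) \<cdot>\<^bsub>Und Z\<^esub> Rho q (a, rO Y (pO p x) b) =
        rW A Z (Rho q (a, pO p x)) b \<cdot>\<^bsub>Und Z\<^esub> Lam Z a (pO q (pO p x)) b"
      using q.rho_lam[of a "pO p x" b] axb by simp
    show "pA (comp_bmor A X Z q p) (Lam X a x b) \<cdot>\<^bsub>Und Z\<^esub> Rho (comp_bmor A X Z q p) (a, rO X x b) =
      rW A Z (Rho (comp_bmor A X Z q p) (a, x)) b \<cdot>\<^bsub>Und Z\<^esub> Lam Z a (pO (comp_bmor A X Z q p) x) b"
      using axb by (simp add: assoc rewrite[OF p] q)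
  qed (auto simp: p.X.bimodule_axioms q.Y.bimodule_axioms
      intro: is_functor_comp p.Fun.is_functor_axioms q.Fun.is_functor_axioms)
qed

text \<open>As functors and structure maps are extensional, morphisms of bimodules that agree on their domains
  are equal as records.\<close>
lemma bmor_eqI:
  fixes p q :: "('a, 'x, 'y, 'v, 'w) bmor"
  assumes "Fun p = Fun q" "Rho p \<in> extensional (S \<times> T)" "Rho q \<in> extensional (S \<times> T)"
    and "\<And>a x. a \<in> S \<Longrightarrow> x \<in> T \<Longrightarrow> Rho p (a, x) = Rho q (a, x)"
  shows "p = q"
proof -
  have "Rho p = Rho q"
    using assms(4) by (intro extensionalityI[OF assms(2,3)]) auto
  with assms(1) show ?thesis by (simp add: bmor.equality)
qed

lemma comp_bmor_id_left:
  assumes "bimodule_morphism A X Y p" shows "comp_bmor A X Y (id_bmor A Y) p = p"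
proof -
  interpret p: bimodule_morphism A X Y p by fact
  show ?thesis
    by (rule bmor_eqI[of _ _ "Ob A" "Ob (Und X)"])
      (simp_all add: comp_ftr_id_left[OF p.Fun.is_functor_axioms] p.rho_ext)
qed

lemma comp_bmor_id_right:
  assumes "bimodule_morphism A X Y p" shows "comp_bmor A X Y p (id_bmor A X) = p"
proof -
  interpret p: bimodule_morphism A X Y p by fact
  show ?thesis
    by (rule bmor_eqI[of _ _ "Ob A" "Ob (Und X)"])
      (simp_all add: comp_ftr_id_right[OF p.Fun.is_functor_axioms] p.rho_ext)
qed

lemma comp_bmor_assoc:
  assumes "bimodule_morphism A W X p" "bimodule_morphism A X Y q" "bimodule_morphism A Y Z r"
  shows "comp_bmor A W Z r (comp_bmor A W Y q p) = comp_bmor A W Z (comp_bmor A X Z r q) p"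
proof -
  interpret p: bimodule_morphism A W X p by fact
  interpret q: bimodule_morphism A X Y q by fact
  interpret r: bimodule_morphism A Y Z r by fact
  show ?thesis
    by (rule bmor_eqI[of _ _ "Ob A" "Ob (Und W)"])
      (simp_all add: comp_ftr_assoc[OF p.Fun.is_functor_axioms q.Fun.is_functor_axioms]
        r.Y.Und.assoc)
qed

lemma bimodule_cellI:
  assumes "bimodule_morphism A X Y p" "bimodule_morphism A X Y q"
    and "is_nat (Und X) (Und Y) (Fun p) (Fun q) \<tau>"
    and "\<And>a x. a \<in> Ob A \<Longrightarrow> x \<in> Ob (Und X) \<Longrightarrow>
      Rho q (a, x) \<cdot>\<^bsub>Und Y\<^esub> lW A Y a (\<tau> x) = \<tau> (lO X a x) \<cdot>\<^bsub>Und Y\<^esub> Rho p (a, x)"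
    and "\<And>x b. x \<in> Ob (Und X) \<Longrightarrow> b \<in> Ob A \<Longrightarrow> \<tau> (rO X x b) = rW A Y (\<tau> x) b"
  shows "bimodule_cell A X Y p q \<tau>"
  by (intro bimodule_cell.intro bimodule_cell_axioms.intro assms(1-3)) (use assms(4-) in auto)

lemma bimodule_cell_id:
  assumes "bimodule_morphism A X Y p"
  shows "bimodule_cell A X Y p p (\<lambda>x\<in>Ob (Und X). Id (Und Y) (pO p x))"
proof -
  interpret p: bimodule_morphism A X Y p by fact
  show ?thesis
    by (rule bimodule_cellI) (auto simp: assms intro: is_nat_id p.Fun.is_functor_axioms)
qed

lemma bimodule_cell_vcomp:
  assumes "bimodule_cell A X Y p q \<tau>" "bimodule_cell A X Y q r \<sigma>"
  shows "bimodule_cell A X Y p r (\<lambda>x\<in>Ob (Und X). \<sigma> x \<cdot>\<^bsub>Und Y\<^esub> \<tau> x)"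
proof -
  interpret T: bimodule_cell A X Y p q \<tau> by fact
  interpret S: bimodule_cell A X Y q r \<sigma> by fact
  show ?thesis
  proof (rule bimodule_cellI)
    fix a x assume ax: "a \<in> Ob A" "x \<in> Ob (Und X)"
    show "Rho r (a, x) \<cdot>\<^bsub>Und Y\<^esub> lW A Y a ((\<lambda>x\<in>Ob (Und X). \<sigma> x \<cdot>\<^bsub>Und Y\<^esub> \<tau> x) x) =
      (\<lambda>x\<in>Ob (Und X). \<sigma> x \<cdot>\<^bsub>Und Y\<^esub> \<tau> x) (lO X a x) \<cdot>\<^bsub>Und Y\<^esub> Rho p (a, x)"
      using ax by (simp add: T.src.Y.Und.assoc T.cell_left
        T.src.Y.Und.comp_rewrite[OF S.cell_left])
  qed (auto simp: T.src.bimodule_morphism_axioms S.tgt.bimodule_morphism_axioms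
      T.cell_right S.cell_right intro: is_nat_vcomp T.is_nat_axioms S.is_nat_axioms)
qed

text \<open>The pasting uses, in this order: the cell law of \<open>\<sigma>\<close>, naturality of the structure map of \<open>q\<close> at
  \<open>\<tau> x\<close>, naturality of \<open>\<sigma>\<close> at the structure map of \<open>p'\<close>, and \<open>q\<close> applied to the cell law of \<open>\<tau>\<close>.\<close>
lemma bimodule_cell_hcomp:
  assumes "bimodule_cell A X Y p p' \<tau>" "bimodule_cell A Y Z q q' \<sigma>"
  shows "bimodule_cell A X Z (comp_bmor A X Z q p) (comp_bmor A X Z q' p')
    (\<lambda>x\<in>Ob (Und X). \<sigma> (pO p' x) \<cdot>\<^bsub>Und Z\<^esub> pA q (\<tau> x))"
proof -
  interpret T: bimodule_cell A X Y p p' \<tau> by fact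
  interpret S: bimodule_cell A Y Z q q' \<sigma> by fact
  note assoc = S.src.Y.Und.assoc and rewrite = S.src.Y.Und.comp_rewrite
  show ?thesis
  proof (rule bimodule_cellI)
    fix a x assume ax: "a \<in> Ob A" "x \<in> Ob (Und X)"
    have 1: "Rho q' (a, pO p' x) \<cdot>\<^bsub>Und Z\<^esub> lW A Z a (\<sigma> (pO p' x)) =
        \<sigma> (lO Y a (pO p' x)) \<cdot>\<^bsub>Und Z\<^esub> Rho q (a, pO p' x)"
      using S.cell_left[of a "pO p' x"] ax by simp
    have 2: "Rho q (a, pO p' x) \<cdot>\<^bsub>Und Z\<^esub> lW A Z a (pA q (\<tau> x)) =
        pA q (lW A Y a (\<tau> x)) \<cdot>\<^bsub>Und Z\<^esub> Rho q (a, pO p x)"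
      using S.src.rho_natural[of "Id A a" "\<tau> x"] ax by simp
    have 3: "pA q' (Rho p' (a, x)) \<cdot>\<^bsub>Und Z\<^esub> \<sigma> (lO Y a (pO p' x)) =
        \<sigma> (pO p' (lO X a x)) \<cdot>\<^bsub>Und Z\<^esub> pA q (Rho p' (a, x))"
      using S.natural[of "Rho p' (a, x)"] ax by simp
    have "pA q (Rho p' (a, x) \<cdot>\<^bsub>Und Y\<^esub> lW A Y a (\<tau> x)) = pA q (\<tau> (lO X a x) \<cdot>\<^bsub>Und Y\<^esub> Rho p (a, x))"
      using T.cell_left ax by simp
    then have 4: "pA q (Rho p' (a, x)) \<cdot>\<^bsub>Und Z\<^esub> pA q (lW A Y a (\<tau> x)) =
        pA q (\<tau> (lO X a x)) \<cdot>\<^bsub>Und Z\<^esub> pA q (Rho p (a, x))"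
      using ax by simp
    show "Rho (comp_bmor A X Z q' p') (a, x) \<cdot>\<^bsub>Und Z\<^esub>
        lW A Z a ((\<lambda>x\<in>Ob (Und X). \<sigma> (pO p' x) \<cdot>\<^bsub>Und Z\<^esub> pA q (\<tau> x)) x) =
      (\<lambda>x\<in>Ob (Und X). \<sigma> (pO p' x) \<cdot>\<^bsub>Und Z\<^esub> pA q (\<tau> x)) (lO X a x) \<cdot>\<^bsub>Und Z\<^esub>
        Rho (comp_bmor A X Z q p) (a, x)"
      using ax by (simp add: assoc rewrite[OF 1] 2 rewrite[OF 3] rewrite[OF 4])
  qed (use is_nat_hcomp[OF T.is_nat_axioms S.is_nat_axioms] in
      \<open>auto simp: T.cell_right S.cell_right
      intro: bimodule_morphism_comp T.src.bimodule_morphism_axioms S.src.bimodule_morphism_axioms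
        T.tgt.bimodule_morphism_axioms S.tgt.bimodule_morphism_axioms\<close>)
qed

lemma bimod_hom_simps [simp]:
  "Ob (bimod_hom A X Y) = {p. bimodule_morphism A X Y p}"
  "Ar (bimod_hom A X Y) = {t. bimodule_cell A X Y (Src t) (Tgt t) (Cmp t)}"
  "Dom (bimod_hom A X Y) t = Src t"
  "Cod (bimod_hom A X Y) t = Tgt t"
  "Id (bimod_hom A X Y) p = \<lparr>Src = p, Tgt = p, Cmp = (\<lambda>x\<in>Ob (Und X). Id (Und Y) (pO p x))\<rparr>"
  "s \<cdot>\<^bsub>bimod_hom A X Y\<^esub> t =
    \<lparr>Src = Src t, Tgt = Tgt s, Cmp = (\<lambda>x\<in>Ob (Und X). Cmp s x \<cdot>\<^bsub>Und Y\<^esub> Cmp t x)\<rparr>"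
  by (simp_all add: bimod_hom_def)

lemma category_bimod_hom:
  assumes "bimodule A X" "bimodule A Y"
  shows "category (bimod_hom A X Y)"
proof (rule categoryI)
  fix f assume f: "f \<in> Ar (bimod_hom A X Y)"
  then interpret f: bimodule_cell A X Y "Src f" "Tgt f" "Cmp f" by simp
  show "Dom (bimod_hom A X Y) f \<in> Ob (bimod_hom A X Y) \<and> Cod (bimod_hom A X Y) f \<in> Ob (bimod_hom A X Y)"
    by (simp add: f.src.bimodule_morphism_axioms f.tgt.bimodule_morphism_axioms)
  show "Id (bimod_hom A X Y) (Cod (bimod_hom A X Y) f) \<cdot>\<^bsub>bimod_hom A X Y\<^esub> f = f \<and>
    f \<cdot>\<^bsub>bimod_hom A X Y\<^esub> Id (bimod_hom A X Y) (Dom (bimod_hom A X Y) f) = f"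
    by (auto intro!: cell_eqI[of _ _ "Ob (Und X)"] simp: f.nat_ext)
next
  fix f g assume "f \<in> Ar (bimod_hom A X Y)" "g \<in> Ar (bimod_hom A X Y)"
    "Cod (bimod_hom A X Y) f = Dom (bimod_hom A X Y) g"
  then show "g \<cdot>\<^bsub>bimod_hom A X Y\<^esub> f \<in> Ar (bimod_hom A X Y) \<and>
      Dom (bimod_hom A X Y) (g \<cdot>\<^bsub>bimod_hom A X Y\<^esub> f) = Dom (bimod_hom A X Y) f \<and>
      Cod (bimod_hom A X Y) (g \<cdot>\<^bsub>bimod_hom A X Y\<^esub> f) = Cod (bimod_hom A X Y) g"
    by (auto intro: bimodule_cell_vcomp)
next
  fix f g h assume a: "f \<in> Ar (bimod_hom A X Y)" "g \<in> Ar (bimod_hom A X Y)" "h \<in> Ar (bimod_hom A X Y)"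
    and b: "Cod (bimod_hom A X Y) f = Dom (bimod_hom A X Y) g"
      "Cod (bimod_hom A X Y) g = Dom (bimod_hom A X Y) h"
  from a interpret f: bimodule_cell A X Y "Src f" "Tgt f" "Cmp f" by simp
  from a b interpret g: bimodule_cell A X Y "Tgt f" "Tgt g" "Cmp g" by simp
  from a b interpret h: bimodule_cell A X Y "Tgt g" "Tgt h" "Cmp h" by simp
  show "h \<cdot>\<^bsub>bimod_hom A X Y\<^esub> (g \<cdot>\<^bsub>bimod_hom A X Y\<^esub> f) =
      h \<cdot>\<^bsub>bimod_hom A X Y\<^esub> g \<cdot>\<^bsub>bimod_hom A X Y\<^esub> f"
    by (auto intro!: cell_eqI[of _ _ "Ob (Und X)"] simp: f.src.Y.Und.assoc)
qed (auto simp: bimodule_cell_id)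

lemma Bimod2_simps [simp]:
  "Obj (Bimod2 A) = {X. bimodule A X}" "HomC (Bimod2 A) = bimod_hom A" "One (Bimod2 A) = id_bmor A"
  by (simp_all add: Bimod2_def)

lemma HC_Bimod2_FO [simp]:
  "bimodule_morphism A Y Z q \<Longrightarrow> bimodule_morphism A X Y p \<Longrightarrow>
    FO (HC (Bimod2 A) X Y Z) (q, p) = comp_bmor A X Z q p"
  by (simp add: Bimod2_def)

lemma HC_Bimod2_FA [simp]:
  "bimodule_cell A Y Z (Src s) (Tgt s) (Cmp s) \<Longrightarrow> bimodule_cell A X Y (Src t) (Tgt t) (Cmp t) \<Longrightarrow>
    FA (HC (Bimod2 A) X Y Z) (s, t) =
      \<lparr>Src = comp_bmor A X Z (Src s) (Src t), Tgt = comp_bmor A X Z (Tgt s) (Tgt t),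
       Cmp = (\<lambda>x\<in>Ob (Und X). Cmp s (pO (Tgt t) x) \<cdot>\<^bsub>Und Z\<^esub> pA (Src s) (Cmp t x))\<rparr>"
  by (simp add: Bimod2_def)

lemma two_category_Bimod2:
  fixes A :: "('a, 'b) smc"
  shows "two_category (Bimod2 A :: (('x, 'y, 'a, 'b) bimod, ('a, 'x, 'y, 'x, 'y) bmor,
    (('a, 'x, 'y, 'x, 'y) bmor, 'x, 'y) cell) two_cat)" (is "two_category ?B")
proof (rule two_category.intro)
  fix X Y :: "('x, 'y, 'a, 'b) bimod"
  assume "X \<in> Obj ?B" "Y \<in> Obj ?B"
  then show "category (HomC ?B X Y)" by (simp add: category_bimod_hom)
next
  fix X :: "('x, 'y, 'a, 'b) bimod" assume "X \<in> Obj ?B"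
  then show "One ?B X \<in> Ob (HomC ?B X X)" by (simp add: bimodule_morphism_id)
next
  fix X Y Z :: "('x, 'y, 'a, 'b) bimod"
  assume obj: "X \<in> Obj ?B" "Y \<in> Obj ?B" "Z \<in> Obj ?B"
  have HC: "HC ?B X Y Z = ftr_on (prod_cat (bimod_hom A Y Z) (bimod_hom A X Y))
       (\<lambda>(q, p). comp_bmor A X Z q p)
       (\<lambda>(s, t). \<lparr>Src = comp_bmor A X Z (Src s) (Src t), Tgt = comp_bmor A X Z (Tgt s) (Tgt t),
          Cmp = (\<lambda>x\<in>Ob (Und X). Cmp s (pO (Tgt t) x) \<cdot>\<^bsub>Und Z\<^esub> pA (Src s) (Cmp t x))\<rparr>)"
    by (simp add: Bimod2_def)
  show "is_functor (prod_cat (HomC ?B Y Z) (HomC ?B X Y)) (HomC ?B X Z) (HC ?B X Y Z)"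
    unfolding HC Bimod2_simps
  proof (rule is_functor_ftr_on, goal_cases)
    case (5 x)
    obtain q p where x: "x = (q, p)" "bimodule_morphism A Y Z q" "bimodule_morphism A X Y p"
      using 5 by auto
    interpret q: bimodule_morphism A Y Z q by fact
    interpret p: bimodule_morphism A X Y p by fact
    show ?case by (auto simp: x restrict_def fun_eq_iff)
  next
    case (6 f g)
    obtain s t s' t' where fg: "f = (s, t)" "g = (s', t')" by (cases f, cases g)
    with 6 have cells: "bimodule_cell A X Y (Src t) (Tgt t) (Cmp t)"
      "bimodule_cell A X Y (Tgt t) (Tgt t') (Cmp t')"
      "bimodule_cell A Y Z (Src s) (Tgt s) (Cmp s)" "bimodule_cell A Y Z (Tgt s) (Tgt s') (Cmp s')"
      and eqs: "Src t' = Tgt t" "Src s' = Tgt s"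
      by auto
    interpret t': bimodule_cell A X Y "Tgt t" "Tgt t'" "Cmp t'" by fact
    show ?case using interchange[OF cells[THEN bimodule_cell.axioms(3)]]
      by (auto simp: fg eqs restrict_def fun_eq_iff)
  qed (use obj in \<open>auto simp: category_bimod_hom intro: bimodule_morphism_comp bimodule_cell_hcomp\<close>)
next
  fix X Y :: "('x, 'y, 'a, 'b) bimod" and p
  assume obj: "X \<in> Obj ?B" "Y \<in> Obj ?B" and "p \<in> Ob (HomC ?B X Y)"
  then show "FO (HC ?B X Y Y) (One ?B Y, p) = p" "FO (HC ?B X X Y) (p, One ?B X) = p"
    by (simp_all add: comp_bmor_id_left comp_bmor_id_right bimodule_morphism_id)
next
  fix X Y :: "('x, 'y, 'a, 'b) bimod" and t
  assume obj: "X \<in> Obj ?B" "Y \<in> Obj ?B" and t: "t \<in> Ar (HomC ?B X Y)"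
  then interpret t: bimodule_cell A X Y "Src t" "Tgt t" "Cmp t" by simp
  note mors = t.src.bimodule_morphism_axioms t.tgt.bimodule_morphism_axioms
  note ids = bimodule_morphism_id[THEN bimodule_cell_id]
  show "FA (HC ?B X Y Y) (One2 ?B Y, t) = t" "FA (HC ?B X X Y) (t, One2 ?B X) = t"
    using obj t ids[of A X] ids[of A Y]
    by (auto intro!: cell_eqI[of _ _ "Ob (Und X)"] simp: mors[THEN comp_bmor_id_left]
        mors[THEN comp_bmor_id_right] t.nat_ext)
next
  fix W X Y Z :: "('x, 'y, 'a, 'b) bimod" and p q r
  assume "p \<in> Ob (HomC ?B W X)" "q \<in> Ob (HomC ?B X Y)" "r \<in> Ob (HomC ?B Y Z)"
  then show "FO (HC ?B W Y Z) (r, FO (HC ?B W X Y) (q, p)) =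
      FO (HC ?B W X Z) (FO (HC ?B X Y Z) (r, q), p)"
    by (simp add: bimodule_morphism_comp comp_bmor_assoc)
next
  fix W X Y Z :: "('x, 'y, 'a, 'b) bimod" and r s t
  assume a: "r \<in> Ar (HomC ?B W X)" "s \<in> Ar (HomC ?B X Y)" "t \<in> Ar (HomC ?B Y Z)"
  from a interpret r: bimodule_cell A W X "Src r" "Tgt r" "Cmp r" by simp
  from a interpret s: bimodule_cell A X Y "Src s" "Tgt s" "Cmp s" by simp
  from a interpret t: bimodule_cell A Y Z "Src t" "Tgt t" "Cmp t" by simp
  show "FA (HC ?B W Y Z) (t, FA (HC ?B W X Y) (s, r)) = FA (HC ?B W X Z) (FA (HC ?B X Y Z) (t, s), r)"
    using a
    by (simp add: bimodule_cell_hcomp[of A W X _ _ "Cmp r" Y] bimodule_cell_hcomp[of A X Y _ _ "Cmp s" Z]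
        comp_bmor_assoc[OF r.src.bimodule_morphism_axioms s.src.bimodule_morphism_axioms
          t.src.bimodule_morphism_axioms]
        comp_bmor_assoc[OF r.tgt.bimodule_morphism_axioms s.tgt.bimodule_morphism_axioms
          t.tgt.bimodule_morphism_axioms])
      (auto simp: restrict_def fun_eq_iff t.src.Y.Und.assoc)
qed

section \<open>The 2-functor \<open>(-) \<times> A\<close>\<close>

lemma (in two_category) HC_closed:
  "x \<in> Obj K \<Longrightarrow> y \<in> Obj K \<Longrightarrow> z \<in> Obj K \<Longrightarrow>
    f \<in> Ob (HomC K x y) \<Longrightarrow> g \<in> Ob (HomC K y z) \<Longrightarrow> FO (HC K x y z) (g, f) \<in> Ob (HomC K x z)"
  "x \<in> Obj K \<Longrightarrow> y \<in> Obj K \<Longrightarrow> z \<in> Obj K \<Longrightarrow>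
    s \<in> Ar (HomC K x y) \<Longrightarrow> t \<in> Ar (HomC K y z) \<Longrightarrow> FA (HC K x y z) (t, s) \<in> Ar (HomC K x z)"
  using is_functor.FO_ob[OF hc_functor, of x y z "(g, f)"] is_functor.FA_ar[OF hc_functor, of x y z "(t, s)"]
  by auto

lemma two_functor_id:
  assumes "two_category K"
  shows "two_functor K K (id_two_ftr K)"
proof -
  interpret K: two_category K by fact
  show ?thesis
    by (intro two_functor.intro two_functor_axioms.intro assms)
      (simp_all add: id_two_ftr_def K.hom_category K.one_ob K.HC_closed)
qed

lemma two_functor_comp:
  assumes "two_functor K L T" "two_functor L M S"
  shows "two_functor K M (comp_two_ftr K S T)"
proof -
  interpret T: two_functor K L T by fact
  interpret S: two_functor L M S by fact
  have T_ob: "FO (T1 T x y) f \<in> Ob (HomC L (T0 T x) (T0 T y))"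
    if "x \<in> Obj K" "y \<in> Obj K" "f \<in> Ob (HomC K x y)" for x y f
    using is_functor.FO_ob[OF T.T1_functor] that by blast
  have T_ar: "FA (T1 T x y) t \<in> Ar (HomC L (T0 T x) (T0 T y))"
    if "x \<in> Obj K" "y \<in> Obj K" "t \<in> Ar (HomC K x y)" for x y t
    using is_functor.FA_ar[OF T.T1_functor] that by blast
  show ?thesis
    by (intro two_functor.intro two_functor_axioms.intro T.dom.two_category_axioms S.cod.two_category_axioms)
      (auto simp: comp_two_ftr_def T.T0_obj S.T0_obj T.dom.one_ob T.T1_one S.T1_one T.dom.HC_closed
        T.T1_hc T.T1_hc2 S.T1_hc S.T1_hc2 T_ob T_ar intro: is_functor_comp[OF T.T1_functor S.T1_functor])
qed

lemma times_cat_simps [simp]: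
  "Pr y (AOb b) \<in> Ob (times_cat A P) \<longleftrightarrow> y \<in> Ob P \<and> b \<in> Ob A"
  "Pr h (AAr g) \<in> Ar (times_cat A P) \<longleftrightarrow> h \<in> Ar P \<and> g \<in> Ar A"
  "Dom (times_cat A P) (Pr h (AAr g)) = Pr (Dom P h) (AOb (Dom A g))"
  "Cod (times_cat A P) (Pr h (AAr g)) = Pr (Cod P h) (AOb (Cod A g))"
  "Id (times_cat A P) (Pr y (AOb b)) = Pr (Id P y) (AAr (Id A b))"
  "Pr h' (AAr g') \<cdot>\<^bsub>times_cat A P\<^esub> Pr h (AAr g) = Pr (h' \<cdot>\<^bsub>P\<^esub> h) (AAr (g' \<cdot>\<^bsub>A\<^esub> g))"
  by (auto simp: times_cat_def)

lemma times_ob_cases: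
  assumes "u \<in> Ob (times_cat A P)"
  obtains y b where "u = Pr y (AOb b)" "y \<in> Ob P" "b \<in> Ob A"
  using assms by (auto simp: times_cat_def)

lemma times_ar_cases:
  assumes "k \<in> Ar (times_cat A P)"
  obtains h g where "k = Pr h (AAr g)" "h \<in> Ar P" "g \<in> Ar A"
  using assms by (auto simp: times_cat_def)

lemma category_times_cat:
  assumes "category A" "category P"
  shows "category (times_cat A P)"
proof -
  interpret A: category A by fact
  interpret P: category P by fact
  show ?thesis
    by (rule categoryI) (auto elim!: times_ar_cases times_ob_cases simp: A.assoc P.assoc)
qed

lemma times_bimod_simps [simp]:
  "Und (times_bimod A P) = times_cat A P"
  "a \<in> Ob A \<Longrightarrow> y \<in> Ob P \<Longrightarrow> b \<in> Ob A \<Longrightarrow>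
    lO (times_bimod A P) a (Pr y (AOb b)) = Pr y (AOb (tenO A a b))"
  "f \<in> Ar A \<Longrightarrow> h \<in> Ar P \<Longrightarrow> g \<in> Ar A \<Longrightarrow>
    lA (times_bimod A P) f (Pr h (AAr g)) = Pr h (AAr (tenA A f g))"
  "y \<in> Ob P \<Longrightarrow> b \<in> Ob A \<Longrightarrow> a \<in> Ob A \<Longrightarrow>
    rO (times_bimod A P) (Pr y (AOb b)) a = Pr y (AOb (tenO A b a))"
  "h \<in> Ar P \<Longrightarrow> g \<in> Ar A \<Longrightarrow> f \<in> Ar A \<Longrightarrow>
    rA (times_bimod A P) (Pr h (AAr g)) f = Pr h (AAr (tenA A g f))"
  by (simp_all add: times_bimod_def times_lact_def times_ract_def)

context strict_monoidal_category
begin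

lemma Lam_times_bimod [simp]:
  "a \<in> Ob A \<Longrightarrow> y \<in> Ob P \<Longrightarrow> c \<in> Ob A \<Longrightarrow> b \<in> Ob A \<Longrightarrow>
    Lam (times_bimod A P) a (Pr y (AOb c)) b = Pr (Id P y) (AAr (Id A (tenO A a (tenO A c b))))"
  by (simp add: times_bimod_def times_lact_def times_ract_def)

text \<open>All the laws are instances of strict associativity and unitality of \<open>\<otimes>\<close> in the second coordinate;
  in particular \<open>a(ub) = (au)b\<close>, so that identities are admissible as \<open>\<lambda>\<close>.\<close>
lemma bimodule_times_bimod:
  assumes "category P"
  shows "bimodule A (times_bimod A P)"
proof -
  interpret P: category P by fact
  interpret AP: category "times_cat A P"
    by (rule category_times_cat[OF category_axioms assms])
  have lact: "is_functor (prod_cat A (times_cat A P)) (times_cat A P) (times_lact A P)"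
    unfolding times_lact_def
    by (rule is_functor_ftr_on)
      (auto elim!: times_ar_cases times_ob_cases
        simp: category_axioms AP.category_axioms ten_id ten_comp)
  have ract: "is_functor (prod_cat (times_cat A P) A) (times_cat A P) (times_ract A P)"
    unfolding times_ract_def
    by (rule is_functor_ftr_on)
      (auto elim!: times_ar_cases times_ob_cases
        simp: category_axioms AP.category_axioms ten_id ten_comp)
  show ?thesis
  proof (intro bimodule.intro bimodule_axioms.intro)
    show "strict_monoidal_category A" by unfold_locales
    show "category (Und (times_bimod A P))" by (simp add: AP.category_axioms)
    show "is_functor (prod_cat A (Und (times_bimod A P))) (Und (times_bimod A P)) (LAct (times_bimod A P))"
      "is_functor (prod_cat (Und (times_bimod A P)) A) (Und (times_bimod A P)) (RAct (times_bimod A P))"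
      using lact ract by (simp_all add: times_bimod_def)
  qed (auto elim!: times_ar_cases times_ob_cases
      simp: ten_assoc ten_assoc_ar ten_id in_hom_iff)
qed

end

lemma times_mor_simps [simp]:
  "Fun (times_mor A P Q F) =
    ftr_on (times_cat A P) (\<lambda>u. Pr (FO F (pfst u)) (psnd u)) (\<lambda>k. Pr (FA F (pfst k)) (psnd k))"
  "a \<in> Ob A \<Longrightarrow> u \<in> Ob (times_cat A P) \<Longrightarrow> Rho (times_mor A P Q F) (a, u) =
    Id (times_cat A Q) (lO (times_bimod A Q) a (Pr (FO F (pfst u)) (psnd u)))"
  "Rho (times_mor A P Q F) \<in> extensional (Ob A \<times> Ob (times_cat A P))"
  by (simp_all add: times_mor_def times_bimod_def Let_def)

context strict_monoidal_category
begin

lemma bimodule_morphism_times_mor: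
  assumes "is_functor P Q F"
  shows "bimodule_morphism A (times_bimod A P) (times_bimod A Q) (times_mor A P Q F)"
proof -
  interpret F: is_functor P Q F by fact
  note cats = category_times_cat[OF category_axioms F.dom.category_axioms]
    category_times_cat[OF category_axioms F.cod.category_axioms]
  show ?thesis
  proof (rule bimodule_morphismI)
    show "is_functor (Und (times_bimod A P)) (Und (times_bimod A Q)) (Fun (times_mor A P Q F))"
      unfolding times_bimod_simps times_mor_simps
      by (rule is_functor_ftr_on[OF cats]) (auto elim!: times_ar_cases times_ob_cases)
  qed (auto elim!: times_ar_cases times_ob_cases intro: bimodule_times_bimod
      simp: F.dom.category_axioms F.cod.category_axioms ten_id ten_assoc)
qed

lemma bimodule_cell_times_cell:
  assumes t: "is_nat P Q (Src t) (Tgt t) (Cmp t)"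
  defines "t' \<equiv> times_cell A P Q t"
  shows "bimodule_cell A (times_bimod A P) (times_bimod A Q) (Src t') (Tgt t') (Cmp t')"
proof -
  interpret t: is_nat P Q "Src t" "Tgt t" "Cmp t" by fact
  note mors = bimodule_morphism_times_mor[OF t.src.is_functor_axioms]
    bimodule_morphism_times_mor[OF t.tgt.is_functor_axioms]
  show ?thesis unfolding t'_def times_cell_def cell.simps
  proof (rule bimodule_cellI[OF mors])
    show "is_nat (Und (times_bimod A P)) (Und (times_bimod A Q))
     (Fun (times_mor A P Q (Src t))) (Fun (times_mor A P Q (Tgt t)))
     (\<lambda>u\<in>Ob (times_cat A P). Pr (Cmp t (pfst u)) (AAr (Id A (un_AOb (psnd u)))))"
      by (rule is_natI[OF mors[THEN bimodule_morphism.axioms(3)]])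
       (auto elim!: times_ar_cases times_ob_cases simp: t.natural)
  qed (auto elim!: times_ob_cases simp: ten_id)
qed

lemma Times2_simps [simp]:
  "T0 (Times2 A) = times_bimod A"
  "is_functor P Q F \<Longrightarrow> FO (T1 (Times2 A) P Q) F = times_mor A P Q F"
  "is_nat P Q (Src t) (Tgt t) (Cmp t) \<Longrightarrow> FA (T1 (Times2 A) P Q) t = times_cell A P Q t"
  by (simp_all add: Times2_def)

lemma times_mor_id:
  assumes "category P"
  shows "times_mor A P P (id_ftr P) = id_bmor A (times_bimod A P)"
proof -
  interpret P: category P by fact
  note mor = bimodule_morphism_times_mor[OF is_functor_id[OF assms]]
  note mor' = bimodule_morphism_id[OF bimodule_times_bimod[OF assms]]
  show ?thesis
  proof (rule bmor_eqI[of _ _ "Ob A" "Ob (times_cat A P)"])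
    show "Fun (times_mor A P P (id_ftr P)) = Fun (id_bmor A (times_bimod A P))"
      by (rule functor_eqI[OF mor[THEN bimodule_morphism.axioms(3)] mor'[THEN bimodule_morphism.axioms(3)]])
        (auto elim!: times_ar_cases times_ob_cases)
  qed (auto elim!: times_ob_cases simp: id_bmor_def)
qed

lemma times_mor_comp:
  assumes "is_functor P Q F" "is_functor Q R G"
  shows "times_mor A P R (comp_ftr P G F) =
    comp_bmor A (times_bimod A P) (times_bimod A R) (times_mor A Q R G) (times_mor A P Q F)"
proof -
  interpret F: is_functor P Q F by fact
  interpret G: is_functor Q R G by fact
  note mor = bimodule_morphism_times_mor[OF is_functor_comp[OF assms]]
  note mor' = bimodule_morphism_comp[OF assms[THEN bimodule_morphism_times_mor]]
  show ?thesis
  proof (rule bmor_eqI[of _ _ "Ob A" "Ob (times_cat A P)"])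
    show "Fun (times_mor A P R (comp_ftr P G F)) =
      Fun (comp_bmor A (times_bimod A P) (times_bimod A R) (times_mor A Q R G) (times_mor A P Q F))"
      by (rule functor_eqI[OF mor[THEN bimodule_morphism.axioms(3)] mor'[THEN bimodule_morphism.axioms(3)]])
        (auto elim!: times_ar_cases times_ob_cases)
  qed (auto elim!: times_ob_cases simp: comp_bmor_def)
qed

lemma times_cell_simps [simp]:
  "Src (times_cell A P Q t) = times_mor A P Q (Src t)"
  "Tgt (times_cell A P Q t) = times_mor A P Q (Tgt t)"
  "Cmp (times_cell A P Q t) \<in> extensional (Ob (times_cat A P))"
  "y \<in> Ob P \<Longrightarrow> b \<in> Ob A \<Longrightarrow> Cmp (times_cell A P Q t) (Pr y (AOb b)) = Pr (Cmp t y) (AAr (Id A b))"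
  by (simp_all add: times_cell_def)

lemma two_functor_Times2:
  "two_functor Cat2 (Bimod2 A) (Times2 A :: (('a, 'b, 'u) ucat, ('a, 'b, 'u) uftr, ('a, 'b, 'u) ucell,
     ('a, 'b, 'u) ubimod, ('a, 'b, 'u) ubmor, ('a, 'b, 'u) ubcell) two_ftr)"
proof (intro two_functor.intro two_functor_axioms.intro two_category_Cat2 two_category_Bimod2)
  fix P :: "('a, 'b, 'u) ucat" assume P: "P \<in> Obj Cat2"
  then show "T0 (Times2 A) P \<in> Obj (Bimod2 A)" by (simp add: bimodule_times_bimod)
  show "FO (T1 (Times2 A) P P) (One Cat2 P) = One (Bimod2 A) (T0 (Times2 A) P)"
    using P by (simp add: times_mor_id)
next
  fix P Q :: "('a, 'b, 'u) ucat" assume PQ: "P \<in> Obj Cat2" "Q \<in> Obj Cat2"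
  have T1: "T1 (Times2 A) P Q = ftr_on (fun_cat P Q) (times_mor A P Q) (times_cell A P Q)"
    by (simp add: Times2_def)
  show "is_functor (HomC Cat2 P Q) (HomC (Bimod2 A) (T0 (Times2 A) P) (T0 (Times2 A) Q)) (T1 (Times2 A) P Q)"
    unfolding T1 Cat2_simps Bimod2_simps Times2_simps
  proof (rule is_functor_ftr_on, goal_cases)
    case (5 F)
    then interpret F: is_functor P Q F by simp
    show ?case by (intro cell_eqI[of _ _ "Ob (times_cat A P)"]) (auto elim!: times_ob_cases)
  next
    case (6 t s)
    then interpret t: is_nat P Q "Src t" "Tgt t" "Cmp t" by simp
    show ?case by (intro cell_eqI[of _ _ "Ob (times_cat A P)"]) (auto elim!: times_ob_cases)
  qed (use PQ in \<open>auto simp: category_fun_cat category_bimod_hom bimodule_times_bimod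
     bimodule_morphism_times_mor bimodule_cell_times_cell[simplified]\<close>)
next
  fix P Q R :: "('a, 'b, 'u) ucat" and F G
  assume "F \<in> Ob (HomC Cat2 P Q)" "G \<in> Ob (HomC Cat2 Q R)"
  then show "FO (T1 (Times2 A) P R) (FO (HC Cat2 P Q R) (G, F)) =
    FO (HC (Bimod2 A) (T0 (Times2 A) P) (T0 (Times2 A) Q) (T0 (Times2 A) R))
     (FO (T1 (Times2 A) Q R) G, FO (T1 (Times2 A) P Q) F)"
    by (simp add: is_functor_comp times_mor_comp bimodule_morphism_times_mor)
next
  fix P Q R :: "('a, 'b, 'u) ucat" and t s
  assume a: "t \<in> Ar (HomC Cat2 P Q)" "s \<in> Ar (HomC Cat2 Q R)"
  from a interpret t: is_nat P Q "Src t" "Tgt t" "Cmp t" by simp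
  from a interpret s: is_nat Q R "Src s" "Tgt s" "Cmp s" by simp
  from a have "bimodule_cell A (times_bimod A P) (times_bimod A Q)
      (times_mor A P Q (Src t)) (times_mor A P Q (Tgt t)) (Cmp (times_cell A P Q t))"
    "bimodule_cell A (times_bimod A Q) (times_bimod A R)
      (times_mor A Q R (Src s)) (times_mor A Q R (Tgt s)) (Cmp (times_cell A Q R s))"
    using bimodule_cell_times_cell[of P Q t] bimodule_cell_times_cell[of Q R s] by simp_all
  then show "FA (T1 (Times2 A) P R) (FA (HC Cat2 P Q R) (s, t)) =
    FA (HC (Bimod2 A) (T0 (Times2 A) P) (T0 (Times2 A) Q) (T0 (Times2 A) R))
     (FA (T1 (Times2 A) Q R) s, FA (T1 (Times2 A) P Q) t)"
    using a by (intro cell_eqI[of _ _ "Ob (times_cat A P)"])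
      (auto elim!: times_ob_cases simp: is_nat_hcomp[of P Q _ _ "Cmp t" R]
        times_mor_comp[OF t.src.is_functor_axioms s.src.is_functor_axioms]
        times_mor_comp[OF t.tgt.is_functor_axioms s.tgt.is_functor_axioms])
qed

end

section \<open>The 2-functor of Hochschild cohomology\<close>

context hochschild_object
begin

lemma xi_ar [simp]:
  assumes "a \<in> Ob A"
  shows "\<xi> a \<in> Ar (Und X)" "Dom (Und X) (\<xi> a) = lO X a x" "Cod (Und X) (\<xi> a) = rO X x a"
  using xi_hom[OF assms] by (simp_all add: hom_def)

lemmas xi_simps [simp] = x_ob xi_unit

end

lemma hochschild_objectI:
  assumes "bimodule A X" "x \<in> Ob (Und X)" "\<xi> \<in> extensional (Ob A)"
    and "\<And>a. a \<in> Ob A \<Longrightarrow>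
      \<xi> a \<in> Ar (Und X) \<and> Dom (Und X) (\<xi> a) = lO X a x \<and> Cod (Und X) (\<xi> a) = rO X x a"
    and "\<And>f. f \<in> Ar A \<Longrightarrow>
      \<xi> (Cod A f) \<cdot>\<^bsub>Und X\<^esub> lA X f (Id (Und X) x) = rA X (Id (Und X) x) f \<cdot>\<^bsub>Und X\<^esub> \<xi> (Dom A f)"
    and "\<xi> (Unt A) = Id (Und X) x"
    and "\<And>a b. a \<in> Ob A \<Longrightarrow> b \<in> Ob A \<Longrightarrow>
      rW A X (\<xi> a) b \<cdot>\<^bsub>Und X\<^esub> Lam X a x b \<cdot>\<^bsub>Und X\<^esub> lW A X a (\<xi> b) = \<xi> (tenO A a b)"
  shows "hochschild_object A X x \<xi>"
  by (intro hochschild_object.intro hochschild_object_axioms.intro assms(1))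
    (use assms(2-) in \<open>auto simp: hom_def\<close>)

lemma hochschild_morphism_iff:
  "hochschild_morphism A X x \<xi> x' \<xi>' f \<longleftrightarrow>
    f \<in> Ar (Und X) \<and> Dom (Und X) f = x \<and> Cod (Und X) f = x' \<and>
    (\<forall>a\<in>Ob A. \<xi>' a \<cdot>\<^bsub>Und X\<^esub> lW A X a f = rW A X f a \<cdot>\<^bsub>Und X\<^esub> \<xi> a)"
  by (auto simp: hochschild_morphism_def hom_def)

lemma H0_simps [simp]:
  "Pr x (Fam \<xi>) \<in> Ob (H0 A X) \<longleftrightarrow> hochschild_object A X x \<xi>"
  "Pr f (Pr (Pr x (Fam \<xi>)) (Pr x' (Fam \<xi>'))) \<in> Ar (H0 A X) \<longleftrightarrow>
    hochschild_object A X x \<xi> \<and> hochschild_object A X x' \<xi>' \<and> hochschild_morphism A X x \<xi> x' \<xi>' f"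
  "Dom (H0 A X) (Pr f (Pr u u')) = u"
  "Cod (H0 A X) (Pr f (Pr u u')) = u'"
  "Id (H0 A X) u = Pr (Id (Und X) (pfst u)) (Pr u u)"
  "Pr f' (Pr v v') \<cdot>\<^bsub>H0 A X\<^esub> Pr f (Pr u u') = Pr (f' \<cdot>\<^bsub>Und X\<^esub> f) (Pr u v')"
  by (auto simp: H0_def)

lemma H0_ob_cases:
  assumes "u \<in> Ob (H0 A X)"
  obtains x \<xi> where "u = Pr x (Fam \<xi>)" "hochschild_object A X x \<xi>"
  using assms by (auto simp: H0_def)

lemma H0_ar_cases:
  assumes "k \<in> Ar (H0 A X)"
  obtains f x \<xi> x' \<xi>' where "k = Pr f (Pr (Pr x (Fam \<xi>)) (Pr x' (Fam \<xi>')))"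
    "hochschild_object A X x \<xi>" "hochschild_object A X x' \<xi>'" "hochschild_morphism A X x \<xi> x' \<xi>' f"
  using assms by (auto simp: H0_def)

lemma hochschild_morphism_id:
  assumes "hochschild_object A X x \<xi>"
  shows "hochschild_morphism A X x \<xi> x \<xi> (Id (Und X) x)"
proof -
  interpret hochschild_object A X x \<xi> by fact
  show ?thesis by (simp add: hochschild_morphism_iff)
qed

lemma hochschild_morphism_comp:
  assumes "hochschild_object A X x \<xi>" "hochschild_object A X x' \<xi>'" "hochschild_object A X x'' \<xi>''"
    and "hochschild_morphism A X x \<xi> x' \<xi>' f" "hochschild_morphism A X x' \<xi>' x'' \<xi>'' g"
  shows "hochschild_morphism A X x \<xi> x'' \<xi>'' (g \<cdot>\<^bsub>Und X\<^esub> f)"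
proof -
  interpret x: hochschild_object A X x \<xi> by fact
  interpret x': hochschild_object A X x' \<xi>' by fact
  interpret x'': hochschild_object A X x'' \<xi>'' by fact
  have f: "f \<in> Ar (Und X)" "Dom (Und X) f = x" "Cod (Und X) f = x'"
      "\<And>a. a \<in> Ob A \<Longrightarrow> \<xi>' a \<cdot>\<^bsub>Und X\<^esub> lW A X a f = rW A X f a \<cdot>\<^bsub>Und X\<^esub> \<xi> a"
    and g: "g \<in> Ar (Und X)" "Dom (Und X) g = x'" "Cod (Und X) g = x''"
      "\<And>a. a \<in> Ob A \<Longrightarrow> \<xi>'' a \<cdot>\<^bsub>Und X\<^esub> lW A X a g = rW A X g a \<cdot>\<^bsub>Und X\<^esub> \<xi>' a"
    using assms(4,5) by (auto simp: hochschild_morphism_iff)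
  show ?thesis
    unfolding hochschild_morphism_iff
    by (simp add: f g x.Und.assoc x.Und.comp_rewrite[OF g(4)])
qed

lemma category_H0:
  assumes "bimodule A X"
  shows "category (H0 A X)"
proof -
  interpret bimodule A X by fact
  show ?thesis
  proof (rule categoryI)
    fix f g assume "f \<in> Ar (H0 A X)" "g \<in> Ar (H0 A X)" "Cod (H0 A X) f = Dom (H0 A X) g"
    then show "g \<cdot>\<^bsub>H0 A X\<^esub> f \<in> Ar (H0 A X) \<and> Dom (H0 A X) (g \<cdot>\<^bsub>H0 A X\<^esub> f) = Dom (H0 A X) f \<and>
        Cod (H0 A X) (g \<cdot>\<^bsub>H0 A X\<^esub> f) = Cod (H0 A X) g"
      by (auto elim!: H0_ar_cases intro: hochschild_morphism_comp)
  next
    fix u assume "u \<in> Ob (H0 A X)"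
    then show "Id (H0 A X) u \<in> Ar (H0 A X) \<and> Dom (H0 A X) (Id (H0 A X) u) = u \<and>
        Cod (H0 A X) (Id (H0 A X) u) = u"
      by (auto elim!: H0_ob_cases intro: hochschild_morphism_id)
  qed (auto elim!: H0_ar_cases simp: hochschild_morphism_iff Und.assoc)
qed

text \<open>The object \<open>(p(x), p(\<xi>\<^sub>a) \<circ> \<rho>\<^bsub>a,x\<^esub>)\<close> for \<open>u\<close> encoding \<open>(x, \<xi>)\<close>. It is a function of the encoded
  pair because arrows of \<open>H\<^sup>0\<close> carry their source and target, which have to be transported as well.\<close>
definition H0_ob ::
  "('a, 'b) smc \<Rightarrow> ('a, 'b, 'u) ubimod \<Rightarrow> ('a, 'b, 'u) ubmor \<Rightarrow> ('a, 'b, 'u) univ \<Rightarrow> ('a, 'b, 'u) univ" where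
  "H0_ob A Y p u = Pr (pO p (pfst u))
    (Fam (\<lambda>a\<in>Ob A. pA p (un_Fam (psnd u) a) \<cdot>\<^bsub>Und Y\<^esub> Rho p (a, pfst u)))"

definition H0_mor ::
  "('a, 'b) smc \<Rightarrow> ('a, 'b, 'u) ubimod \<Rightarrow> ('a, 'b, 'u) ubimod \<Rightarrow> ('a, 'b, 'u) ubmor \<Rightarrow> ('a, 'b, 'u) uftr" where
  "H0_mor A X Y p = ftr_on (H0 A X) (H0_ob A Y p)
    (\<lambda>k. Pr (pA p (pfst k)) (Pr (H0_ob A Y p (pfst (psnd k))) (H0_ob A Y p (psnd (psnd k)))))"

definition H0_cell ::
  "('a, 'b) smc \<Rightarrow> ('a, 'b, 'u) ubimod \<Rightarrow> ('a, 'b, 'u) ubimod \<Rightarrow> ('a, 'b, 'u) ubcell \<Rightarrow> ('a, 'b, 'u) ucell" where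
  "H0_cell A X Y t =
    \<lparr>Src = H0_mor A X Y (Src t), Tgt = H0_mor A X Y (Tgt t),
     Cmp = (\<lambda>u\<in>Ob (H0 A X). Pr (Cmp t (pfst u)) (Pr (H0_ob A Y (Src t) u) (H0_ob A Y (Tgt t) u)))\<rparr>"

definition H0_two_ftr ::
  "('a, 'b) smc \<Rightarrow>
    (('a, 'b, 'u) ubimod, ('a, 'b, 'u) ubmor, ('a, 'b, 'u) ubcell,
     ('a, 'b, 'u) ucat, ('a, 'b, 'u) uftr, ('a, 'b, 'u) ucell) two_ftr" where
  "H0_two_ftr A =
    \<lparr>T0 = H0 A, T1 = (\<lambda>X Y. ftr_on (bimod_hom A X Y) (H0_mor A X Y) (H0_cell A X Y))\<rparr>"

text \<open>For the tensor law, \<open>\<xi>\<^sub>b\<close> has to move past \<open>\<rho>\<^sub>a\<close> and \<open>\<lambda>\<close> past \<open>\<rho>\<^sub>a b\<close>: the first is naturality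
  of \<open>\<rho>\<close> at \<open>\<xi>\<^sub>b\<close>, the second the compatibility of \<open>\<rho>\<close> with \<open>\<lambda>\<close>. This leaves \<open>p\<close> applied to the
  tensor law of \<open>\<xi>\<close>, followed by the tensor law of \<open>\<rho>\<close>.\<close>
lemma hochschild_object_image:
  assumes "bimodule_morphism A X Y p" "hochschild_object A X x \<xi>"
  shows "hochschild_object A Y (pO p x) (\<lambda>a\<in>Ob A. pA p (\<xi> a) \<cdot>\<^bsub>Und Y\<^esub> Rho p (a, x))"
proof -
  interpret p: bimodule_morphism A X Y p by fact
  interpret x: hochschild_object A X x \<xi> by fact
  note assoc = p.Y.Und.assoc and rewrite = p.Y.Und.comp_rewrite
  show ?thesis
  proof (rule hochschild_objectI)
    fix f assume f: "f \<in> Ar A"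
    have "pA p (\<xi> (Cod A f) \<cdot>\<^bsub>Und X\<^esub> lA X f (Id (Und X) x)) =
        pA p (rA X (Id (Und X) x) f \<cdot>\<^bsub>Und X\<^esub> \<xi> (Dom A f))"
      using x.xi_natural[OF f] by simp
    then have \<xi>: "pA p (\<xi> (Cod A f)) \<cdot>\<^bsub>Und Y\<^esub> pA p (lA X f (Id (Und X) x)) =
        rA Y (Id (Und Y) (pO p x)) f \<cdot>\<^bsub>Und Y\<^esub> pA p (\<xi> (Dom A f))"
      using f by simp
    have \<rho>: "Rho p (Cod A f, x) \<cdot>\<^bsub>Und Y\<^esub> lA Y f (Id (Und Y) (pO p x)) =
        pA p (lA X f (Id (Und X) x)) \<cdot>\<^bsub>Und Y\<^esub> Rho p (Dom A f, x)"
      using p.rho_natural[of f "Id (Und X) x"] f by simp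
    show "(\<lambda>a\<in>Ob A. pA p (\<xi> a) \<cdot>\<^bsub>Und Y\<^esub> Rho p (a, x)) (Cod A f) \<cdot>\<^bsub>Und Y\<^esub> lA Y f (Id (Und Y) (pO p x)) =
      rA Y (Id (Und Y) (pO p x)) f \<cdot>\<^bsub>Und Y\<^esub> (\<lambda>a\<in>Ob A. pA p (\<xi> a) \<cdot>\<^bsub>Und Y\<^esub> Rho p (a, x)) (Dom A f)"
      using f by (simp add: assoc \<rho> rewrite[OF \<xi>])
  next
    fix a b assume ab: "a \<in> Ob A" "b \<in> Ob A"
    have "pA p (rW A X (\<xi> a) b \<cdot>\<^bsub>Und X\<^esub> Lam X a x b \<cdot>\<^bsub>Und X\<^esub> lW A X a (\<xi> b)) = pA p (\<xi> (tenO A a b))"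
      using x.xi_ten[OF ab] by simp
    then have \<xi>: "pA p (\<xi> (tenO A a b)) =
        rW A Y (pA p (\<xi> a)) b \<cdot>\<^bsub>Und Y\<^esub> (pA p (Lam X a x b) \<cdot>\<^bsub>Und Y\<^esub> pA p (lW A X a (\<xi> b)))"
      using ab by (simp add: assoc)
    have \<rho>: "Rho p (a, rO X x b) \<cdot>\<^bsub>Und Y\<^esub> lW A Y a (pA p (\<xi> b)) =
        pA p (lW A X a (\<xi> b)) \<cdot>\<^bsub>Und Y\<^esub> Rho p (a, lO X b x)"
      using p.rho_natural[of "Id A a" "\<xi> b"] ab by simp
    have \<lambda>: "rW A Y (Rho p (a, x)) b \<cdot>\<^bsub>Und Y\<^esub> Lam Y a (pO p x) b =
        pA p (Lam X a x b) \<cdot>\<^bsub>Und Y\<^esub> Rho p (a, rO X x b)"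
      using p.rho_lam[of a x b] ab by simp
    let ?\<xi> = "\<lambda>a\<in>Ob A. pA p (\<xi> a) \<cdot>\<^bsub>Und Y\<^esub> Rho p (a, x)"
    show "rW A Y (?\<xi> a) b \<cdot>\<^bsub>Und Y\<^esub> Lam Y a (pO p x) b \<cdot>\<^bsub>Und Y\<^esub> lW A Y a (?\<xi> b) = ?\<xi> (tenO A a b)"
      using ab by (simp add: assoc \<xi> p.rho_ten rewrite[OF \<lambda>] rewrite[OF \<rho>]
          p.X.lact_assoc p.X.ract_assoc p.Y.lact_assoc p.Y.ract_assoc)
  qed (simp_all add: p.Y.bimodule_axioms)
qed

lemma hochschild_morphism_image:
  assumes "bimodule_morphism A X Y p" "hochschild_object A X x \<xi>" "hochschild_object A X x' \<xi>'"
    and "hochschild_morphism A X x \<xi> x' \<xi>' f"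
  shows "hochschild_morphism A Y (pO p x) (\<lambda>a\<in>Ob A. pA p (\<xi> a) \<cdot>\<^bsub>Und Y\<^esub> Rho p (a, x))
    (pO p x') (\<lambda>a\<in>Ob A. pA p (\<xi>' a) \<cdot>\<^bsub>Und Y\<^esub> Rho p (a, x')) (pA p f)"
proof -
  interpret p: bimodule_morphism A X Y p by fact
  interpret x: hochschild_object A X x \<xi> by fact
  interpret x': hochschild_object A X x' \<xi>' by fact
  have f: "f \<in> Ar (Und X)" "Dom (Und X) f = x" "Cod (Und X) f = x'"
      "\<And>a. a \<in> Ob A \<Longrightarrow> \<xi>' a \<cdot>\<^bsub>Und X\<^esub> lW A X a f = rW A X f a \<cdot>\<^bsub>Und X\<^esub> \<xi> a"
    using assms(4) by (auto simp: hochschild_morphism_iff)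
  have "(pA p (\<xi>' a) \<cdot>\<^bsub>Und Y\<^esub> Rho p (a, x')) \<cdot>\<^bsub>Und Y\<^esub> lW A Y a (pA p f) =
      rW A Y (pA p f) a \<cdot>\<^bsub>Und Y\<^esub> (pA p (\<xi> a) \<cdot>\<^bsub>Und Y\<^esub> Rho p (a, x))" if a: "a \<in> Ob A" for a
  proof -
    have "pA p (\<xi>' a \<cdot>\<^bsub>Und X\<^esub> lW A X a f) = pA p (rW A X f a \<cdot>\<^bsub>Und X\<^esub> \<xi> a)"
      using f(4)[OF a] by simp
    then have 1: "pA p (\<xi>' a) \<cdot>\<^bsub>Und Y\<^esub> pA p (lW A X a f) = rW A Y (pA p f) a \<cdot>\<^bsub>Und Y\<^esub> pA p (\<xi> a)"
      using a f(1-3) by simp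
    have 2: "Rho p (a, x') \<cdot>\<^bsub>Und Y\<^esub> lW A Y a (pA p f) = pA p (lW A X a f) \<cdot>\<^bsub>Und Y\<^esub> Rho p (a, x)"
      using p.rho_natural[of "Id A a" f] a f(1-3) by simp
    show ?thesis
      using a f(1-3) by (simp add: p.Y.Und.assoc 2 p.Y.Und.comp_rewrite[OF 1])
  qed
  then show ?thesis using f(1-3) by (simp add: hochschild_morphism_iff)
qed

text \<open>Naturality of \<open>\<tau>\<close> at \<open>\<xi>\<^sub>a\<close> and strictness of \<open>\<tau>\<close> on the right turn \<open>\<tau>\<close> at \<open>ax\<close> into \<open>(\<tau>\<^sub>x)a\<close>.\<close>
lemma hochschild_morphism_cell:
  assumes "bimodule_cell A X Y p q \<tau>" "hochschild_object A X x \<xi>"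
  shows "hochschild_morphism A Y (pO p x) (\<lambda>a\<in>Ob A. pA p (\<xi> a) \<cdot>\<^bsub>Und Y\<^esub> Rho p (a, x))
    (pO q x) (\<lambda>a\<in>Ob A. pA q (\<xi> a) \<cdot>\<^bsub>Und Y\<^esub> Rho q (a, x)) (\<tau> x)"
proof -
  interpret t: bimodule_cell A X Y p q \<tau> by fact
  interpret x: hochschild_object A X x \<xi> by fact
  have "(pA q (\<xi> a) \<cdot>\<^bsub>Und Y\<^esub> Rho q (a, x)) \<cdot>\<^bsub>Und Y\<^esub> lW A Y a (\<tau> x) =
      rW A Y (\<tau> x) a \<cdot>\<^bsub>Und Y\<^esub> (pA p (\<xi> a) \<cdot>\<^bsub>Und Y\<^esub> Rho p (a, x))" if a: "a \<in> Ob A" for a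
  proof -
    have 1: "pA q (\<xi> a) \<cdot>\<^bsub>Und Y\<^esub> \<tau> (lO X a x) = rW A Y (\<tau> x) a \<cdot>\<^bsub>Und Y\<^esub> pA p (\<xi> a)"
      using t.natural[of "\<xi> a"] a by (simp add: t.cell_right)
    show ?thesis
      using a by (simp add: t.src.Y.Und.assoc t.cell_left t.src.Y.Und.comp_rewrite[OF 1])
  qed
  then show ?thesis by (simp add: hochschild_morphism_iff)
qed

lemma H0_ob_Pr [simp]:
  "H0_ob A Y p (Pr x (Fam \<xi>)) = Pr (pO p x) (Fam (\<lambda>a\<in>Ob A. pA p (\<xi> a) \<cdot>\<^bsub>Und Y\<^esub> Rho p (a, x)))"
  by (simp add: H0_ob_def)

lemma pfst_H0_ob [simp]: "pfst (H0_ob A Y p u) = pO p (pfst u)"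
  by (simp add: H0_ob_def)

lemma H0_mor_simps [simp]:
  "u \<in> Ob (H0 A X) \<Longrightarrow> FO (H0_mor A X Y p) u = H0_ob A Y p u"
  "k \<in> Ar (H0 A X) \<Longrightarrow> FA (H0_mor A X Y p) k =
    Pr (pA p (pfst k)) (Pr (H0_ob A Y p (pfst (psnd k))) (H0_ob A Y p (psnd (psnd k))))"
  by (simp_all add: H0_mor_def)

lemma is_functor_H0_mor:
  assumes "bimodule_morphism A X Y p"
  shows "is_functor (H0 A X) (H0 A Y) (H0_mor A X Y p)"
proof -
  interpret p: bimodule_morphism A X Y p by fact
  show ?thesis
    unfolding H0_mor_def
    by (rule is_functor_ftr_on)
      (auto elim!: H0_ar_cases H0_ob_cases
        simp: category_H0 p.X.bimodule_axioms p.Y.bimodule_axioms hochschild_object_image[OF assms]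
          hochschild_morphism_image[OF assms] hochschild_morphism_iff[of A X]
          hochschild_object.x_ob)
qed

lemma H0_cell_simps [simp]:
  "Src (H0_cell A X Y t) = H0_mor A X Y (Src t)"
  "Tgt (H0_cell A X Y t) = H0_mor A X Y (Tgt t)"
  "Cmp (H0_cell A X Y t) \<in> extensional (Ob (H0 A X))"
  "u \<in> Ob (H0 A X) \<Longrightarrow> Cmp (H0_cell A X Y t) u =
    Pr (Cmp t (pfst u)) (Pr (H0_ob A Y (Src t) u) (H0_ob A Y (Tgt t) u))"
  by (simp_all add: H0_cell_def)

lemma is_nat_H0_cell:
  assumes "bimodule_cell A X Y (Src t) (Tgt t) (Cmp t)"
  shows "is_nat (H0 A X) (H0 A Y) (H0_mor A X Y (Src t)) (H0_mor A X Y (Tgt t)) (Cmp (H0_cell A X Y t))"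
proof -
  interpret t: bimodule_cell A X Y "Src t" "Tgt t" "Cmp t" by fact
  note mors = t.src.bimodule_morphism_axioms t.tgt.bimodule_morphism_axioms
  show ?thesis
  proof (rule is_natI)
    fix k assume k: "k \<in> Ar (H0 A X)"
    then obtain f x \<xi> x' \<xi>' where k': "k = Pr f (Pr (Pr x (Fam \<xi>)) (Pr x' (Fam \<xi>')))"
      and x: "hochschild_object A X x \<xi>" "hochschild_object A X x' \<xi>'"
        "hochschild_morphism A X x \<xi> x' \<xi>' f"
      by (rule H0_ar_cases)
    have "f \<in> Ar (Und X)" "Dom (Und X) f = x" "Cod (Und X) f = x'"
      using x by (auto simp: hochschild_morphism_iff)
    then show "Cmp (H0_cell A X Y t) (Cod (H0 A X) k) \<cdot>\<^bsub>H0 A Y\<^esub> FA (H0_mor A X Y (Src t)) k =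
      FA (H0_mor A X Y (Tgt t)) k \<cdot>\<^bsub>H0 A Y\<^esub> Cmp (H0_cell A X Y t) (Dom (H0 A X) k)"
      using k x t.natural[of f] by (simp add: k')
  qed (auto elim!: H0_ob_cases simp: mors[THEN is_functor_H0_mor] mors[THEN hochschild_object_image]
      intro: hochschild_morphism_cell[OF assms])
qed

lemma H0_two_ftr_simps [simp]:
  "T0 (H0_two_ftr A) = H0 A"
  "bimodule_morphism A X Y p \<Longrightarrow> FO (T1 (H0_two_ftr A) X Y) p = H0_mor A X Y p"
  "bimodule_cell A X Y (Src t) (Tgt t) (Cmp t) \<Longrightarrow> FA (T1 (H0_two_ftr A) X Y) t = H0_cell A X Y t"
  by (simp_all add: H0_two_ftr_def)

lemma H0_ob_id:
  assumes "u \<in> Ob (H0 A X)"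
  shows "H0_ob A X (id_bmor A X) u = u"
proof -
  obtain x \<xi> where u: "u = Pr x (Fam \<xi>)" "hochschild_object A X x \<xi>"
    using assms by (rule H0_ob_cases)
  interpret hochschild_object A X x \<xi> by fact
  have "(\<lambda>a\<in>Ob A. pA (id_bmor A X) (\<xi> a) \<cdot>\<^bsub>Und X\<^esub> Rho (id_bmor A X) (a, x)) = \<xi>"
    by (rule extensionalityI[OF _ xi_ext]) simp_all
  then show ?thesis by (simp add: u)
qed

lemma H0_ob_comp:
  assumes "bimodule_morphism A X Y p" "bimodule_morphism A Y Z q" "u \<in> Ob (H0 A X)"
  shows "H0_ob A Z (comp_bmor A X Z q p) u = H0_ob A Z q (H0_ob A Y p u)"
proof -
  interpret p: bimodule_morphism A X Y p by fact
  interpret q: bimodule_morphism A Y Z q by fact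
  obtain x \<xi> where u: "u = Pr x (Fam \<xi>)" "hochschild_object A X x \<xi>"
    using assms(3) by (rule H0_ob_cases)
  interpret hochschild_object A X x \<xi> by fact
  show ?thesis by (auto simp: u restrict_def fun_eq_iff q.Y.Und.assoc)
qed

lemma H0_mor_id:
  assumes "bimodule A X"
  shows "H0_mor A X X (id_bmor A X) = id_ftr (H0 A X)"
proof (rule functor_eqI)
  show "is_functor (H0 A X) (H0 A X) (H0_mor A X X (id_bmor A X))"
    by (rule is_functor_H0_mor[OF bimodule_morphism_id[OF assms]])
  show "FA (H0_mor A X X (id_bmor A X)) k = FA (id_ftr (H0 A X)) k" if k: "k \<in> Ar (H0 A X)" for k
    using k by (cases rule: H0_ar_cases[OF k])
      (simp add: H0_ob_id hochschild_morphism_iff del: H0_ob_Pr)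
qed (simp_all add: category_H0 assms H0_ob_id)

lemma H0_mor_comp:
  assumes "bimodule_morphism A X Y p" "bimodule_morphism A Y Z q"
  shows "H0_mor A X Z (comp_bmor A X Z q p) = comp_ftr (H0 A X) (H0_mor A Y Z q) (H0_mor A X Y p)"
proof (rule functor_eqI)
  interpret p: is_functor "H0 A X" "H0 A Y" "H0_mor A X Y p" 
    by (rule is_functor_H0_mor) fact
  show "is_functor (H0 A X) (H0 A Z) (H0_mor A X Z (comp_bmor A X Z q p))"
    by (rule is_functor_H0_mor[OF bimodule_morphism_comp[OF assms]])
  show "is_functor (H0 A X) (H0 A Z) (comp_ftr (H0 A X) (H0_mor A Y Z q) (H0_mor A X Y p))"
    by (rule is_functor_comp[OF assms[THEN is_functor_H0_mor]])
  \<comment> \<open>That \<open>p\<close> maps into \<open>H\<^sup>0\<close> is used as a fact and withdrawn as a rewrite rule, which would reduce the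
      fact to \<open>True\<close> before it could be expressed through \<open>H0_ob\<close>.\<close>
  show "FO (H0_mor A X Z (comp_bmor A X Z q p)) u = FO (comp_ftr (H0 A X) (H0_mor A Y Z q) (H0_mor A X Y p)) u"
    if "u \<in> Ob (H0 A X)" for u
    using that p.FO_ob[of u] by (simp add: H0_ob_comp[OF assms] del: p.FO_ob)
  show "FA (H0_mor A X Z (comp_bmor A X Z q p)) k = FA (comp_ftr (H0 A X) (H0_mor A Y Z q) (H0_mor A X Y p)) k"
    if k: "k \<in> Ar (H0 A X)" for k
  proof -
    have "pfst k \<in> Ar (Und X)" "pfst (psnd k) \<in> Ob (H0 A X)" "psnd (psnd k) \<in> Ob (H0 A X)"
      using k by (auto elim!: H0_ar_cases simp: hochschild_morphism_iff)
    then show ?thesis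
      using k p.FA_ar[OF k] by (simp add: H0_ob_comp[OF assms] del: p.FA_ar)
  qed
qed

lemma two_functor_H0:
  fixes A :: "('a, 'b) smc"
  shows "two_functor (Bimod2 A) Cat2 (H0_two_ftr A ::
    (('a, 'b, 'u) ubimod, ('a, 'b, 'u) ubmor, ('a, 'b, 'u) ubcell,
     ('a, 'b, 'u) ucat, ('a, 'b, 'u) uftr, ('a, 'b, 'u) ucell) two_ftr)"
proof (intro two_functor.intro two_functor_axioms.intro two_category_Cat2 two_category_Bimod2)
  fix X :: "('a, 'b, 'u) ubimod" assume X: "X \<in> Obj (Bimod2 A)"
  then show "T0 (H0_two_ftr A) X \<in> Obj Cat2" by (simp add: category_H0)
  show "FO (T1 (H0_two_ftr A) X X) (One (Bimod2 A) X) = One Cat2 (T0 (H0_two_ftr A) X)"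
    using X by (simp add: bimodule_morphism_id H0_mor_id)
next
  fix X Y :: "('a, 'b, 'u) ubimod" assume XY: "X \<in> Obj (Bimod2 A)" "Y \<in> Obj (Bimod2 A)"
  have T1: "T1 (H0_two_ftr A) X Y = ftr_on (bimod_hom A X Y) (H0_mor A X Y) (H0_cell A X Y)"
    by (simp add: H0_two_ftr_def)
  show "is_functor (HomC (Bimod2 A) X Y) (HomC Cat2 (T0 (H0_two_ftr A) X) (T0 (H0_two_ftr A) Y))
      (T1 (H0_two_ftr A) X Y)"
    unfolding T1 Cat2_simps Bimod2_simps H0_two_ftr_simps
  proof (rule is_functor_ftr_on, goal_cases)
    case (5 p)
    then interpret p: bimodule_morphism A X Y p by simp
    show ?case
      by (intro cell_eqI[of _ _ "Ob (H0 A X)"]) (auto elim!: H0_ob_cases simp: hochschild_object.x_ob)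
  next
    case (6 s t)
    then show ?case
      by (intro cell_eqI[of _ _ "Ob (H0 A X)"]) (auto elim!: H0_ob_cases simp: hochschild_object.x_ob)
  qed (use XY in \<open>auto simp: category_fun_cat category_bimod_hom category_H0 is_functor_H0_mor is_nat_H0_cell\<close>)
next
  fix X Y Z :: "('a, 'b, 'u) ubimod" and p q
  assume "p \<in> Ob (HomC (Bimod2 A) X Y)" "q \<in> Ob (HomC (Bimod2 A) Y Z)"
  then show "FO (T1 (H0_two_ftr A) X Z) (FO (HC (Bimod2 A) X Y Z) (q, p)) =
    FO (HC Cat2 (T0 (H0_two_ftr A) X) (T0 (H0_two_ftr A) Y) (T0 (H0_two_ftr A) Z))
     (FO (T1 (H0_two_ftr A) Y Z) q, FO (T1 (H0_two_ftr A) X Y) p)"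
    by (simp add: bimodule_morphism_comp H0_mor_comp is_functor_H0_mor)
next
  fix X Y Z :: "('a, 'b, 'u) ubimod" and t s
  assume a: "t \<in> Ar (HomC (Bimod2 A) X Y)" "s \<in> Ar (HomC (Bimod2 A) Y Z)"
  from a interpret t: bimodule_cell A X Y "Src t" "Tgt t" "Cmp t" by simp
  from a interpret s: bimodule_cell A Y Z "Src s" "Tgt s" "Cmp s" by simp
  note mors = t.src.bimodule_morphism_axioms s.src.bimodule_morphism_axioms
    t.tgt.bimodule_morphism_axioms s.tgt.bimodule_morphism_axioms
  interpret t': is_nat "H0 A X" "H0 A Y" "H0_mor A X Y (Src t)" "H0_mor A X Y (Tgt t)" "Cmp (H0_cell A X Y t)"
    by (rule is_nat_H0_cell[OF t.bimodule_cell_axioms])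
  interpret s': is_nat "H0 A Y" "H0 A Z" "H0_mor A Y Z (Src s)" "H0_mor A Y Z (Tgt s)" "Cmp (H0_cell A Y Z s)"
    by (rule is_nat_H0_cell[OF s.bimodule_cell_axioms])
  have "Cmp (H0_cell A Y Z s) (H0_ob A Y (Tgt t) u) \<cdot>\<^bsub>H0 A Z\<^esub>
      FA (H0_mor A Y Z (Src s)) (Cmp (H0_cell A X Y t) u) =
    Pr (Cmp s (pO (Tgt t) (pfst u)) \<cdot>\<^bsub>Und Z\<^esub> pA (Src s) (Cmp t (pfst u)))
      (Pr (H0_ob A Z (comp_bmor A X Z (Src s) (Src t)) u) (H0_ob A Z (comp_bmor A X Z (Tgt s) (Tgt t)) u))"
    if u: "u \<in> Ob (H0 A X)" for u
    using t'.cmp_ar(1)[OF u] t'.src.FO_ob[OF u] t'.tgt.FO_ob[OF u] u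
    by (simp add: H0_ob_comp[OF mors(1,2)] H0_ob_comp[OF mors(3,4)]
        del: t'.cmp_ar(1) t'.src.FO_ob t'.tgt.FO_ob)
  then show "FA (T1 (H0_two_ftr A) X Z) (FA (HC (Bimod2 A) X Y Z) (s, t)) =
    FA (HC Cat2 (T0 (H0_two_ftr A) X) (T0 (H0_two_ftr A) Y) (T0 (H0_two_ftr A) Z))
     (FA (T1 (H0_two_ftr A) Y Z) s, FA (T1 (H0_two_ftr A) X Y) t)"
    using a t'.is_nat_axioms s'.is_nat_axioms
    by (intro cell_eqI[of _ _ "Ob (H0 A X)"])
      (auto simp: bimodule_cell_hcomp[of A X Y _ _ "Cmp t" Z] H0_mor_comp[OF mors(1,2)]
        H0_mor_comp[OF mors(3,4)] elim!: H0_ob_cases simp: hochschild_object.x_ob)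
qed

section \<open>Unit, counit and the adjunction\<close>

text \<open>The object \<open>(y,i)\<close> of \<open>P \<times> A\<close> with the identities of \<open>(y,a)\<close> as maps \<open>a(y,i) \<rightarrow> (y,i)a\<close>.\<close>
definition unit_ob :: "('a, 'b) smc \<Rightarrow> ('a, 'b, 'u) ucat \<Rightarrow> ('a, 'b, 'u) univ \<Rightarrow> ('a, 'b, 'u) univ" where
  "unit_ob A P y = Pr (Pr y (AOb (Unt A))) (Fam (\<lambda>a\<in>Ob A. Pr (Id P y) (AAr (Id A a))))"

definition unit_ftr :: "('a, 'b) smc \<Rightarrow> ('a, 'b, 'u) ucat \<Rightarrow> ('a, 'b, 'u) uftr" where
  "unit_ftr A P = ftr_on P (unit_ob A P)
    (\<lambda>h. Pr (Pr h (AAr (Id A (Unt A)))) (Pr (unit_ob A P (Dom P h)) (unit_ob A P (Cod P h))))"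

text \<open>The action \<open>((x,\<xi>),b) \<mapsto> xb\<close>; its structure map is the composite
  \<open>a(xb) \<rightarrow> (ax)b \<rightarrow> (xa)b = x(ab)\<close> of \<open>\<lambda>\<close> and \<open>(\<xi>\<^sub>a)b\<close>.\<close>
definition counit_mor :: "('a, 'b) smc \<Rightarrow> ('a, 'b, 'u) ubimod \<Rightarrow> ('a, 'b, 'u) ubmor" where
  "counit_mor A X =
    \<lparr>Fun = ftr_on (times_cat A (H0 A X))
       (\<lambda>u. rO X (pfst (pfst u)) (un_AOb (psnd u))) (\<lambda>k. rA X (pfst (pfst k)) (un_AAr (psnd k))),
     Rho = (\<lambda>(a, u)\<in>Ob A \<times> Ob (times_cat A (H0 A X)).
       rW A X (un_Fam (psnd (pfst u)) a) (un_AOb (psnd u)) \<cdot>\<^bsub>Und X\<^esub>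
       Lam X a (pfst (pfst u)) (un_AOb (psnd u)))\<rparr>"

lemma unit_ftr_simps [simp]:
  "y \<in> Ob P \<Longrightarrow> FO (unit_ftr A P) y = unit_ob A P y"
  "h \<in> Ar P \<Longrightarrow> FA (unit_ftr A P) h =
    Pr (Pr h (AAr (Id A (Unt A)))) (Pr (unit_ob A P (Dom P h)) (unit_ob A P (Cod P h)))"
  by (simp_all add: unit_ftr_def)

lemma pfst_unit_ob [simp]: "pfst (unit_ob A P y) = Pr y (AOb (Unt A))"
  by (simp add: unit_ob_def)

lemma counit_mor_simps [simp]:
  "x \<in> Ob (H0 A X) \<Longrightarrow> b \<in> Ob A \<Longrightarrow> pO (counit_mor A X) (Pr x (AOb b)) = rO X (pfst x) b"
  "k \<in> Ar (H0 A X) \<Longrightarrow> g \<in> Ar A \<Longrightarrow> pA (counit_mor A X) (Pr k (AAr g)) = rA X (pfst k) g"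
  "a \<in> Ob A \<Longrightarrow> hochschild_object A X x \<xi> \<Longrightarrow> b \<in> Ob A \<Longrightarrow>
    Rho (counit_mor A X) (a, Pr (Pr x (Fam \<xi>)) (AOb b)) = rW A X (\<xi> a) b \<cdot>\<^bsub>Und X\<^esub> Lam X a x b"
  "Rho (counit_mor A X) \<in> extensional (Ob A \<times> Ob (times_cat A (H0 A X)))"
  by (simp_all add: counit_mor_def)

text \<open>Naturality and the tensor law are the places where the axioms of \<open>H\<^sup>0(A,X)\<close> enter. For
  naturality, an arrow of \<open>H\<^sup>0(A,X) \<times> A\<close> moves past \<open>\<lambda>\<close> by naturality of \<open>\<lambda>\<close>, and past \<open>\<xi>\<close> because
  it is a morphism of Hochschild objects. For the tensor law, \<open>\<xi>\<^bsub>ab\<^esub>\<close> is expanded by its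
  own tensor law, and naturality of \<open>\<lambda>\<close> at \<open>\<xi>\<^sub>b\<close> separates the part belonging to \<open>a\<close> from the part belonging
  to \<open>b\<close>. Compatibility with \<open>\<lambda>\<close> is the law expressing \<open>\<lambda>\<^bsub>a,x,cb\<^esub>\<close> through \<open>\<lambda>\<^bsub>a,x,c\<^esub>\<close>.\<close>
lemma bimodule_morphism_counit:
  assumes "bimodule A X"
  shows "bimodule_morphism A (times_bimod A (H0 A X)) X (counit_mor A X)"
proof -
  interpret X: bimodule A X by fact
  note assoc = X.Und.assoc and rewrite = X.Und.comp_rewrite
  note cats = category_times_cat[OF X.A.category_axioms category_H0[OF assms]]
  show ?thesis
  proof (rule bimodule_morphismI)
    show "bimodule A (times_bimod A (H0 A X))"
      by (rule X.A.bimodule_times_bimod[OF category_H0[OF assms]])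
    show "is_functor (Und (times_bimod A (H0 A X))) (Und X) (Fun (counit_mor A X))"
      unfolding counit_mor_def bmor.simps times_bimod_simps
      by (rule is_functor_ftr_on[OF cats X.Und.category_axioms])
        (auto elim!: times_ob_cases times_ar_cases H0_ob_cases H0_ar_cases
          simp: hochschild_object.x_ob hochschild_morphism_iff X.ract_comp)
  next
    fix x b assume "x \<in> Ob (Und (times_bimod A (H0 A X)))" "b \<in> Ob A"
    then show "pO (counit_mor A X) (rO (times_bimod A (H0 A X)) x b) = rO X (pO (counit_mor A X) x) b"
      by (auto elim!: times_ob_cases H0_ob_cases simp: hochschild_object.x_ob X.ract_assoc)
  next
    fix h g assume "h \<in> Ar (Und (times_bimod A (H0 A X)))" "g \<in> Ar A"
    then show "pA (counit_mor A X) (rA (times_bimod A (H0 A X)) h g) = rA X (pA (counit_mor A X) h) g"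
      by (auto elim!: times_ar_cases H0_ar_cases simp: hochschild_morphism_iff X.ract_assoc_ar)
  next
    show "Rho (counit_mor A X) \<in> extensional (Ob A \<times> Ob (Und (times_bimod A (H0 A X))))"
      by simp
  next
    fix a u assume a: "a \<in> Ob A" and "u \<in> Ob (Und (times_bimod A (H0 A X)))"
    then obtain x \<xi> b where u: "u = Pr (Pr x (Fam \<xi>)) (AOb b)" "hochschild_object A X x \<xi>" "b \<in> Ob A"
      by (auto elim!: times_ob_cases H0_ob_cases)
    interpret x: hochschild_object A X x \<xi> by fact
    show "Rho (counit_mor A X) (a, u) \<in> Ar (Und X) \<and>
        Dom (Und X) (Rho (counit_mor A X) (a, u)) = lO X a (pO (counit_mor A X) u) \<and>
        Cod (Und X) (Rho (counit_mor A X) (a, u)) =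
          pO (counit_mor A X) (lO (times_bimod A (H0 A X)) a u)"
      using a u by (simp add: X.ract_assoc)
  next
    fix f k assume f: "f \<in> Ar A" and "k \<in> Ar (Und (times_bimod A (H0 A X)))"
    then obtain h x \<xi> x' \<xi>' g where k: "k = Pr (Pr h (Pr (Pr x (Fam \<xi>)) (Pr x' (Fam \<xi>')))) (AAr g)"
        "hochschild_object A X x \<xi>" "hochschild_object A X x' \<xi>'" "hochschild_morphism A X x \<xi> x' \<xi>' h"
        "g \<in> Ar A"
      by (auto elim!: times_ar_cases H0_ar_cases)
    interpret x: hochschild_object A X x \<xi> by fact
    interpret x': hochschild_object A X x' \<xi>' by fact
    have h: "h \<in> Ar (Und X)" "Dom (Und X) h = x" "Cod (Und X) h = x'"
        "\<And>a. a \<in> Ob A \<Longrightarrow> \<xi>' a \<cdot>\<^bsub>Und X\<^esub> lW A X a h = rW A X h a \<cdot>\<^bsub>Und X\<^esub> \<xi> a"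
      using k(4) by (auto simp: hochschild_morphism_iff)
    let ?a = "Dom A f" and ?a' = "Cod A f"
    \<comment> \<open>\<open>\<xi>\<close> is natural in \<open>A\<close> with \<open>x\<close> fixed, and in \<open>x\<close> with the object of \<open>A\<close> fixed; factoring
      \<open>(f, h)\<close> as \<open>(f, 1) \<circ> (1, h)\<close> gives naturality in both.\<close>
    have "\<xi>' ?a' \<cdot>\<^bsub>Und X\<^esub> lA X f h = rA X h f \<cdot>\<^bsub>Und X\<^esub> \<xi> ?a"
    proof -
      have l: "lA X f h = lA X f (Id (Und X) x') \<cdot>\<^bsub>Und X\<^esub> lW A X ?a h"
        using X.lact_comp[of "Id A ?a" f h "Id (Und X) x'"] f h by simp
      have r: "rA X h f = rA X (Id (Und X) x') f \<cdot>\<^bsub>Und X\<^esub> rW A X h ?a"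
        using X.ract_comp[of "Id A ?a" f h "Id (Und X) x'"] f h by simp
      show ?thesis
        using f h(1-3) by (simp add: l r assoc rewrite[OF x'.xi_natural[OF f]] h(4))
    qed
    \<comment> \<open>Both sides are acted on by \<open>g\<close>, which is padded with identities so that the right action, a
      functor of two variables, splits them as composites.\<close>
    then have "rA X (\<xi>' ?a' \<cdot>\<^bsub>Und X\<^esub> lA X f h) (Id A (Cod A g) \<cdot>\<^bsub>A\<^esub> g) =
        rA X (rA X h f \<cdot>\<^bsub>Und X\<^esub> \<xi> ?a) (g \<cdot>\<^bsub>A\<^esub> Id A (Dom A g))"
      using k(5) by simp
    then have 1: "rW A X (\<xi>' ?a') (Cod A g) \<cdot>\<^bsub>Und X\<^esub> rA X (lA X f h) g =
        rA X (rA X h f) g \<cdot>\<^bsub>Und X\<^esub> rW A X (\<xi> ?a) (Dom A g)"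
      using f h(1-3) k(5) X.ract_comp[of g "Id A (Cod A g)" "lA X f h" "\<xi>' ?a'"]
        X.ract_comp[of "Id A (Dom A g)" g "\<xi> ?a" "rA X h f"] by simp
    have 2: "Lam X ?a' x' (Cod A g) \<cdot>\<^bsub>Und X\<^esub> lA X f (rA X h g) =
        rA X (lA X f h) g \<cdot>\<^bsub>Und X\<^esub> Lam X ?a x (Dom A g)"
      using X.lam_natural[OF f h(1) k(5)] h by simp
    show "Rho (counit_mor A X) (Cod A f, Cod (Und (times_bimod A (H0 A X))) k) \<cdot>\<^bsub>Und X\<^esub>
         lA X f (pA (counit_mor A X) k) =
        pA (counit_mor A X) (lA (times_bimod A (H0 A X)) f k) \<cdot>\<^bsub>Und X\<^esub>
         Rho (counit_mor A X) (Dom A f, Dom (Und (times_bimod A (H0 A X))) k)"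
      using f h(1-3) k by (simp add: assoc 2 rewrite[OF 1] X.ract_assoc_ar)
  next
    fix u assume "u \<in> Ob (Und (times_bimod A (H0 A X)))"
    then obtain x \<xi> b where u: "u = Pr (Pr x (Fam \<xi>)) (AOb b)" "hochschild_object A X x \<xi>" "b \<in> Ob A"
      by (auto elim!: times_ob_cases H0_ob_cases)
    interpret x: hochschild_object A X x \<xi> by fact
    show "Rho (counit_mor A X) (Unt A, u) = Id (Und X) (pO (counit_mor A X) u)"
      using u by simp
  next
    fix a b u assume ab: "a \<in> Ob A" "b \<in> Ob A" and "u \<in> Ob (Und (times_bimod A (H0 A X)))"
    then obtain x \<xi> c where u: "u = Pr (Pr x (Fam \<xi>)) (AOb c)" "hochschild_object A X x \<xi>" "c \<in> Ob A"
      by (auto elim!: times_ob_cases H0_ob_cases)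
    interpret x: hochschild_object A X x \<xi> by fact
    have "\<xi> (tenO A a b) = rW A X (\<xi> a) b \<cdot>\<^bsub>Und X\<^esub> (Lam X a x b \<cdot>\<^bsub>Und X\<^esub> lW A X a (\<xi> b))"
      using x.xi_ten[OF ab] ab by (simp add: assoc)
    moreover have "rW A X (rW A X (\<xi> a) b) c = rW A X (\<xi> a) (tenO A b c)"
      using X.ract_assoc_ar[of "\<xi> a" "Id A b" "Id A c"] ab u by (simp add: X.A.ten_id)
    ultimately have 1: "rW A X (\<xi> (tenO A a b)) c = rW A X (\<xi> a) (tenO A b c) \<cdot>\<^bsub>Und X\<^esub>
        (rW A X (Lam X a x b) c \<cdot>\<^bsub>Und X\<^esub> rW A X (lW A X a (\<xi> b)) c)"
      using ab u(3) by (simp add: X.lact_assoc X.ract_assoc)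
    have 2: "rW A X (lW A X a (\<xi> b)) c \<cdot>\<^bsub>Und X\<^esub> Lam X a (lO X b x) c =
        Lam X a (rO X x b) c \<cdot>\<^bsub>Und X\<^esub> lW A X a (rW A X (\<xi> b) c)"
      using X.lam_natural[of "Id A a" "\<xi> b" "Id A c"] ab u(3) by simp
    show "Rho (counit_mor A X) (tenO A a b, u) =
      Rho (counit_mor A X) (a, lO (times_bimod A (H0 A X)) b u) \<cdot>\<^bsub>Und X\<^esub>
        lW A X a (Rho (counit_mor A X) (b, u))"
      using ab u by (simp add: 1 assoc X.lam_ten_left X.lam_ten_right rewrite[OF 2]
        X.lact_assoc X.ract_assoc)
  next
    fix a u b assume ab: "a \<in> Ob A" "b \<in> Ob A" and "u \<in> Ob (Und (times_bimod A (H0 A X)))"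
    then obtain x \<xi> c where u: "u = Pr (Pr x (Fam \<xi>)) (AOb c)" "hochschild_object A X x \<xi>" "c \<in> Ob A"
      by (auto elim!: times_ob_cases H0_ob_cases)
    interpret x: hochschild_object A X x \<xi> by fact
    have 1: "rW A X (\<xi> a) (tenO A c b) = rW A X (rW A X (\<xi> a) c) b"
      using X.ract_assoc_ar[of "\<xi> a" "Id A c" "Id A b"] ab u by (simp add: X.A.ten_id)
    show "pA (counit_mor A X) (Lam (times_bimod A (H0 A X)) a u b) \<cdot>\<^bsub>Und X\<^esub>
        Rho (counit_mor A X) (a, rO (times_bimod A (H0 A X)) u b) =
      rW A X (Rho (counit_mor A X) (a, u)) b \<cdot>\<^bsub>Und X\<^esub> Lam X a (pO (counit_mor A X) u) b"
      using ab u hochschild_morphism_id[OF u(2)]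
      by (simp add: 1 assoc X.lam_ten_right X.ract_assoc)
  qed (rule assms)
qed

context strict_monoidal_category
begin

lemma H0_ob_times_mor:
  assumes "is_functor P Q F" "y \<in> Ob P"
  shows "H0_ob A (times_bimod A Q) (times_mor A P Q F) (unit_ob A P y) = unit_ob A Q (FO F y)"
proof -
  interpret F: is_functor P Q F by fact
  show ?thesis using assms(2) by (auto simp: unit_ob_def restrict_def fun_eq_iff)
qed

lemma hochschild_object_unit:
  assumes "category P" "y \<in> Ob P"
  shows "hochschild_object A (times_bimod A P) (Pr y (AOb (Unt A))) (\<lambda>a\<in>Ob A. Pr (Id P y) (AAr (Id A a)))"
proof -
  interpret P: category P by fact
  show ?thesis
    by (rule hochschild_objectI) (use assms in \<open>auto simp: bimodule_times_bimod ten_id\<close>)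
qed

lemma hochschild_morphism_unit:
  assumes "category P" "h \<in> Ar P"
  shows "hochschild_morphism A (times_bimod A P)
    (Pr (Dom P h) (AOb (Unt A))) (\<lambda>a\<in>Ob A. Pr (Id P (Dom P h)) (AAr (Id A a)))
    (Pr (Cod P h) (AOb (Unt A))) (\<lambda>a\<in>Ob A. Pr (Id P (Cod P h)) (AAr (Id A a)))
    (Pr h (AAr (Id A (Unt A))))"
proof -
  interpret P: category P by fact
  show ?thesis using assms(2) by (simp add: hochschild_morphism_iff)
qed

lemma is_functor_unit:
  assumes "category P"
  shows "is_functor P (H0 A (times_bimod A P)) (unit_ftr A P)"
proof -
  interpret P: category P by fact
  show ?thesis unfolding unit_ftr_def
    by (rule is_functor_ftr_on[OF assms category_H0[OF bimodule_times_bimod[OF assms]]])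
      (simp_all add: unit_ob_def hochschild_object_unit hochschild_morphism_unit assms)
qed

lemma unit_natural:
  assumes "is_functor P Q F"
  shows "comp_ftr P (unit_ftr A Q) F =
    comp_ftr P (H0_mor A (times_bimod A P) (times_bimod A Q) (times_mor A P Q F)) (unit_ftr A P)"
proof -
  interpret F: is_functor P Q F by fact
  interpret P: is_functor P "H0 A (times_bimod A P)" "unit_ftr A P"
    by (rule is_functor_unit[OF F.dom.category_axioms])
  note H0F = is_functor_H0_mor[OF bimodule_morphism_times_mor[OF assms]]
  note ob = H0_ob_times_mor[OF assms]
  show ?thesis
  proof (rule functor_eqI)
    show "is_functor P (H0 A (times_bimod A Q)) (comp_ftr P (unit_ftr A Q) F)"
      by (rule is_functor_comp[OF assms is_functor_unit[OF F.cod.category_axioms]])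
    show "is_functor P (H0 A (times_bimod A Q))
        (comp_ftr P (H0_mor A (times_bimod A P) (times_bimod A Q) (times_mor A P Q F)) (unit_ftr A P))"
      by (rule is_functor_comp[OF is_functor_unit[OF F.dom.category_axioms] H0F])
    show "FO (comp_ftr P (unit_ftr A Q) F) y = FO (comp_ftr P
        (H0_mor A (times_bimod A P) (times_bimod A Q) (times_mor A P Q F)) (unit_ftr A P)) y"
      if "y \<in> Ob P" for y
      using that P.FO_ob[OF that] by (simp add: ob del: P.FO_ob)
    show "FA (comp_ftr P (unit_ftr A Q) F) h = FA (comp_ftr P
        (H0_mor A (times_bimod A P) (times_bimod A Q) (times_mor A P Q F)) (unit_ftr A P)) h"
      if "h \<in> Ar P" for h
      using that P.FA_ar[OF that] by (simp add: ob del: P.FA_ar)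
  qed
qed

lemma unit_natural2:
  fixes t :: "('a, 'b, 'u) ucell"
  assumes t: "is_nat P Q (Src t) (Tgt t) (Cmp t)" and y: "y \<in> Ob P"
  shows "FA (unit_ftr A Q) (Cmp t y) =
    Cmp (H0_cell A (times_bimod A P) (times_bimod A Q) (times_cell A P Q t)) (FO (unit_ftr A P) y)"
proof -
  interpret t: is_nat P Q "Src t" "Tgt t" "Cmp t" by fact
  interpret P: is_functor P "H0 A (times_bimod A P)" "unit_ftr A P"
    by (rule is_functor_unit[OF t.src.dom.category_axioms])
  show ?thesis
    using P.FO_ob[OF y] y
    by (simp add: H0_ob_times_mor[OF t.src.is_functor_axioms]
      H0_ob_times_mor[OF t.tgt.is_functor_axioms] del: P.FO_ob)
qed

end

text \<open>On objects both sides are \<open>((x,\<xi>),b) \<mapsto> p(x)b = p(xb)\<close>. Their structure maps agree because \<open>\<rho>\<close>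
  is compatible with \<open>\<lambda>\<close>.\<close>
lemma counit_natural:
  assumes "bimodule_morphism A X Y p"
  shows "comp_bmor A (times_bimod A (H0 A X)) Y (counit_mor A Y) (times_mor A (H0 A X) (H0 A Y) (H0_mor A X Y p)) =
    comp_bmor A (times_bimod A (H0 A X)) Y p (counit_mor A X)"
proof -
  interpret p: bimodule_morphism A X Y p by fact
  note mor = bimodule_morphism_comp[OF p.X.A.bimodule_morphism_times_mor[OF is_functor_H0_mor[OF assms]]
      bimodule_morphism_counit[OF p.Y.bimodule_axioms]]
  note mor' = bimodule_morphism_comp[OF bimodule_morphism_counit[OF p.X.bimodule_axioms] assms]
  show ?thesis
  proof (rule bmor_eqI[of _ _ "Ob A" "Ob (Und (times_bimod A (H0 A X)))"])
    show "Fun (comp_bmor A (times_bimod A (H0 A X)) Y (counit_mor A Y) (times_mor A (H0 A X) (H0 A Y) (H0_mor A X Y p))) =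
      Fun (comp_bmor A (times_bimod A (H0 A X)) Y p (counit_mor A X))"
      by (rule functor_eqI[OF mor[THEN bimodule_morphism.axioms(3)] mor'[THEN bimodule_morphism.axioms(3)]])
        (auto elim!: times_ob_cases times_ar_cases H0_ob_cases H0_ar_cases
          simp: hochschild_object.x_ob hochschild_object_image[OF assms]
            hochschild_morphism_image[OF assms] hochschild_morphism_iff[of A X])
  next
    fix a u assume a: "a \<in> Ob A" and "u \<in> Ob (Und (times_bimod A (H0 A X)))"
    then obtain x \<xi> b where u: "u = Pr (Pr x (Fam \<xi>)) (AOb b)" "hochschild_object A X x \<xi>" "b \<in> Ob A"
      by (auto elim!: times_ob_cases H0_ob_cases)
    interpret x: hochschild_object A X x \<xi> by fact
    let ?px = "Pr (pO p x) (Fam (\<lambda>a\<in>Ob A. pA p (\<xi> a) \<cdot>\<^bsub>Und Y\<^esub> Rho p (a, x)))"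
    have px: "hochschild_object A Y (pO p x) (\<lambda>a\<in>Ob A. pA p (\<xi> a) \<cdot>\<^bsub>Und Y\<^esub> Rho p (a, x))"
      by (rule hochschild_object_image[OF assms u(2)])
    have id: "Pr (Id (Und Y) (pO p x)) (Pr ?px ?px) \<in> Ar (H0 A Y)"
      using px hochschild_morphism_id[OF px] by simp
    show "Rho (comp_bmor A (times_bimod A (H0 A X)) Y (counit_mor A Y) (times_mor A (H0 A X) (H0 A Y) (H0_mor A X Y p))) (a, u) =
      Rho (comp_bmor A (times_bimod A (H0 A X)) Y p (counit_mor A X)) (a, u)"
      using a u px id by (simp add: p.Y.Und.assoc p.rho_lam p.Y.ract_assoc del: H0_simps(2))
  qed (use bimodule_morphism.rho_ext[OF mor] bimodule_morphism.rho_ext[OF mor'] in simp_all)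
qed

lemma counit_natural2:
  fixes t :: "('a, 'b, 'u) ubcell"
  assumes t: "bimodule_cell A X Y (Src t) (Tgt t) (Cmp t)" and u: "u \<in> Ob (times_cat A (H0 A X))"
  shows "pA (counit_mor A Y) (Cmp (times_cell A (H0 A X) (H0 A Y) (H0_cell A X Y t)) u) =
    Cmp t (pO (counit_mor A X) u)"
proof -
  interpret t: bimodule_cell A X Y "Src t" "Tgt t" "Cmp t" by fact
  interpret t': is_nat "H0 A X" "H0 A Y" "H0_mor A X Y (Src t)" "H0_mor A X Y (Tgt t)" "Cmp (H0_cell A X Y t)"
    by (rule is_nat_H0_cell[OF t])
  obtain x b where u: "u = Pr x (AOb b)" "x \<in> Ob (H0 A X)" "b \<in> Ob A"
    using u by (rule times_ob_cases)
  have "pfst x \<in> Ob (Und X)" using u(2) by (auto elim!: H0_ob_cases simp: hochschild_object.x_ob)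
  then show ?thesis
    using t'.cmp_ar(1)[OF u(2)] u by (simp add: t.cell_right del: t'.cmp_ar(1))
qed

text \<open>On objects, \<open>(y,i)b = (y,b)\<close>; the structure map is an identity, both \<open>\<xi>\<close> and \<open>\<lambda>\<close> being identities here.\<close>
lemma (in strict_monoidal_category) triangle_times:
  assumes "category P"
  shows "comp_bmor A (times_bimod A P) (times_bimod A P) (counit_mor A (times_bimod A P))
    (times_mor A P (H0 A (times_bimod A P)) (unit_ftr A P)) = id_bmor A (times_bimod A P)"
proof -
  interpret P: category P by fact
  interpret U: is_functor P "H0 A (times_bimod A P)" "unit_ftr A P"
    by (rule is_functor_unit[OF assms])
  note AP = bimodule_times_bimod[OF assms]
  note mor = bimodule_morphism_comp[OF bimodule_morphism_times_mor[OF is_functor_unit[OF assms]]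
    bimodule_morphism_counit[OF AP]]
  note mor' = bimodule_morphism_id[OF AP]
  have ob: "unit_ob A P y \<in> Ob (H0 A (times_bimod A P))" if "y \<in> Ob P" for y
    using U.FO_ob[OF that] that by (simp del: U.FO_ob)
  have ar: "Pr (Pr h (AAr (Id A (Unt A)))) (Pr (unit_ob A P (Dom P h)) (unit_ob A P (Cod P h)))
      \<in> Ar (H0 A (times_bimod A P))" if "h \<in> Ar P" for h
    using U.FA_ar[OF that] that by (simp del: U.FA_ar)
  show ?thesis
  proof (rule bmor_eqI[of _ _ "Ob A" "Ob (Und (times_bimod A P))"])
    show "Fun (comp_bmor A (times_bimod A P) (times_bimod A P) (counit_mor A (times_bimod A P))
      (times_mor A P (H0 A (times_bimod A P)) (unit_ftr A P))) = Fun (id_bmor A (times_bimod A P))"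
      by (rule functor_eqI[OF mor[THEN bimodule_morphism.axioms(3)] mor'[THEN bimodule_morphism.axioms(3)]])
        (auto elim!: times_ob_cases times_ar_cases simp: ob ar)
  next
    fix a u assume a: "a \<in> Ob A" and "u \<in> Ob (Und (times_bimod A P))"
    then obtain y b where u: "u = Pr y (AOb b)" "y \<in> Ob P" "b \<in> Ob A"
      by (auto elim!: times_ob_cases)
    show "Rho (comp_bmor A (times_bimod A P) (times_bimod A P) (counit_mor A (times_bimod A P))
      (times_mor A P (H0 A (times_bimod A P)) (unit_ftr A P))) (a, u) = Rho (id_bmor A (times_bimod A P)) (a, u)"
      using a u ob[OF u(2)] ar[of "Id P y"] 
      by (simp add: hochschild_object_unit[OF assms] ten_id unit_ob_def del: H0_simps(2))
  qed (use bimodule_morphism.rho_ext[OF mor] bimodule_morphism.rho_ext[OF mor'] in simp_all)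
qed

text \<open>The Hochschild structure obtained on \<open>xi = x\<close> is \<open>(\<xi>\<^sub>a)i \<circ> \<lambda>\<^bsub>a,x,i\<^esub> = \<xi>\<^sub>a\<close>. Equality of the families
  as HOL functions needs \<open>\<xi>\<close> to be extensional.\<close>
lemma triangle_H0:
  assumes "bimodule A X"
  shows "comp_ftr (H0 A X) (H0_mor A (times_bimod A (H0 A X)) X (counit_mor A X)) (unit_ftr A (H0 A X)) =
    id_ftr (H0 A X)"
proof -
  interpret X: bimodule A X by fact
  interpret H0: category "H0 A X" by (rule category_H0[OF assms])
  interpret U: is_functor "H0 A X" "H0 A (times_bimod A (H0 A X))" "unit_ftr A (H0 A X)"
    by (rule X.A.is_functor_unit[OF H0.category_axioms])
  have ob: "H0_ob A X (counit_mor A X) (unit_ob A (H0 A X) u) = u" if u: "u \<in> Ob (H0 A X)" for u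
  proof -
    obtain x \<xi> where x: "u = Pr x (Fam \<xi>)" "hochschild_object A X x \<xi>"
      using u by (rule H0_ob_cases)
    interpret x: hochschild_object A X x \<xi> by fact
    have *: "(\<lambda>a\<in>Ob A. pA (counit_mor A X) ((\<lambda>a\<in>Ob A. Pr (Id (H0 A X) u) (AAr (Id A a))) a) \<cdot>\<^bsub>Und X\<^esub>
        Rho (counit_mor A X) (a, Pr u (AOb (Unt A)))) = \<xi>"
      by (rule extensionalityI[OF _ x.xi_ext])
        (use x(2) hochschild_morphism_id[OF x(2)] in \<open>simp_all add: x(1)\<close>)
    show ?thesis unfolding unit_ob_def H0_ob_Pr * using x by simp
  qed
  show ?thesis
  proof (rule functor_eqI)
    show "is_functor (H0 A X) (H0 A X)
        (comp_ftr (H0 A X) (H0_mor A (times_bimod A (H0 A X)) X (counit_mor A X)) (unit_ftr A (H0 A X)))"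
      by (rule is_functor_comp[OF U.is_functor_axioms is_functor_H0_mor[OF bimodule_morphism_counit[OF assms]]])
    show "is_functor (H0 A X) (H0 A X) (id_ftr (H0 A X))" by (simp add: H0.category_axioms)
    show "FO (comp_ftr (H0 A X) (H0_mor A (times_bimod A (H0 A X)) X (counit_mor A X)) (unit_ftr A (H0 A X))) u =
        FO (id_ftr (H0 A X)) u" if "u \<in> Ob (H0 A X)" for u
      using that U.FO_ob[OF that] by (simp add: ob del: U.FO_ob)
    show "FA (comp_ftr (H0 A X) (H0_mor A (times_bimod A (H0 A X)) X (counit_mor A X)) (unit_ftr A (H0 A X))) k =
        FA (id_ftr (H0 A X)) k" if k: "k \<in> Ar (H0 A X)" for k
    proof -
      have "FA (comp_ftr (H0 A X) (H0_mor A (times_bimod A (H0 A X)) X (counit_mor A X)) (unit_ftr A (H0 A X))) k =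
        Pr (rA X (pfst k) (Id A (Unt A))) (Pr (Dom (H0 A X) k) (Cod (H0 A X) k))"
        using k U.FA_ar[OF k] by (simp add: ob del: U.FA_ar)
      also have "\<dots> = k" using k by (auto elim!: H0_ar_cases simp: hochschild_morphism_iff)
      finally show ?thesis using k by simp
    qed
  qed
qed

lemma id_two_ftr_simps [simp]:
  "T0 (id_two_ftr K) x = x" "T1 (id_two_ftr K) x y = id_ftr (HomC K x y)"
  by (simp_all add: id_two_ftr_def)

lemma comp_two_ftr_simps [simp]:
  "T0 (comp_two_ftr K S T) x = T0 S (T0 T x)"
  "T1 (comp_two_ftr K S T) x y = comp_ftr (HomC K x y) (T1 S (T0 T x) (T0 T y)) (T1 T x y)"
  by (simp_all add: comp_two_ftr_def)

context strict_monoidal_category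
begin

abbreviation CatU :: "(('a, 'b, 'u) ucat, ('a, 'b, 'u) uftr, ('a, 'b, 'u) ucell) two_cat" where
  "CatU \<equiv> Cat2"

abbreviation BimodU :: "(('a, 'b, 'u) ubimod, ('a, 'b, 'u) ubmor, ('a, 'b, 'u) ubcell) two_cat" where
  "BimodU \<equiv> Bimod2 A"

lemma two_natural_unit:
  "two_natural CatU CatU (id_two_ftr CatU) (comp_two_ftr CatU (H0_two_ftr A) (Times2 A)) (unit_ftr A)"
proof (rule two_natural.intro[OF two_functor_id[OF two_category_Cat2]
      two_functor_comp[OF two_functor_Times2 two_functor_H0]], rule two_natural_axioms.intro)
  fix P :: "('a, 'b, 'u) ucat" assume "P \<in> Obj Cat2"
  then show "unit_ftr A P \<in> Ob (HomC Cat2 (T0 (id_two_ftr Cat2) P)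
      (T0 (comp_two_ftr Cat2 (H0_two_ftr A) (Times2 A)) P))"
    by (simp add: is_functor_unit)
next
  fix P Q :: "('a, 'b, 'u) ucat" and F assume "P \<in> Obj Cat2" "Q \<in> Obj Cat2" "F \<in> Ob (HomC Cat2 P Q)"
  then show "FO (HC Cat2 (T0 (id_two_ftr Cat2) P) (T0 (id_two_ftr Cat2) Q)
        (T0 (comp_two_ftr Cat2 (H0_two_ftr A) (Times2 A)) Q)) (unit_ftr A Q, FO (T1 (id_two_ftr Cat2) P Q) F) =
      FO (HC Cat2 (T0 (id_two_ftr Cat2) P) (T0 (comp_two_ftr Cat2 (H0_two_ftr A) (Times2 A)) P)
        (T0 (comp_two_ftr Cat2 (H0_two_ftr A) (Times2 A)) Q))
       (FO (T1 (comp_two_ftr Cat2 (H0_two_ftr A) (Times2 A)) P Q) F, unit_ftr A P)"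
    by (simp add: is_functor_unit bimodule_morphism_times_mor is_functor_H0_mor unit_natural)
next
  fix P Q :: "('a, 'b, 'u) ucat" and t assume PQ: "P \<in> Obj Cat2" "Q \<in> Obj Cat2" "t \<in> Ar (HomC Cat2 P Q)"
  then interpret t: is_nat P Q "Src t" "Tgt t" "Cmp t" by simp
  note t' = bimodule_cell_times_cell[OF t.is_nat_axioms]
  interpret P: is_functor P "H0 A (times_bimod A P)" "unit_ftr A P"
    by (rule is_functor_unit[OF t.src.dom.category_axioms])
  interpret Q: is_functor Q "H0 A (times_bimod A Q)" "unit_ftr A Q"
    by (rule is_functor_unit[OF t.src.cod.category_axioms])
  note t'' = is_nat_H0_cell[OF t']
  interpret t'': is_nat "H0 A (times_bimod A P)" "H0 A (times_bimod A Q)"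
    "H0_mor A (times_bimod A P) (times_bimod A Q) (times_mor A P Q (Src t))"
    "H0_mor A (times_bimod A P) (times_bimod A Q) (times_mor A P Q (Tgt t))"
    "Cmp (H0_cell A (times_bimod A P) (times_bimod A Q) (times_cell A P Q t))"
    using t'' by simp
  have cod: "FO (H0_mor A (times_bimod A P) (times_bimod A Q) (times_mor A P Q (Tgt t))) (FO (unit_ftr A P) y) =
      FO (unit_ftr A Q) (FO (Tgt t) y)" if "y \<in> Ob P" for y
    using arg_cong[OF unit_natural[OF t.tgt.is_functor_axioms], of "\<lambda>F. FO F y"] that
    by (simp del: unit_ftr_simps H0_mor_simps)
  show "FA (HC Cat2 (T0 (id_two_ftr Cat2) P) (T0 (id_two_ftr Cat2) Q)
        (T0 (comp_two_ftr Cat2 (H0_two_ftr A) (Times2 A)) Q))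
       (Id (HomC Cat2 (T0 (id_two_ftr Cat2) Q) (T0 (comp_two_ftr Cat2 (H0_two_ftr A) (Times2 A)) Q)) (unit_ftr A Q),
        FA (T1 (id_two_ftr Cat2) P Q) t) =
      FA (HC Cat2 (T0 (id_two_ftr Cat2) P) (T0 (comp_two_ftr Cat2 (H0_two_ftr A) (Times2 A)) P)
        (T0 (comp_two_ftr Cat2 (H0_two_ftr A) (Times2 A)) Q))
       (FA (T1 (comp_two_ftr Cat2 (H0_two_ftr A) (Times2 A)) P Q) t,
        Id (HomC Cat2 (T0 (id_two_ftr Cat2) P) (T0 (comp_two_ftr Cat2 (H0_two_ftr A) (Times2 A)) P)) (unit_ftr A P))"
    using PQ t' t'' is_nat_id[OF P.is_functor_axioms] is_nat_id[OF Q.is_functor_axioms]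
    by (intro cell_eqI[of _ _ "Ob P"])
      (simp_all add: unit_natural[OF t.src.is_functor_axioms] unit_natural[OF t.tgt.is_functor_axioms]
        unit_natural2 cod del: unit_ftr_simps H0_simps H0_mor_simps H0_cell_simps(4))
qed

lemma two_natural_counit:
  "two_natural BimodU BimodU (comp_two_ftr BimodU (Times2 A) (H0_two_ftr A)) (id_two_ftr BimodU) (counit_mor A)"
proof (rule two_natural.intro[OF two_functor_comp[OF two_functor_H0 two_functor_Times2]
      two_functor_id[OF two_category_Bimod2]], rule two_natural_axioms.intro)
  let ?S = "comp_two_ftr BimodU (Times2 A) (H0_two_ftr A)" and ?I = "id_two_ftr BimodU"
  fix X :: "('a, 'b, 'u) ubimod" assume "X \<in> Obj BimodU"
  then show "counit_mor A X \<in> Ob (HomC BimodU (T0 ?S X) (T0 ?I X))"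
    by (simp add: bimodule_morphism_counit)
next
  let ?S = "comp_two_ftr BimodU (Times2 A) (H0_two_ftr A)" and ?I = "id_two_ftr BimodU"
  fix X Y :: "('a, 'b, 'u) ubimod" and p assume "X \<in> Obj BimodU" "Y \<in> Obj BimodU" "p \<in> Ob (HomC BimodU X Y)"
  then show "FO (HC BimodU (T0 ?S X) (T0 ?S Y) (T0 ?I Y)) (counit_mor A Y, FO (T1 ?S X Y) p) =
      FO (HC BimodU (T0 ?S X) (T0 ?I X) (T0 ?I Y)) (FO (T1 ?I X Y) p, counit_mor A X)"
    by (simp add: bimodule_morphism_counit bimodule_morphism_times_mor is_functor_H0_mor counit_natural)
next
  let ?S = "comp_two_ftr BimodU (Times2 A) (H0_two_ftr A)" and ?I = "id_two_ftr BimodU"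
  fix X Y :: "('a, 'b, 'u) ubimod" and t
  assume a: "X \<in> Obj BimodU" "Y \<in> Obj BimodU" "t \<in> Ar (HomC BimodU X Y)"
  then interpret t: bimodule_cell A X Y "Src t" "Tgt t" "Cmp t" by simp
  interpret X: bimodule_morphism A "times_bimod A (H0 A X)" X "counit_mor A X"
    by (rule bimodule_morphism_counit[OF t.src.X.bimodule_axioms])
  interpret Y: bimodule_morphism A "times_bimod A (H0 A Y)" Y "counit_mor A Y"
    by (rule bimodule_morphism_counit[OF t.src.Y.bimodule_axioms])
  note t' = is_nat_H0_cell[OF t.bimodule_cell_axioms]
  note t'' = bimodule_cell_times_cell[of _ _ "H0_cell A X Y t", simplified, OF t']
  interpret t'': bimodule_cell A "times_bimod A (H0 A X)" "times_bimod A (H0 A Y)"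
      "times_mor A (H0 A X) (H0 A Y) (H0_mor A X Y (Src t))"
      "times_mor A (H0 A X) (H0 A Y) (H0_mor A X Y (Tgt t))"
      "Cmp (times_cell A (H0 A X) (H0 A Y) (H0_cell A X Y t))"
    by (rule t'')
  have ob: "pO (times_mor A (H0 A X) (H0 A Y) (H0_mor A X Y (Tgt t))) u \<in> Ob (times_cat A (H0 A Y))"
      "pO (counit_mor A X) u \<in> Ob (Und X)"
    if "u \<in> Ob (times_cat A (H0 A X))" for u
    using t''.tgt.Fun.FO_ob X.Fun.FO_ob that by simp_all
  have cod: "pO (counit_mor A Y) (pO (times_mor A (H0 A X) (H0 A Y) (H0_mor A X Y (Tgt t))) u) =
      pO (Tgt t) (pO (counit_mor A X) u)" if "u \<in> Ob (times_cat A (H0 A X))" for u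
    using arg_cong[OF counit_natural[OF t.tgt.bimodule_morphism_axioms], of "\<lambda>p. pO p u"] that
    by (simp del: times_mor_simps)
  show "FA (HC BimodU (T0 ?S X) (T0 ?S Y) (T0 ?I Y))
       (Id (HomC BimodU (T0 ?S Y) (T0 ?I Y)) (counit_mor A Y), FA (T1 ?S X Y) t) =
      FA (HC BimodU (T0 ?S X) (T0 ?I X) (T0 ?I Y))
       (FA (T1 ?I X Y) t, Id (HomC BimodU (T0 ?S X) (T0 ?I X)) (counit_mor A X))"
    using a t' t'' bimodule_cell_id[OF X.bimodule_morphism_axioms]
      bimodule_cell_id[OF Y.bimodule_morphism_axioms]
    by (intro cell_eqI[of _ _ "Ob (times_cat A (H0 A X))"])
      (simp_all add: counit_natural[OF t.src.bimodule_morphism_axioms]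
        counit_natural[OF t.tgt.bimodule_morphism_axioms] counit_natural2 ob cod del: times_mor_simps)
qed

lemma two_adjunction_Times2_H0:
  "two_adjunction CatU BimodU (Times2 A) (H0_two_ftr A) (unit_ftr A) (counit_mor A)"
  by (intro two_adjunction.intro two_adjunction_axioms.intro two_functor_Times2 two_functor_H0
      two_natural_unit two_natural_counit)
    (simp_all add: is_functor_unit bimodule_times_bimod category_H0 bimodule_morphism_times_mor
      bimodule_morphism_counit is_functor_H0_mor triangle_times triangle_H0)

end

theorem theorem4p3:
  fixes A :: "('a, 'b) smc"
  assumes "strict_monoidal_category A"
  shows "\<exists>(R :: (('a, 'b, 'u) ubimod, ('a, 'b, 'u) ubmor, ('a, 'b, 'u) ubcell,
               ('a, 'b, 'u) ucat, ('a, 'b, 'u) uftr, ('a, 'b, 'u) ucell) two_ftr) \<eta> \<epsilon>.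
    two_adjunction Cat2 (Bimod2 A) (Times2 A) R \<eta> \<epsilon> \<and>
    (\<forall>X\<in>Obj (Bimod2 A). T0 R X = H0 A X)"
  using strict_monoidal_category.two_adjunction_Times2_H0[OF assms] H0_two_ftr_simps(1) by metis

end
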